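(* Let $\bm{}(S_t)_{t\in[0,1]}$ be a stochastic process in $\mathbb R^d$ with law $\mathsf S$ and $X_t=AS_t$ with law $\mathsf X=A\mathsf S$, where $(\mathsf S,A)\in\mathscr I_\star$. Let $(\hat\mu_n)\subset\dot{\mathfrak D}$ be a consistent estimator of $\mathsf X$ with $\max_{|w|=2,3}|\langle\hat\mu_n\rangle_w-\langle\mathsf X\rangle_w|=O_P(\tilde\alpha_n)$ for some convergence rate $(\tilde\alpha_n)$. Then for any $\varepsilon>0$ and any $0\le q<1$ there exists an explicitly computable $n_0=n_0(\varepsilon,q,(\tilde\alpha_n),(\hat\mu_n),A,\mathsf S)\in\mathbb N$ such that for each $n\ge n_0$ the following holds with probability at least $q$: for every $\hat\theta\in\hat\Phi(\hat\mu_n)$ there is $M\in\mathrm M_d$ such that $$\sup_{t\in[0,1]}\frac{|\hat\theta X_t-MS_t|}{|MS_t|}\mathbf 1_{\{S_t\ne0\}}\le\varepsilon .$$ In explicit terms, one such threshold is $$n_0=\min\Big\{n\ge m_{1-q}\ \Big|\ \tilde\alpha_n<\frac{\eta(\tilde\delta(\varepsilon/\tilde c_4))}{(1+\|A^{-1}\|_\infty)^3M_{1-q}}\Big\},$$ where $m_{1-q},M_{1-q}$ are as in the definition of convergence rate, $\tilde c_4$ and $\tilde\delta(\cdot)$ are the robustness constants of $(\mathsf S,A)$ described in the context, and $\eta=\omega_\varphi^{-1}:\mathbb R_+\to\mathbb R_+$ is the inverse of $\omega_\varphi(\tilde\eta)=\sup\{\varphi(v)\mid v\in\mathcal V,\ \|v-[\mathsf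 S]_{\mathfrak c}\|_\infty\le\tilde\eta\}$, with $\varphi:\mathcal V\to\mathbb R_+$ defined in the context.
   Context: Signals. Fix $d\ge2$. $\mathcal C_d$: continuous paths $[0,1]\to\mathbb R^d$ with the sup-norm; $\mathfrak D$: Borel probability measures on $\mathcal C_d$ giving full mass to the absolutely continuous paths. For a word $w=i_1\cdots i_m$ over $[d]$: $\mathfrak{sig}_w(x)=\int_{0\le t_1\le\cdots\le t_m\le1}dx^{i_1}_{t_1}\cdots dx^{i_m}_{t_m}$, $\langle\mu\rangle_w=\int\mathfrak{sig}_wd\mu$, $|w|=m$. $[\mu]_0=(\langle\mu\rangle_{ij})_{ij}$, $[\mu]_\nu=(\langle\mu\rangle_{ij\nu})_{ij}$, $[\mu]_{\mathfrak c}=([\mu]_0,\dots,[\mu]_d)\in\mathcal V:=(\mathbb R^{d\times d})^{d+1}$; $\|\cdot\|_\infty$ on $\mathcal V$ is the maximum of absolute values of entries. $\dot{\mathfrak D}$: those $\mu\in\mathfrak D$ with $[\mu]_{\mathfrak c}$ finite and $\langle\mu\rangle_{ii}\ne0$ for all $i$. $A\mu$: push-forward of $\mu$ under $x\mapsto(Ax_t)_t$. $\|\cdot\|$: Frobenius norm; $\|\cdot\|_2$: spectral norm; $\|A^{-1}\|_\infty$: operator norm induced by the $\ell_\infty$-norm; $\kappa_2(B)=\|B\|_2\|B^{-1}\|_2$; $\mathrm M_d$: monomial matrices (invertible diagonal times permutation). $D_\mu$: closure of $\bigcup_t\mathrm{supp}(\mu_t)$. With $N_\mu=\mathrm{diag}(\langle\mu\rangle_{11},\dots,\langle\mu\rangle_{dd})^{1/2}$,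 for $v=(v_0,\dots,v_d)\in\mathcal V$ put $$\varphi(v)^2=\|N_{\mathsf S}^{-1}(v_0-[\mathsf S]_0)N_{\mathsf S}^{-1}\|^2+\sum_{\nu=1}^d\langle\mathsf S\rangle_{\nu\nu}^{-1}\|N_{\mathsf S}^{-1}(v_\nu-[\mathsf S]_\nu)N_{\mathsf S}^{-1}\|^2,\qquad \delta(\mathsf S,\mu)=\varphi([\mu]_{\mathfrak c}).$$ Causes: $C_\mu=\frac12([\mu]_0+[\mu]_0^\top)$. $\mathscr I_\star=\mathscr S_\star\times\mathrm{GL}_d$, where $\mathscr S_\star$ is the set of $\mu\in\dot{\mathfrak D}$ with $C_\mu$ invertible, $\langle\mu\rangle_{iii}=0$ for at most one $i$, and $\langle\mu\rangle_{ij}=\delta_{ij}\langle\mu\rangle_{ij}$, $\langle\mu\rangle_{ijk}=\delta_{ijk}\langle\mu\rangle_{ijk}$ for all $i,j,k$. Inversion map: for invertible $C_\mu$, $R_{(\mu)}=C_\mu^{-1/2}$. For $\theta\in\mathrm{GL}_d$: $\mathfrak x_0(\theta)=N_{\theta\mu}^{-1}[\theta\mu]_0N_{\theta\mu}^{-1}$, $\mathfrak x_\nu(\theta)=\langle\theta\mu\rangle_{\nu\nu}^{-1/2}N_{\theta\mu}^{-1}[\theta\mu]_\nu N_{\theta\mu}^{-1}$; $\phi_\mu(\theta)=\sum_{\nu=0}^d\|\mathfrak x_\nu(\theta R_{(\mu)})\|_\times^2$ with $\|T\|_\times$ the Frobenius norm of the off-diagonal part. $\tilde\Xi_1$: matrices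 $\theta\in\mathrm{GL}_d$ with rows of Euclidean norm $1$ and $\kappa_2(\theta)\le\tilde\kappa_0:=b+\Delta_\kappa$, where $\Delta_\kappa>0$ is fixed and $b=\kappa_2(\bar B_{(A,\mathsf S)})$, $\bar B_{(A,\mathsf S)}$ being $(R_{(A\mathsf S)}A)^{-1}$ with rows rescaled to Euclidean norm one. $\hat\Phi(\mu)=\{\theta R_{(\mu)}\mid\theta\in\arg\min_{\tilde\Xi_1}\phi_\mu\}$ (arbitrary non-empty compact subset of $\mathrm{GL}_d$ if $C_\mu$ is not invertible). Robustness constants: $\tilde c_0,\dots,\tilde c_4>0$ are the constants, depending only on $(\mathsf S,A,\tilde\kappa_0)$, provided by the paper's robustness theorem (linear mixing case), namely such that for every $\epsilon>0$, with $\tilde\delta(\epsilon)=\min\{\tilde c_0,\tilde c_1^2(\epsilon/(\tilde c_2+\epsilon))^2\}$, every $\mu\in\dot{\mathfrak D}$ with $\delta(\mathsf S,\mu)<\tilde\delta(\epsilon)$ and every $\theta\in\hat\Phi(A\mu)$ there are $M\in\mathrm M_d$ with $\|M\|\le\tilde c_3$, $\kappa_2(M)\le\tilde c_4$, and $E\in\mathbb R^{d\times d}$ with $\|E\|\le\epsilon$ and $\theta=M(\mathrm I+E)A^{-1}$; and $$\sup_{B\in\hat\Phi(A\mu)}\inf_{(M,v)\in\mathrm M_d\times\mathbb R^d}\sup_{u\in v+D_\mu}\frac{|BA(u-v)-Mu|}{|Mu|}\mathbf 1_{\{Mu\ne0\}}\le\tilde c_4\epsilon.$$ Estimators: $\hat\mu_n$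 are random elements of $\dot{\mathfrak D}$ on the underlying probability space; consistent means $\langle\hat\mu_n\rangle_w\to\langle\mathsf X\rangle_w$ as $n\to\infty$, almost surely or in probability, for each $|w|=2,3$. A convergence rate is a strictly decreasing null sequence $(\tilde\alpha_n)$ such that, with $\gamma_n=\max_{|w|=2,3}|\langle\hat\mu_n\rangle_w-\langle\mathsf X\rangle_w|$, for any $\epsilon>0$ there are $0<m_\epsilon,M_\epsilon<\infty$ with $\sup_{n\ge m_\epsilon}\mathbb P(\gamma_n\ge M_\epsilon\tilde\alpha_n)\le\epsilon$; this is written $\gamma_n=O_P(\tilde\alpha_n)$. Quotients with vanishing denominator are read as $0$. *)

theory Defs
  imports "HOL-Probability.Probability"
begin

section \<open>The path space\<close>

typedef unit_interval = "{0..1::real}"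
  morphisms real_of_ui Ui
  by (rule exI[of _ 0]) simp

setup_lifting type_definition_unit_interval

instantiation unit_interval :: metric_space
begin

lift_definition dist_unit_interval :: "unit_interval \<Rightarrow> unit_interval \<Rightarrow> real" is "dist" .

definition uniformity_unit_interval :: "(unit_interval \<times> unit_interval) filter"
  where "uniformity_unit_interval = (INF e\<in>{0 <..}. principal {(x, y). dist x y < e})"

definition open_unit_interval :: "unit_interval set \<Rightarrow> bool"
  where "open_unit_interval U = (\<forall>x\<in>U. \<forall>\<^sub>F (x', y) in uniformity. x' = x \<longrightarrow> y \<in> U)"

instance
proof
  show "(dist x y = 0) = (x = y)" for x y :: unit_interval
    by transfer simp
  show "dist x y \<le> dist x z + dist y z" for x y z :: unit_interval
    by transfer (rule dist_triangle2)
qed (rule open_unit_interval_def uniformity_unit_interval_def)+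

end

text \<open>\<open>bcontfun\<close> carries the sup-metric, and every continuous path on the compact unit
  interval is bounded. Hence \<open>borel\<close> on this type is the Borel sigma-algebra of the path space
  with the sup-norm.\<close>

type_synonym 'd path = "unit_interval \<Rightarrow>\<^sub>C (real ^ 'd)"

definition at_time :: "'d::finite path \<Rightarrow> real \<Rightarrow> real ^ 'd"
  where "at_time x t = apply_bcontfun x (Ui t)"

definition mat_path :: "real ^ 'd ^ 'd \<Rightarrow> 'd::finite path \<Rightarrow> 'd path"
  where "mat_path A x = Bcontfun (\<lambda>t. A *v apply_bcontfun x t)"

lemma apply_mat_path [simp]:
  fixes A :: "real ^ 'd ^ 'd" and x :: "'d::finite path"
  shows "apply_bcontfun (mat_path A x) t = A *v apply_bcontfun x t"
proof -
  have "bounded ((\<lambda>v. A *v v) ` range (apply_bcontfun x))"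
    by (intro bounded_linear_image bounded_apply_bcontfun matrix_vector_mul_bounded_linear)
  moreover have "continuous_on UNIV (\<lambda>t. A *v apply_bcontfun x t)"
    by (intro bounded_linear.continuous_on[OF matrix_vector_mul_bounded_linear]
        continuous_on_apply_bcontfun)
  ultimately have "(\<lambda>t. A *v apply_bcontfun x t) \<in> bcontfun"
    by (simp add: bcontfun_def image_image)
  then show ?thesis
    by (simp add: mat_path_def Bcontfun_inverse)
qed

definition mat_push :: "real ^ 'd ^ 'd \<Rightarrow> 'd::finite path measure \<Rightarrow> 'd path measure"
  where "mat_push A \<mu> = distr \<mu> borel (mat_path A)"

definition abs_cont_on :: "real \<Rightarrow> real \<Rightarrow> (real \<Rightarrow> 'a::metric_space) \<Rightarrow> bool"
  where "abs_cont_on a b f \<longleftrightarrow>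
    (\<forall>e>0. \<exists>\<delta>>0. \<forall>D. finite D \<and> (\<forall>(u, v)\<in>D. a \<le> u \<and> u \<le> v \<and> v \<le> b)
        \<and> pairwise (\<lambda>(u, v) (u', v'). disjnt {u<..<v} {u'<..<v'}) D
        \<and> (\<Sum>(u, v)\<in>D. v - u) < \<delta>
      \<longrightarrow> (\<Sum>(u, v)\<in>D. dist (f u) (f v)) < e)"

abbreviation ac_path :: "'d::finite path \<Rightarrow> bool"
  where "ac_path x \<equiv> abs_cont_on 0 1 (at_time x)"

definition signal_laws :: "'d::finite path measure set"
  where "signal_laws = {\<mu>. sets \<mu> = sets borel \<and> prob_space \<mu> \<and> (AE x in \<mu>. ac_path x)}"

section \<open>Iterated integrals and coordinates\<close>

text \<open>Riemann--Stieltjes integral over \<open>[a, b]\<close>. A tagged division that is fine for balls of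
  constant radius \<open>\<delta>\<close> has mesh at most \<open>2 * \<delta>\<close>.\<close>

definition has_rs_integral ::
  "(real \<Rightarrow> real) \<Rightarrow> (real \<Rightarrow> real) \<Rightarrow> real \<Rightarrow> real \<Rightarrow> real \<Rightarrow> bool"
  where "has_rs_integral f g a b I \<longleftrightarrow>
    (\<forall>e>0. \<exists>\<delta>>0. \<forall>p. p tagged_division_of {a..b} \<and> (\<lambda>s. ball s \<delta>) fine p \<longrightarrow>
      \<bar>(\<Sum>(s, K)\<in>p. f s * (g (Sup K) - g (Inf K))) - I\<bar> < e)"

definition rs_integral :: "(real \<Rightarrow> real) \<Rightarrow> (real \<Rightarrow> real) \<Rightarrow> real \<Rightarrow> real \<Rightarrow> real"
  where "rs_integral f g a b = (THE I. has_rs_integral f g a b I)"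

text \<open>\<open>iter_int [i\<^sub>m, \<dots>, i\<^sub>1] x t\<close> is the iterated integral over
  \<open>0 \<le> t\<^sub>1 \<le> \<dots> \<le> t\<^sub>m \<le> t\<close>; the letters are listed in reverse, so that the head is integrated
  last (outermost).\<close>

primrec iter_int :: "'d list \<Rightarrow> 'd::finite path \<Rightarrow> real \<Rightarrow> real"
  where
    "iter_int [] x t = 1"
  | "iter_int (i # w) x t = rs_integral (iter_int w x) (\<lambda>s. at_time x s $ i) 0 t"

text \<open>The value \<open>0\<close> off the absolutely continuous paths is irrelevant under the measures
  considered; it keeps \<open>sig w\<close> Borel measurable.\<close>

definition sig :: "'d list \<Rightarrow> 'd::finite path \<Rightarrow> real"
  where "sig w x = (if ac_path x then iter_int (rev w) x 1 else 0)"

definition esig :: "'d::finite path measure \<Rightarrow> 'd list \<Rightarrow> real"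
  where "esig \<mu> w = (\<integral>x. sig w x \<partial>\<mu>)"

definition words23 :: "'d::finite list set"
  where "words23 = {w. length w = 2 \<or> length w = 3}"

definition coord0 :: "'d::finite path measure \<Rightarrow> real ^ 'd ^ 'd"
  where "coord0 \<mu> = (\<chi> i j. esig \<mu> [i, j])"

definition coord :: "'d::finite path measure \<Rightarrow> 'd \<Rightarrow> real ^ 'd ^ 'd"
  where "coord \<mu> \<nu> = (\<chi> i j. esig \<mu> [i, j, \<nu>])"

text \<open>The space \<open>\<V>\<close> of tuples \<open>(v\<^sub>0, (v\<^sub>\<nu>)\<^sub>\<nu>)\<close>. Its \<open>infnorm\<close> is the maximum of the absolute
  values of all matrix entries, and \<open>norm\<close> on square matrices is the Frobenius norm.\<close>

type_synonym 'd coords = "(real ^ 'd ^ 'd) \<times> ((real ^ 'd ^ 'd) ^ 'd)"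

definition coords :: "'d::finite path measure \<Rightarrow> 'd coords"
  where "coords \<mu> = (coord0 \<mu>, (\<chi> \<nu>. coord \<mu> \<nu>))"

definition finite_coords :: "'d::finite path measure \<Rightarrow> bool"
  where "finite_coords \<mu> \<longleftrightarrow> (\<forall>w\<in>words23. integrable \<mu> (sig w))"

definition signal_laws_dot :: "'d::finite path measure set"
  where "signal_laws_dot =
    {\<mu>\<in>signal_laws. finite_coords \<mu> \<and> (\<forall>i. esig \<mu> [i, i] \<noteq> 0)}"

section \<open>Matrices\<close>

definition diag_mat :: "('d \<Rightarrow> real) \<Rightarrow> real ^ 'd ^ 'd::finite"
  where "diag_mat c = (\<chi> i j. if i = j then c i else 0)"

definition monomial_mats :: "(real ^ 'd ^ 'd::finite) set"
  where "monomial_mats =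
    {diag_mat c ** (\<chi> i j. of_bool (j = \<pi> i)) |c \<pi>. (\<forall>i. c i \<noteq> 0) \<and> \<pi> permutes UNIV}"

definition spectral_norm :: "real ^ 'd ^ 'd::finite \<Rightarrow> real"
  where "spectral_norm B = onorm ((*v) B)"

definition cond2 :: "real ^ 'd ^ 'd::finite \<Rightarrow> real"
  where "cond2 B = spectral_norm B * spectral_norm (matrix_inv B)"

definition linf_opnorm :: "real ^ 'd ^ 'd::finite \<Rightarrow> real"
  where "linf_opnorm B = (SUP x\<in>{x. infnorm x \<le> 1}. infnorm (B *v x))"

definition offdiag :: "real ^ 'd ^ 'd::finite \<Rightarrow> real ^ 'd ^ 'd"
  where "offdiag T = (\<chi> i j. if i = j then 0 else T $ i $ j)"

definition normalize_rows :: "real ^ 'd ^ 'd::finite \<Rightarrow> real ^ 'd ^ 'd"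
  where "normalize_rows B = (\<chi> i. row i B /\<^sub>R norm (row i B))"

definition pos_def_mat :: "real ^ 'd ^ 'd::finite \<Rightarrow> bool"
  where "pos_def_mat B \<longleftrightarrow> transpose B = B \<and> (\<forall>x. x \<noteq> 0 \<longrightarrow> x \<bullet> (B *v x) > 0)"

text \<open>The power \<open>C\<^sup>-\<^sup>1\<^sup>/\<^sup>2\<close> of a symmetric positive definite matrix \<open>C\<close>.\<close>

definition inv_sqrt_mat :: "real ^ 'd ^ 'd::finite \<Rightarrow> real ^ 'd ^ 'd"
  where "inv_sqrt_mat C = (THE R. pos_def_mat R \<and> R ** R = matrix_inv C)"

section \<open>The dissimilarity \<open>\<delta>\<close> and the identifiable causes\<close>

definition N_mat :: "'d::finite path measure \<Rightarrow> real ^ 'd ^ 'd"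
  where "N_mat \<mu> = diag_mat (\<lambda>i. sqrt (esig \<mu> [i, i]))"

definition phi_S :: "'d::finite path measure \<Rightarrow> 'd coords \<Rightarrow> real"
  where "phi_S \<S> v = sqrt (
      (norm (matrix_inv (N_mat \<S>) ** (fst v - coord0 \<S>) ** matrix_inv (N_mat \<S>)))\<^sup>2
    + (\<Sum>\<nu>\<in>UNIV. inverse (esig \<S> [\<nu>, \<nu>]) *
        (norm (matrix_inv (N_mat \<S>) ** (snd v $ \<nu> - coord \<S> \<nu>) ** matrix_inv (N_mat \<S>)))\<^sup>2))"

definition dissim :: "'d::finite path measure \<Rightarrow> 'd path measure \<Rightarrow> real"
  where "dissim \<S> \<mu> = phi_S \<S> (coords \<mu>)"

definition omega_phi :: "'d::finite path measure \<Rightarrow> real \<Rightarrow> real"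
  where "omega_phi \<S> r = Sup {phi_S \<S> v |v. infnorm (v - coords \<S>) \<le> r}"

definition eta_phi :: "'d::finite path measure \<Rightarrow> real \<Rightarrow> real"
  where "eta_phi \<S> = inv_into {0..} (omega_phi \<S>)"

definition C_mat :: "'d::finite path measure \<Rightarrow> real ^ 'd ^ 'd"
  where "C_mat \<mu> = (1 / 2) *\<^sub>R (coord0 \<mu> + transpose (coord0 \<mu>))"

definition source_laws :: "'d::finite path measure set"
  where "source_laws = {\<mu>\<in>signal_laws_dot. invertible (C_mat \<mu>)
    \<and> (\<forall>i j. esig \<mu> [i, i, i] = 0 \<and> esig \<mu> [j, j, j] = 0 \<longrightarrow> i = j)
    \<and> (\<forall>i j. esig \<mu> [i, j] = of_bool (i = j) * esig \<mu> [i, j])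
    \<and> (\<forall>i j k. esig \<mu> [i, j, k] = of_bool (i = j \<and> j = k) * esig \<mu> [i, j, k])}"

definition causes :: "('d::finite path measure \<times> (real ^ 'd ^ 'd)) set"
  where "causes = source_laws \<times> {A. invertible A}"

section \<open>The inversion map\<close>

definition R_mat :: "'d::finite path measure \<Rightarrow> real ^ 'd ^ 'd"
  where "R_mat \<mu> = inv_sqrt_mat (C_mat \<mu>)"

definition x0_mat :: "'d::finite path measure \<Rightarrow> real ^ 'd ^ 'd \<Rightarrow> real ^ 'd ^ 'd"
  where "x0_mat \<mu> \<theta> = (let \<mu>' = mat_push \<theta> \<mu> in
    matrix_inv (N_mat \<mu>') ** coord0 \<mu>' ** matrix_inv (N_mat \<mu>'))"

definition x_mat :: "'d::finite path measure \<Rightarrow> 'd \<Rightarrow> real ^ 'd ^ 'd \<Rightarrow> real ^ 'd ^ 'd"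
  where "x_mat \<mu> \<nu> \<theta> = (let \<mu>' = mat_push \<theta> \<mu> in
    (1 / sqrt (esig \<mu>' [\<nu>, \<nu>])) *\<^sub>R
      (matrix_inv (N_mat \<mu>') ** coord \<mu>' \<nu> ** matrix_inv (N_mat \<mu>')))"

definition contrast :: "'d::finite path measure \<Rightarrow> real ^ 'd ^ 'd \<Rightarrow> real"
  where "contrast \<mu> \<theta> = (norm (offdiag (x0_mat \<mu> (\<theta> ** R_mat \<mu>))))\<^sup>2
    + (\<Sum>\<nu>\<in>UNIV. (norm (offdiag (x_mat \<mu> \<nu> (\<theta> ** R_mat \<mu>))))\<^sup>2)"

definition kappa_bound :: "real ^ 'd ^ 'd \<Rightarrow> 'd::finite path measure \<Rightarrow> real \<Rightarrow> real"
  where "kappa_bound A \<S> \<Delta> =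
    cond2 (normalize_rows (matrix_inv (R_mat (mat_push A \<S>) ** A))) + \<Delta>"

definition Xi1 :: "real \<Rightarrow> (real ^ 'd ^ 'd::finite) set"
  where "Xi1 \<kappa> = {\<theta>. invertible \<theta> \<and> (\<forall>i. norm (row i \<theta>) = 1) \<and> cond2 \<theta> \<le> \<kappa>}"

text \<open>The inversion map is left arbitrary (up to being compact-valued) where \<open>C_mat \<mu>\<close> is
  singular; hence it is specified by a predicate.\<close>

definition inversion_map ::
  "real \<Rightarrow> ('d::finite path measure \<Rightarrow> (real ^ 'd ^ 'd) set) \<Rightarrow> bool"
  where "inversion_map \<kappa> \<Phi> \<longleftrightarrow> (\<forall>\<mu>\<in>signal_laws. finite_coords \<mu> \<longrightarrow>
    (if invertible (C_mat \<mu>)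
     then \<Phi> \<mu> = {\<theta> ** R_mat \<mu> |\<theta>. is_arg_min (contrast \<mu>) (\<lambda>\<theta>. \<theta> \<in> Xi1 \<kappa>) \<theta>}
     else \<Phi> \<mu> \<noteq> {} \<and> compact (\<Phi> \<mu>) \<and> \<Phi> \<mu> \<subseteq> {\<theta>. invertible \<theta>}))"

section \<open>Robustness constants\<close>

definition msupport :: "'a::topological_space measure \<Rightarrow> 'a set"
  where "msupport M = {u. \<forall>U. open U \<and> u \<in> U \<longrightarrow> emeasure M U > 0}"

definition spatial_support :: "'d::finite path measure \<Rightarrow> (real ^ 'd) set"
  where "spatial_support \<mu> = closure (\<Union>t. msupport (distr \<mu> borel (\<lambda>x. apply_bcontfun x t)))"

definition delta_tilde :: "real \<Rightarrow> real \<Rightarrow> real \<Rightarrow> real \<Rightarrow> real"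
  where "delta_tilde c0 c1 c2 \<epsilon> = min c0 (c1\<^sup>2 * (\<epsilon> / (c2 + \<epsilon>))\<^sup>2)"

text \<open>Suprema and infima are taken in \<open>[0, \<infinity>]\<close>.\<close>

definition robustness_constants ::
  "'d::finite path measure \<Rightarrow> real ^ 'd ^ 'd \<Rightarrow> ('d path measure \<Rightarrow> (real ^ 'd ^ 'd) set) \<Rightarrow>
    real \<Rightarrow> real \<Rightarrow> real \<Rightarrow> real \<Rightarrow> real \<Rightarrow> bool"
  where "robustness_constants \<S> A \<Phi> c0 c1 c2 c3 c4 \<longleftrightarrow>
    0 < c0 \<and> 0 < c1 \<and> 0 < c2 \<and> 0 < c3 \<and> 0 < c4 \<and>
    (\<forall>\<epsilon>>0. \<forall>\<mu>\<in>signal_laws_dot. dissim \<S> \<mu> < delta_tilde c0 c1 c2 \<epsilon> \<longrightarrow>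
      (\<forall>\<theta>\<in>\<Phi> (mat_push A \<mu>). \<exists>M\<in>monomial_mats. \<exists>E.
          norm M \<le> c3 \<and> cond2 M \<le> c4 \<and> norm E \<le> \<epsilon> \<and> \<theta> = M ** (mat 1 + E) ** matrix_inv A)
      \<and> (SUP B\<in>\<Phi> (mat_push A \<mu>). INF (M, v)\<in>monomial_mats \<times> UNIV.
          SUP u\<in>(+) v ` spatial_support \<mu>.
            ennreal (norm ((B ** A) *v (u - v) - M *v u) / norm (M *v u) * of_bool (M *v u \<noteq> 0)))
        \<le> ennreal (c4 * \<epsilon>))"

section \<open>Estimators\<close>

text \<open>The Giry sigma-algebra \<open>prob_algebra borel\<close> is the one generated by the evaluations
  \<open>\<mu> \<mapsto> \<mu>(B)\<close>, \<open>B\<close> Borel.\<close>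

definition dot_estimator ::
  "'w measure \<Rightarrow> (nat \<Rightarrow> 'w \<Rightarrow> 'd::finite path measure) \<Rightarrow> bool"
  where "dot_estimator P \<mu>hat \<longleftrightarrow>
    (\<forall>n. \<mu>hat n \<in> P \<rightarrow>\<^sub>M restrict_space (prob_algebra borel) signal_laws_dot)"

definition tendsto_in_prob :: "'w measure \<Rightarrow> (nat \<Rightarrow> 'w \<Rightarrow> real) \<Rightarrow> real \<Rightarrow> bool"
  where "tendsto_in_prob P Y l \<longleftrightarrow>
    (\<forall>e>0. (\<lambda>n. measure P {\<omega>\<in>space P. e \<le> \<bar>Y n \<omega> - l\<bar>}) \<longlonglongrightarrow> 0)"

definition consistent_estimator ::
  "'w measure \<Rightarrow> (nat \<Rightarrow> 'w \<Rightarrow> 'd::finite path measure) \<Rightarrow> 'd path measure \<Rightarrow> bool"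
  where "consistent_estimator P \<mu>hat \<X> \<longleftrightarrow> (\<forall>w\<in>words23.
    (AE \<omega> in P. (\<lambda>n. esig (\<mu>hat n \<omega>) w) \<longlonglongrightarrow> esig \<X> w)
    \<or> tendsto_in_prob P (\<lambda>n \<omega>. esig (\<mu>hat n \<omega>) w) (esig \<X> w))"

definition est_error ::
  "(nat \<Rightarrow> 'w \<Rightarrow> 'd::finite path measure) \<Rightarrow> 'd path measure \<Rightarrow> nat \<Rightarrow> 'w \<Rightarrow> real"
  where "est_error \<mu>hat \<X> n \<omega> = (MAX w\<in>words23. \<bar>esig (\<mu>hat n \<omega>) w - esig \<X> w\<bar>)"

definition convergence_rate :: "(nat \<Rightarrow> real) \<Rightarrow> bool"
  where "convergence_rate \<alpha> \<longleftrightarrow> (\<forall>n. \<alpha> (Suc n) < \<alpha> n) \<and> \<alpha> \<longlonglongrightarrow> 0"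

text \<open>\<open>m\<close> and \<open>M\<close> are admissible values of \<open>m\<^sub>\<epsilon>\<close> and \<open>M\<^sub>\<epsilon>\<close> in \<open>\<gamma>\<^sub>n = O\<^sub>P(\<alpha>\<^sub>n)\<close>.\<close>

definition OP_witness ::
  "'w measure \<Rightarrow> (nat \<Rightarrow> 'w \<Rightarrow> real) \<Rightarrow> (nat \<Rightarrow> real) \<Rightarrow> real \<Rightarrow> real \<Rightarrow> real \<Rightarrow> bool"
  where "OP_witness P \<gamma> \<alpha> \<epsilon> m M \<longleftrightarrow> 0 < m \<and> 0 < M \<and>
    (SUP n\<in>{n. m \<le> real n}. measure P {\<omega>\<in>space P. \<gamma> n \<omega> \<ge> M * \<alpha> n}) \<le> \<epsilon>"

definition is_OP :: "'w measure \<Rightarrow> (nat \<Rightarrow> 'w \<Rightarrow> real) \<Rightarrow> (nat \<Rightarrow> real) \<Rightarrow> bool"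
  where "is_OP P \<gamma> \<alpha> \<longleftrightarrow> (\<forall>\<epsilon>>0. \<exists>m M. OP_witness P \<gamma> \<alpha> \<epsilon> m M)"

text \<open>Since the event of interest need not be measurable, ``with probability at least \<open>q\<close>''
  means that it contains a measurable event of probability at least \<open>q\<close>.\<close>

definition with_prob_at_least :: "'w measure \<Rightarrow> real \<Rightarrow> ('w \<Rightarrow> bool) \<Rightarrow> bool"
  where "with_prob_at_least P q Q \<longleftrightarrow> (\<exists>F\<in>sets P. q \<le> measure P F \<and> (\<forall>\<omega>\<in>F. Q \<omega>))"

text \<open>Every \<open>\<theta> \<in> \<Theta>\<close> recovers the source path \<open>s\<close> from the observed path \<open>x\<close> up to a monomial
  matrix and a relative uniform error of at most \<open>\<epsilon>\<close>.\<close>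

definition recovers_within ::
  "real \<Rightarrow> (real ^ 'd ^ 'd) set \<Rightarrow> 'd::finite path \<Rightarrow> 'd path \<Rightarrow> bool"
  where "recovers_within \<epsilon> \<Theta> x s \<longleftrightarrow> (\<forall>\<theta>\<in>\<Theta>. \<exists>M\<in>monomial_mats.
    (SUP t. ennreal (norm (\<theta> *v apply_bcontfun x t - M *v apply_bcontfun s t)
        / norm (M *v apply_bcontfun s t) * of_bool (apply_bcontfun s t \<noteq> 0))) \<le> ennreal \<epsilon>)"

definition sample_thresholds ::
  "real ^ 'd ^ 'd \<Rightarrow> 'd::finite path measure \<Rightarrow> real \<Rightarrow> real \<Rightarrow> real \<Rightarrow> real \<Rightarrow>
    (nat \<Rightarrow> real) \<Rightarrow> real \<Rightarrow> real \<Rightarrow> real \<Rightarrow> nat set"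
  where "sample_thresholds A \<S> c0 c1 c2 c4 \<alpha> m M \<epsilon> =
    {n. m \<le> real n \<and> \<alpha> n < eta_phi \<S> (delta_tilde c0 c1 c2 (\<epsilon> / c4))
                          / ((1 + linf_opnorm (matrix_inv A)) ^ 3 * M)}"

end

theory Submission
  imports Defs
begin

text \<open>On the event that the estimation error is below \<open>M \<alpha> n\<close>, multilinearity of iterated integrals
  bounds the distance between the coordinates of \<open>\<mu> = A\<^sup>-\<^sup>1 (\<mu>hat n)\<close> and those of \<open>\<S>\<close> by
  \<open>(1 + \<parallel>A\<^sup>-\<^sup>1\<parallel>)\<^sup>3 M \<alpha> n\<close>. Below the threshold this is less than \<open>\<eta>\<close>, so \<open>\<mu>\<close> is close enough to \<open>\<S>\<close>
  for robustness to give \<open>\<theta> = M (I + E) A\<^sup>-\<^sup>1\<close>. Then \<open>\<theta> X - M S = M E M\<^sup>-\<^sup>1 (M S)\<close> along every path, and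
  the relative error is at most \<open>\<kappa>\<^sub>2(M) \<parallel>E\<parallel>\<close>; no support condition is involved.

  Robustness only speaks about \<open>\<mu>\<close> with nonvanishing diagonal second-order coordinates, and closeness
  does not imply this because the constant \<open>c0\<close> may be large. A degenerate \<open>\<mu>\<close> is excluded by applying
  robustness to mixtures of \<open>\<mu>\<close> and \<open>\<S>\<close>. This needs minimizers of the contrast to exist, and hence
  the square root \<open>C\<^sup>-\<^sup>1\<^sup>/\<^sup>2\<close>.\<close>

section \<open>Riemann--Stieltjes integrals\<close>

text \<open>\<open>rs_integral\<close> is a definite description, so iterated integrals obey no
  algebra until the integrals are known to exist. Absolute continuity enters there: it bounds the
  variation of each coordinate, which gives existence, and the indefinite integral is again
  continuous, so that the next level exists too. Multilinearity then holds path by path, hence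
  almost surely under the laws considered. By integration by parts \<open>C_mat\<close> is half the
  second moment matrix of the increment over [0, 1]. It is therefore positive semidefinite, and a
  vanishing diagonal entry yields a null vector; this is the direction in which the covariances of
  the mixtures degenerate. The function \<open>phi_S\<close> is homogeneous about
  \<open>coords \<S>\<close>. Hence \<open>omega_phi\<close> is linear with positive slope, so its
  inverse \<eta> is genuine, and mixing with \<S> cannot increase the dissimilarity. Minimizers of
  the contrast exist because the bound on the condition number can be written without an inverse,
  which makes the constraint set compact, and because the contrast is a polynomial on that
  set.\<close>

abbreviation rs_sum :: "(real \<Rightarrow> real) \<Rightarrow> (real \<Rightarrow> real) \<Rightarrow> (real \<times> real set) set \<Rightarrow> real"
  where "rs_sum f g p \<equiv> (\<Sum>(s, K)\<in>p. f s * (g (Sup K) - g (Inf K)))"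

lemma tagged_division_of_real_cell:
  assumes "p tagged_division_of {a..b::real}" "(s, K) \<in> p"
  shows "K = {Inf K..Sup K}" "a \<le> Inf K" "Inf K \<le> s" "s \<le> Sup K" "Sup K \<le> b"
proof -
  obtain u v where K: "K = {u..v}"
    using tagged_division_ofD(4)[OF assms] by auto
  have "s \<in> K" "K \<subseteq> {a..b}"
    using tagged_division_ofD(2,3)[OF assms] by auto
  with K show "K = {Inf K..Sup K}" "a \<le> Inf K" "Inf K \<le> s" "s \<le> Sup K" "Sup K \<le> b"
    by auto
qed

lemma has_rs_integral_unique:
  assumes "has_rs_integral f g a b I" "has_rs_integral f g a b J"
  shows "I = J"
proof (rule ccontr)
  assume "I \<noteq> J"
  define e where "e = \<bar>I - J\<bar> / 2"
  have e: "e > 0" using \<open>I \<noteq> J\<close> by (simp add: e_def)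
  obtain d1 where d1: "d1 > 0" "\<And>p. p tagged_division_of {a..b} \<Longrightarrow> (\<lambda>s. ball s d1) fine p \<Longrightarrow>
      \<bar>rs_sum f g p - I\<bar> < e"
    using assms(1) e unfolding has_rs_integral_def by meson
  obtain d2 where d2: "d2 > 0" "\<And>p. p tagged_division_of {a..b} \<Longrightarrow> (\<lambda>s. ball s d2) fine p \<Longrightarrow>
      \<bar>rs_sum f g p - J\<bar> < e"
    using assms(2) e unfolding has_rs_integral_def by meson
  \<comment> \<open>Cousin's lemma provides one division that is fine for both radii.\<close>
  obtain p where p: "p tagged_division_of {a..b}" "(\<lambda>s. ball s (min d1 d2)) fine p"
    using fine_division_exists_real[OF gauge_ball, of "min d1 d2"] d1(1) d2(1) by auto
  have "(\<lambda>s. ball s d1) fine p" "(\<lambda>s. ball s d2) fine p"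
    using p(2) by (fastforce simp: fine_def)+
  then have "\<bar>rs_sum f g p - I\<bar> < e" "\<bar>rs_sum f g p - J\<bar> < e"
    using d1 d2 p by auto
  then have "\<bar>I - J\<bar> < e + e"
    by linarith
  moreover have "e + e = \<bar>I - J\<bar>"
    unfolding e_def by (rule field_sum_of_halves)
  ultimately show False
    by linarith
qed

lemma rs_integral_eqI: "has_rs_integral f g a b I \<Longrightarrow> rs_integral f g a b = I"
  unfolding rs_integral_def using has_rs_integral_unique by blast

lemma rs_sum_cong:
  assumes "p tagged_division_of {a..b}" "\<And>s. s \<in> {a..b} \<Longrightarrow> f s = f' s" "\<And>s. s \<in> {a..b} \<Longrightarrow> g s = g' s"
  shows "rs_sum f g p = rs_sum f' g' p"
proof (rule sum.cong[OF refl], clarify)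
  fix s K assume "(s, K) \<in> p"
  from tagged_division_of_real_cell[OF assms(1) this]
  show "f s * (g (Sup K) - g (Inf K)) = f' s * (g' (Sup K) - g' (Inf K))"
    by (simp add: assms)
qed

lemma has_rs_integral_cong:
  assumes "\<And>s. s \<in> {a..b} \<Longrightarrow> f s = f' s" "\<And>s. s \<in> {a..b} \<Longrightarrow> g s = g' s"
  shows "has_rs_integral f g a b I \<longleftrightarrow> has_rs_integral f' g' a b I"
proof -
  have "rs_sum f g p = rs_sum f' g' p" if "p tagged_division_of {a..b}" for p
    using that assms by (rule rs_sum_cong)
  then show ?thesis
    unfolding has_rs_integral_def by (intro all_cong1 imp_cong ex_cong1 conj_cong refl) auto
qed

text \<open>Assuming additivity for the Riemann sums covers two uses at once: linearity in the
  integrand and linearity in the integrator.\<close>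

lemma has_rs_integral_add_scaled:
  assumes "\<And>p. p tagged_division_of {a..b} \<Longrightarrow> rs_sum f g p = rs_sum f1 g1 p + c * rs_sum f2 g2 p"
    and "has_rs_integral f1 g1 a b I" "has_rs_integral f2 g2 a b J"
  shows "has_rs_integral f g a b (I + c * J)"
  unfolding has_rs_integral_def
proof (intro allI impI)
  fix e :: real assume e: "e > 0"
  \<comment> \<open>The added 1 keeps the divisor positive at c = 0 and still gives |c| e2 \<le> e /
    2.\<close>
  define e2 where "e2 = e / (2 * (\<bar>c\<bar> + 1))"
  have e2: "e2 > 0" using e by (simp add: e2_def add_nonneg_pos)
  obtain d1 where d1: "d1 > 0" "\<And>p. p tagged_division_of {a..b} \<Longrightarrow> (\<lambda>s. ball s d1) fine p \<Longrightarrow>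
      \<bar>rs_sum f1 g1 p - I\<bar> < e / 2"
    using assms(2) half_gt_zero[OF e] unfolding has_rs_integral_def by meson
  obtain d2 where d2: "d2 > 0" "\<And>p. p tagged_division_of {a..b} \<Longrightarrow> (\<lambda>s. ball s d2) fine p \<Longrightarrow>
      \<bar>rs_sum f2 g2 p - J\<bar> < e2"
    using assms(3) e2 unfolding has_rs_integral_def by meson
  have "\<bar>rs_sum f g p - (I + c * J)\<bar> < e"
    if p: "p tagged_division_of {a..b}" "(\<lambda>s. ball s (min d1 d2)) fine p" for p
  proof -
    have "(\<lambda>s. ball s d1) fine p" "(\<lambda>s. ball s d2) fine p"
      using p(2) by (fastforce simp: fine_def)+
    then have 1: "\<bar>rs_sum f1 g1 p - I\<bar> < e / 2" and 2: "\<bar>rs_sum f2 g2 p - J\<bar> < e2"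
      using d1 d2 p by auto
    have "\<bar>c\<bar> * \<bar>rs_sum f2 g2 p - J\<bar> \<le> \<bar>c\<bar> * e2"
      using 2 by (intro mult_left_mono) auto
    also have "\<dots> \<le> e / 2"
      using e by (simp add: e2_def field_simps)
    finally have "\<bar>c * (rs_sum f2 g2 p - J)\<bar> \<le> e / 2"
      by (simp add: abs_mult)
    moreover have "rs_sum f g p - (I + c * J) = (rs_sum f1 g1 p - I) + c * (rs_sum f2 g2 p - J)"
      using assms(1)[OF p(1)] by (simp add: algebra_simps)
    ultimately show ?thesis
      using 1 by linarith
  qed
  then show "\<exists>\<delta>>0. \<forall>p. p tagged_division_of {a..b} \<and> (\<lambda>s. ball s \<delta>) fine p \<longrightarrow>
      \<bar>rs_sum f g p - (I + c * J)\<bar> < e"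
    using d1 d2 by (intro exI[of _ "min d1 d2"]) auto
qed

lemma has_rs_integral_zero_left: "has_rs_integral (\<lambda>_. 0) g a b 0"
  unfolding has_rs_integral_def by (auto intro!: exI[of _ 1])

lemma has_rs_integral_zero_right: "has_rs_integral f (\<lambda>_. 0) a b 0"
  unfolding has_rs_integral_def by (auto intro!: exI[of _ 1])

lemma has_rs_integral_sum_left:
  assumes "finite E" "\<And>e. e \<in> E \<Longrightarrow> has_rs_integral (f e) g a b (I e)"
  shows "has_rs_integral (\<lambda>s. \<Sum>e\<in>E. c e * f e s) g a b (\<Sum>e\<in>E. c e * I e)"
  using assms
proof (induction E)
  case empty
  then show ?case by (simp add: has_rs_integral_zero_left)
next
  case (insert x E)
  have "has_rs_integral (\<lambda>s. \<Sum>e\<in>insert x E. c e * f e s) g a b ((\<Sum>e\<in>E. c e * I e) + c x * I x)"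
    using insert
    by (intro has_rs_integral_add_scaled[where ?f1.0 = "\<lambda>s. \<Sum>e\<in>E. c e * f e s" and ?g1.0 = g
          and ?f2.0 = "f x" and ?g2.0 = g])
      (auto simp: sum_distrib_left sum.distrib[symmetric] distrib_right split_def mult.assoc
        add.commute intro!: sum.cong)
  then show ?case
    using insert by (simp add: add.commute)
qed

lemma has_rs_integral_sum_right:
  assumes "finite E" "\<And>e. e \<in> E \<Longrightarrow> has_rs_integral f (g e) a b (I e)"
  shows "has_rs_integral f (\<lambda>s. \<Sum>e\<in>E. c e * g e s) a b (\<Sum>e\<in>E. c e * I e)"
  using assms
proof (induction E)
  case empty
  then show ?case by (simp add: has_rs_integral_zero_right)
next
  case (insert x E)
  have "has_rs_integral f (\<lambda>s. \<Sum>e\<in>insert x E. c e * g e s) a b ((\<Sum>e\<in>E. c e * I e) + c x * I x)"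
    using insert
    by (intro has_rs_integral_add_scaled[where ?g1.0 = "\<lambda>s. \<Sum>e\<in>E. c e * g e s" and ?f1.0 = f
          and ?g2.0 = "g x" and ?f2.0 = f])
      (auto simp: sum_distrib_left sum.distrib[symmetric] sum_subtractf[symmetric] split_def
        algebra_simps intro!: sum.cong)
  then show ?case
    using insert by (simp add: add.commute)
qed

text \<open>The Riemann sum telescopes to the exact value for every division, so any radius
  serves.\<close>

lemma has_rs_integral_const:
  assumes "a \<le> b"
  shows "has_rs_integral (\<lambda>_. 1) g a b (g b - g a)"
  unfolding has_rs_integral_def
  using additive_tagged_division_1[OF assms, of _ g] by (auto intro!: exI[of _ 1])

text \<open>By the fundamental theorem of calculus the difference is the integral of (z - g) f' over
  the cell. In the application z is the value of \<open>g\<close> at one end of a cell and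
  \<epsilon> bounds the oscillation of \<open>g\<close> there.\<close>

lemma C1_cell_estimate:
  fixes f g :: "real \<Rightarrow> real"
  assumes f: "\<And>x. (f has_field_derivative f' x) (at x)" and f': "continuous_on {c..d} f'"
    and g: "continuous_on {c..d} g" and "c \<le> d"
    and L: "\<And>x. x \<in> {c..d} \<Longrightarrow> \<bar>f' x\<bar> \<le> L" and z: "\<And>x. x \<in> {c..d} \<Longrightarrow> \<bar>z - g x\<bar> \<le> \<epsilon>" and "0 \<le> \<epsilon>"
  shows "\<bar>z * (f d - f c) - integral {c..d} (\<lambda>x. g x * f' x)\<bar> \<le> \<epsilon> * L * (d - c)"
proof -
  have "(f' has_integral (f d - f c)) {c..d}"
    using f \<open>c \<le> d\<close>
    by (intro fundamental_theorem_of_calculus)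
      (auto simp: has_real_derivative_iff_has_vector_derivative[symmetric] intro: DERIV_subset)
  then have 1: "((\<lambda>x. z * f' x) has_integral (z * (f d - f c))) {c..d}"
    by (rule has_integral_mult_right)
  have 2: "((\<lambda>x. g x * f' x) has_integral integral {c..d} (\<lambda>x. g x * f' x)) {c..d}"
    by (intro integrable_integral integrable_continuous_interval continuous_intros f' g)
  have "((\<lambda>x. (z - g x) * f' x) has_integral
      (z * (f d - f c) - integral {c..d} (\<lambda>x. g x * f' x))) {c..d}"
    using has_integral_diff[OF 1 2] by (simp add: algebra_simps)
  moreover have "norm ((z - g x) * f' x) \<le> \<epsilon> * L" if "x \<in> {c..d}" for x
    using L[OF that] z[OF that] \<open>0 \<le> \<epsilon>\<close> by (auto simp: abs_mult intro!: mult_mono)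
  moreover have "0 \<le> \<epsilon> * L"
    using L[of c] \<open>c \<le> d\<close> \<open>0 \<le> \<epsilon>\<close> by auto
  ultimately have "norm (z * (f d - f c) - integral {c..d} (\<lambda>x. g x * f' x)) \<le> \<epsilon> * L * measure lborel {c..d}"
    by (intro has_integral_bound_real[where f="\<lambda>x. (z - g x) * f' x"]) auto
  then show ?thesis
    using \<open>c \<le> d\<close> by simp
qed

text \<open>Integration by parts puts the smoothness on the integrand: the integrator is merely
  continuous, and the value is expressed by an ordinary integral against f'.\<close>

lemma has_rs_integral_C1:
  fixes f g :: "real \<Rightarrow> real"
  assumes f: "\<And>x. (f has_field_derivative f' x) (at x)" and f': "continuous_on {a..b} f'"
    and g: "continuous_on {a..b} g" and "a \<le> b"
  shows "has_rs_integral f g a b (f b * g b - f a * g a - integral {a..b} (\<lambda>x. g x * f' x))"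
  unfolding has_rs_integral_def
proof (intro allI impI)
  fix e :: real assume e: "e > 0"
  obtain L where L: "\<And>x. x \<in> {a..b} \<Longrightarrow> \<bar>f' x\<bar> \<le> L" "L > 0"
  proof -
    have "bounded (f' ` {a..b})"
      by (intro compact_imp_bounded compact_continuous_image f') auto
    then obtain L where "L > 0" "\<forall>y\<in>f' ` {a..b}. norm y \<le> L"
      unfolding bounded_pos by blast
    then show thesis
      by (intro that[of L]) auto
  qed
  \<comment> \<open>The summand 1 keeps the divisor positive for a = b; the total error \<epsilon> L
    (b - a) then stays below e.\<close>
  define \<epsilon> where "\<epsilon> = e / (L * (b - a + 1))"
  have \<epsilon>: "\<epsilon> > 0" using e L \<open>a \<le> b\<close> by (simp add: \<epsilon>_def)
  obtain d0 where d0: "d0 > 0" "\<And>x y. x \<in> {a..b} \<Longrightarrow> y \<in> {a..b} \<Longrightarrow> dist x y < d0 \<Longrightarrow> dist (g x) (g y) < \<epsilon>"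
    using compact_uniformly_continuous[OF g] \<epsilon> unfolding uniformly_continuous_on_def
    by (metis compact_Icc dist_commute)
  \<comment> \<open>The claimed value is F b - F a, so it can be compared with a Riemann sum cell by
    cell.\<close>
  define F where "F x = f x * g x - integral {a..x} (\<lambda>x. g x * f' x)" for x
  have "\<bar>rs_sum f g p - (F b - F a)\<bar> < e"
    if p: "p tagged_division_of {a..b}" "(\<lambda>s. ball s (d0/2)) fine p" for p
  proof -
    have cell: "\<bar>f s * (g (Sup K) - g (Inf K)) - (F (Sup K) - F (Inf K))\<bar> \<le> \<epsilon> * L * (Sup K - Inf K)"
      if sK: "(s, K) \<in> p" for s K
    proof -
      define u v where "u = Inf K" and "v = Sup K"
      have K: "K = {u..v}" "a \<le> u" "u \<le> s" "s \<le> v" "v \<le> b"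
        using tagged_division_of_real_cell[OF p(1) sK] by (auto simp: u_def v_def)
      \<comment> \<open>The radius is d0/2 because two points of a cell are compared through its
        tag.\<close>
      have "K \<subseteq> ball s (d0/2)" using p(2) sK by (auto simp: fine_def)
      moreover have "u \<in> K" "v \<in> K" using K by auto
      ultimately have "dist s u < d0/2" "dist s v < d0/2" by auto
      then have near: "dist x y < d0" if "x \<in> {u..v}" "y \<in> {u..v}" for x y
        using that K(3,4) by (auto simp: dist_real_def)
      have gi: "(\<lambda>x. g x * f' x) integrable_on {c..d}" if "a \<le> c" "d \<le> b" for c d
        using that by (intro integrable_continuous_interval continuous_intros
            continuous_on_subset[OF f'] continuous_on_subset[OF g]) auto
      have est: "\<bar>z * (f d - f c) - integral {c..d} (\<lambda>x. g x * f' x)\<bar> \<le> \<epsilon> * L * (d - c)"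
        if "c \<le> d" "{c..d} \<subseteq> {u..v}" "\<And>x. x \<in> {c..d} \<Longrightarrow> \<bar>z - g x\<bar> \<le> \<epsilon>" for c d z
      proof (rule C1_cell_estimate[OF f])
        have sub: "{c..d} \<subseteq> {a..b}" using that K by auto
        show "continuous_on {c..d} f'" "continuous_on {c..d} g"
          using sub f' g continuous_on_subset by blast+
        show "\<bar>f' x\<bar> \<le> L" if "x \<in> {c..d}" for x
          using that sub L by auto
      qed (use that \<epsilon> in auto)
      have gd: "\<bar>g y - g x\<bar> \<le> \<epsilon>" if "x \<in> {u..v}" "y \<in> {u..v}" for x y
      proof -
        have "x \<in> {a..b}" "y \<in> {a..b}" using that K(2,5) by auto
        then show ?thesis
          using d0(2)[of y x] near[OF that(2,1)] by (simp add: dist_real_def)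
      qed
      have 1: "\<bar>g v * (f v - f s) - integral {s..v} (\<lambda>x. g x * f' x)\<bar> \<le> \<epsilon> * L * (v - s)"
        using K gd by (intro est) auto
      have 2: "\<bar>g u * (f s - f u) - integral {u..s} (\<lambda>x. g x * f' x)\<bar> \<le> \<epsilon> * L * (s - u)"
        using K gd by (intro est) auto
      have "integral {a..u} (\<lambda>x. g x * f' x) + integral {u..v} (\<lambda>x. g x * f' x) = integral {a..v} (\<lambda>x. g x * f' x)"
        using K by (intro Henstock_Kurzweil_Integration.integral_combine gi) auto
      moreover have "integral {u..s} (\<lambda>x. g x * f' x) + integral {s..v} (\<lambda>x. g x * f' x) = integral {u..v} (\<lambda>x. g x * f' x)"
        using K by (intro Henstock_Kurzweil_Integration.integral_combine gi) auto
      \<comment> \<open>Summation by parts at the tag: the cell splits into {u..s}, where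
        \<open>g\<close> is frozen at u, and {s..v}, where it is frozen at v.\<close>
      ultimately have "f s * (g v - g u) - (F v - F u) =
          - (g v * (f v - f s) - integral {s..v} (\<lambda>x. g x * f' x))
          - (g u * (f s - f u) - integral {u..s} (\<lambda>x. g x * f' x))"
        unfolding F_def by (simp add: algebra_simps)
      also have "\<bar>\<dots>\<bar> \<le> \<epsilon> * L * (v - s) + \<epsilon> * L * (s - u)"
        using 1 2 by linarith
      also have "\<dots> = \<epsilon> * L * (v - u)" by (simp add: algebra_simps)
      finally show ?thesis by (simp add: u_def v_def)
    qed
    have "F b - F a = (\<Sum>(s, K)\<in>p. F (Sup K) - F (Inf K))"
      by (rule additive_tagged_division_1[OF \<open>a \<le> b\<close> p(1), symmetric])
    then have "\<bar>rs_sum f g p - (F b - F a)\<bar> =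
        \<bar>\<Sum>(s, K)\<in>p. f s * (g (Sup K) - g (Inf K)) - (F (Sup K) - F (Inf K))\<bar>"
      by (simp add: sum_subtractf split_def)
    also have "\<dots> \<le> (\<Sum>(s, K)\<in>p. \<epsilon> * L * (Sup K - Inf K))"
      using cell by (intro order_trans[OF sum_abs] sum_mono) auto
    also have "\<dots> = \<epsilon> * L * (b - a)"
      using additive_tagged_division_1[OF \<open>a \<le> b\<close> p(1), of "\<lambda>x. x"]
      by (simp add: sum_distrib_left[symmetric] split_def)
    also have "\<dots> < e"
    proof -
      have "\<epsilon> * L = e / (b - a + 1)" using L by (simp add: \<epsilon>_def)
      moreover have "e / (b - a + 1) * (b - a) < e"
        using e \<open>a \<le> b\<close> by (simp add: pos_divide_less_eq)
      ultimately show ?thesis by simp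
    qed
    finally show ?thesis .
  qed
  moreover have "f b * g b - f a * g a - integral {a..b} (\<lambda>x. g x * f' x) = F b - F a"
    by (simp add: F_def)
  ultimately show "\<exists>\<delta>>0. \<forall>p. p tagged_division_of {a..b} \<and> (\<lambda>s. ball s \<delta>) fine p \<longrightarrow>
      \<bar>rs_sum f g p - (f b * g b - f a * g a - integral {a..b} (\<lambda>x. g x * f' x))\<bar> < e"
    using d0 by (intro exI[of _ "d0/2"]) auto
qed

text \<open>V dominates the total variation of \<open>g\<close>. Tagged divisions are tested, with
  their tags ignored, because Riemann sums run over these.\<close>

definition variation_bound :: "(real \<Rightarrow> real) \<Rightarrow> real \<Rightarrow> real \<Rightarrow> real \<Rightarrow> bool"
  where "variation_bound g a b V \<longleftrightarrow>
    (\<forall>p. p tagged_division_of {a..b} \<longrightarrow> (\<Sum>(s, K)\<in>p. \<bar>g (Sup K) - g (Inf K)\<bar>) \<le> V)"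

lemma rs_sum_diff_le:
  assumes p: "p tagged_division_of {a..b}" and V: "variation_bound g a b V"
    and "\<And>s. s \<in> {a..b} \<Longrightarrow> \<bar>f s - h s\<bar> \<le> \<eta>" and "0 \<le> \<eta>"
  shows "\<bar>rs_sum f g p - rs_sum h g p\<bar> \<le> \<eta> * V"
proof -
  have "\<bar>rs_sum f g p - rs_sum h g p\<bar> = \<bar>\<Sum>(s, K)\<in>p. (f s - h s) * (g (Sup K) - g (Inf K))\<bar>"
    by (simp add: sum_subtractf[symmetric] split_def left_diff_distrib)
  also have "\<dots> \<le> (\<Sum>(s, K)\<in>p. \<eta> * \<bar>g (Sup K) - g (Inf K)\<bar>)"
  proof (intro order_trans[OF sum_abs] sum_mono, clarify)
    fix s K assume "(s, K) \<in> p"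
    from tagged_division_of_real_cell[OF p this] have "s \<in> {a..b}" by auto
    then show "\<bar>(f s - h s) * (g (Sup K) - g (Inf K))\<bar> \<le> \<eta> * \<bar>g (Sup K) - g (Inf K)\<bar>"
      by (auto simp: abs_mult intro!: mult_right_mono assms)
  qed
  also have "\<dots> = \<eta> * (\<Sum>(s, K)\<in>p. \<bar>g (Sup K) - g (Inf K)\<bar>)"
    by (simp add: sum_distrib_left split_def)
  also have "\<dots> \<le> \<eta> * V"
    using V p \<open>0 \<le> \<eta>\<close> by (auto simp: variation_bound_def intro!: mult_left_mono)
  finally show ?thesis .
qed

lemma has_rs_integral_diff_le:
  assumes "has_rs_integral f g a b I" "has_rs_integral h g a b J" and V: "variation_bound g a b V"
    and fh: "\<And>s. s \<in> {a..b} \<Longrightarrow> \<bar>f s - h s\<bar> \<le> \<eta>" and "0 \<le> \<eta>"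
  shows "\<bar>I - J\<bar> \<le> \<eta> * V"
proof (rule field_le_epsilon)
  fix e :: real assume "e > 0"
  then have e: "e / 2 > 0" by simp
  obtain d1 where d1: "d1 > 0" "\<And>p. p tagged_division_of {a..b} \<Longrightarrow> (\<lambda>s. ball s d1) fine p \<Longrightarrow>
      \<bar>rs_sum f g p - I\<bar> < e / 2"
    using assms(1) e unfolding has_rs_integral_def by meson
  obtain d2 where d2: "d2 > 0" "\<And>p. p tagged_division_of {a..b} \<Longrightarrow> (\<lambda>s. ball s d2) fine p \<Longrightarrow>
      \<bar>rs_sum h g p - J\<bar> < e / 2"
    using assms(2) e unfolding has_rs_integral_def by meson
  obtain p where p: "p tagged_division_of {a..b}" "(\<lambda>s. ball s (min d1 d2)) fine p"
    using fine_division_exists_real[OF gauge_ball, of "min d1 d2"] d1(1) d2(1) by auto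
  have "(\<lambda>s. ball s d1) fine p" "(\<lambda>s. ball s d2) fine p"
    using p(2) by (fastforce simp: fine_def)+
  then have "\<bar>rs_sum f g p - I\<bar> < e / 2" "\<bar>rs_sum h g p - J\<bar> < e / 2"
    using d1 d2 p by auto
  moreover have "\<bar>rs_sum f g p - rs_sum h g p\<bar> \<le> \<eta> * V"
    by (rule rs_sum_diff_le[OF p(1) V fh \<open>0 \<le> \<eta>\<close>])
  ultimately show "\<bar>I - J\<bar> \<le> \<eta> * V + e"
    by linarith
qed

text \<open>Polynomial integrands are covered by integration by parts; the general case follows by
  uniform approximation, which the bounded variation of the integrator allows.\<close>

lemma has_rs_integral_continuous_BV:
  fixes f g :: "real \<Rightarrow> real"
  assumes f: "continuous_on {a..b} f" and g: "continuous_on {a..b} g"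
    and V: "\<And>t. t \<in> {a..b} \<Longrightarrow> variation_bound g a t V"
  obtains I where "continuous_on {a..b} I" "\<And>t. t \<in> {a..b} \<Longrightarrow> has_rs_integral f g a t (I t)"
proof -
  have "\<exists>h. real_polynomial_function h \<and> (\<forall>x\<in>{a..b}. \<bar>f x - h x\<bar> < inverse (real (Suc n)))" for n
    using Stone_Weierstrass_real_polynomial_function[OF compact_Icc f, of "inverse (real (Suc n))"]
    by (metis inverse_positive_iff_positive of_nat_0_less_iff zero_less_Suc)
  then obtain h where h: "\<And>n. real_polynomial_function (h n)"
    "\<And>n x. x \<in> {a..b} \<Longrightarrow> \<bar>f x - h n x\<bar> < inverse (real (Suc n))"
    by metis
  have "\<exists>h'. real_polynomial_function h' \<and> (\<forall>x. (h n has_real_derivative h' x) (at x))" for n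
    using has_real_derivative_polynomial_function[OF h(1)] by metis
  then obtain h' where h': "\<And>n. real_polynomial_function (h' n)"
    "\<And>n x. (h n has_real_derivative h' n x) (at x)"
    by metis
  have h'c: "continuous_on S (h' n)" for n S
    using continuous_on_polymonial_function[of "h' n"] h'(1)[of n]
    by (simp add: real_polynomial_function_eq)
  have hc: "continuous_on S (h n)" for n S
    using h'(2)[of n] by (meson DERIV_continuous continuous_at_imp_continuous_on)
  \<comment> \<open>The value that integration by parts assigns to the polynomial integrand
    \<open>h n\<close>.\<close>
  define J where "J n t = h n t * g t - h n a * g a - integral {a..t} (\<lambda>x. g x * h' n x)" for n t
  have J: "has_rs_integral (h n) g a t (J n t)" if "t \<in> {a..b}" for n t
    unfolding J_def
    using that by (intro has_rs_integral_C1 h' h'c continuous_on_subset[OF g]) auto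
  have Jc: "continuous_on {a..b} (J n)" for n
    unfolding J_def
    by (intro continuous_intros hc g indefinite_integral_continuous_1 integrable_continuous_interval h'c)
  have Vp: "V \<ge> 0" if "t \<in> {a..b}" for t
  proof -
    obtain p where p: "p tagged_division_of {a..t}"
      using fine_division_exists_real[OF gauge_ball[of 1], of a t] by (metis zero_less_one)
    have "0 \<le> (\<Sum>(s, K)\<in>p. \<bar>g (Sup K) - g (Inf K)\<bar>)" by (auto intro: sum_nonneg)
    then show ?thesis using V[OF that] p unfolding variation_bound_def by fastforce
  qed
  have JJ: "\<bar>J n t - J m t\<bar> \<le> (inverse (real (Suc n)) + inverse (real (Suc m))) * V" if "t \<in> {a..b}" for n m t
  proof (rule has_rs_integral_diff_le[OF J[OF that] J[OF that] V[OF that]])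
    show "\<bar>h n s - h m s\<bar> \<le> inverse (real (Suc n)) + inverse (real (Suc m))" if "s \<in> {a..t}" for s
      using h(2)[of s n] h(2)[of s m] that \<open>t \<in> {a..b}\<close> by auto
  qed simp
  have null: "(\<lambda>n. inverse (real (Suc n)) * V) \<longlonglongrightarrow> 0"
    using tendsto_mult_left_zero[OF LIMSEQ_inverse_real_of_nat] by simp
  have "Cauchy (\<lambda>n. J n t)" if t: "t \<in> {a..b}" for t
  proof (rule CauchyI)
    fix e :: real assume "e > 0"
    then obtain N where N: "\<And>n. n \<ge> N \<Longrightarrow> inverse (real (Suc n)) * V < e / 2"
      using order_tendstoD(2)[OF null, of "e / 2"] unfolding eventually_sequentially by auto
    have "norm (J m t - J n t) < e" if "N \<le> m" "N \<le> n" for m n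
      using JJ[OF t, of m n] N[OF that(1)] N[OF that(2)] by (simp add: distrib_right)
    then show "\<exists>M. \<forall>m\<ge>M. \<forall>n\<ge>M. norm (J m t - J n t) < e" by blast
  qed
  then have "\<exists>l. (\<lambda>n. J n t) \<longlonglongrightarrow> l" if "t \<in> {a..b}" for t
    using that by (auto simp: Cauchy_convergent_iff convergent_def)
  then obtain I where I: "\<And>t. t \<in> {a..b} \<Longrightarrow> (\<lambda>n. J n t) \<longlonglongrightarrow> I t"
    by metis
  have IJ: "\<bar>J n t - I t\<bar> \<le> inverse (real (Suc n)) * V" if t: "t \<in> {a..b}" for n t
  proof -
    \<comment> \<open>Letting m tend to infinity in \<open>JJ\<close> gives an error bound that is
      uniform in t.\<close>
    have "(\<lambda>m. (inverse (real (Suc n)) + inverse (real (Suc m))) * V - \<bar>J n t - J m t\<bar>) \<longlonglongrightarrow>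
       (inverse (real (Suc n)) + 0) * V - \<bar>J n t - I t\<bar>"
      by (intro tendsto_intros LIMSEQ_inverse_real_of_nat I t)
    then have "0 \<le> (inverse (real (Suc n)) + 0) * V - \<bar>J n t - I t\<bar>"
      by (rule Lim_bounded2) (use JJ[OF t] in \<open>auto simp del: of_nat_Suc\<close>)
    then show ?thesis by simp
  qed
  show thesis
  proof
    \<comment> \<open>Uniform convergence makes I continuous, which is what allows I to be the
      integrand of a further integral.\<close>
    have "uniform_limit {a..b} J I sequentially"
    proof (rule uniform_limitI)
      fix e :: real assume "e > 0"
      then have "\<forall>\<^sub>F n in sequentially. inverse (real (Suc n)) * V < e"
        by (rule order_tendstoD(2)[OF null])
      then show "\<forall>\<^sub>F n in sequentially. \<forall>x\<in>{a..b}. dist (J n x) (I x) < e"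
      proof eventually_elim
        case (elim n)
        show ?case
        proof
          fix t assume "t \<in> {a..b}"
          from IJ[OF this, of n] elim show "dist (J n t) (I t) < e"
            unfolding dist_real_def by (rule order.strict_trans1)
        qed
      qed
    qed
    then show "continuous_on {a..b} I"
      by (rule uniform_limit_theorem[rotated]) (auto simp: Jc)
    show "has_rs_integral f g a t (I t)" if t: "t \<in> {a..b}" for t
      unfolding has_rs_integral_def
    proof (intro allI impI)
      fix e :: real assume "e > 0"
      then have e3: "e / 3 > 0" by simp
      then obtain n where n: "inverse (real (Suc n)) * V < e / 3"
        using order_tendstoD(2)[OF null, of "e / 3"] unfolding eventually_sequentially by auto
      obtain d where d: "d > 0" "\<And>p. p tagged_division_of {a..t} \<Longrightarrow> (\<lambda>s. ball s d) fine p \<Longrightarrow>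
          \<bar>rs_sum (h n) g p - J n t\<bar> < e / 3"
        using J[OF t, of n] e3 unfolding has_rs_integral_def by meson
      have "\<bar>rs_sum f g p - I t\<bar> < e"
        if p: "p tagged_division_of {a..t}" "(\<lambda>s. ball s d) fine p" for p
      proof -
        have "\<bar>rs_sum f g p - rs_sum (h n) g p\<bar> \<le> inverse (real (Suc n)) * V"
        proof (rule rs_sum_diff_le[OF p(1) V[OF t]])
          fix s assume "s \<in> {a..t}"
          then have "s \<in> {a..b}" using t by auto
          then show "\<bar>f s - h n s\<bar> \<le> inverse (real (Suc n))"
            using h(2)[of s n] by linarith
        qed auto
        then show ?thesis
          using d(2)[OF p] n IJ[OF t, of n] by linarith
      qed
      then show "\<exists>\<delta>>0. \<forall>p. p tagged_division_of {a..t} \<and> (\<lambda>s. ball s \<delta>) fine p \<longrightarrow>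
          \<bar>rs_sum f g p - I t\<bar> < e"
        using d(1) by blast
    qed
  qed
qed

section \<open>Variation of absolutely continuous functions, and integration by parts\<close>

lemma tagged_division_of_open_cells_disjoint:
  assumes p: "p tagged_division_of {a..b::real}" and "(s, K) \<in> p" "(s', K') \<in> p" "(s, K) \<noteq> (s', K')"
  shows "{Inf K<..<Sup K} \<inter> {Inf K'<..<Sup K'} = {}"
proof -
  have "interior K = {Inf K<..<Sup K}" "interior K' = {Inf K'<..<Sup K'}"
    using tagged_division_of_real_cell(1)[OF p assms(2)] tagged_division_of_real_cell(1)[OF p assms(3)]
      interior_atLeastAtMost_real by metis+
  then show ?thesis
    using tagged_division_ofD(5)[OF p assms(2,3,4)] by simp
qed

text \<open>Clipping the cells of a division to the \<open>N\<close> pieces of a uniform grid splits the variation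
  sum into \<open>N\<close> sums of small total length.\<close>

lemma abs_cont_on_variation_bound:
  fixes f :: "real \<Rightarrow> 'a::metric_space" and g :: "real \<Rightarrow> real"
  assumes f: "abs_cont_on a b f" and fg: "\<And>u v. \<bar>g u - g v\<bar> \<le> dist (f u) (f v)" and "a \<le> b"
  obtains V where "\<And>t. t \<in> {a..b} \<Longrightarrow> variation_bound g a t V"
proof -
  obtain \<delta> where "\<delta> > 0" and \<delta>: "\<And>D. finite D \<Longrightarrow> (\<forall>(u, v)\<in>D. a \<le> u \<and> u \<le> v \<and> v \<le> b) \<Longrightarrow>
      pairwise (\<lambda>(u, v) (u', v'). disjnt {u<..<v} {u'<..<v'}) D \<Longrightarrow> (\<Sum>(u, v)\<in>D. v - u) < \<delta> \<Longrightarrow>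
      (\<Sum>(u, v)\<in>D. dist (f u) (f v)) < 1"
    using f zero_less_one unfolding abs_cont_on_def by meson
  \<comment> \<open>Each of N equal pieces of {a..b} is shorter than \<delta>; passing to the
    successor ensures N > 0.\<close>
  obtain N :: nat where N: "(b - a) / \<delta> < N" "0 < N"
  proof -
    obtain N where "(b - a) / \<delta> < real N" using reals_Archimedean2 by blast
    then show thesis by (intro that[of "Suc N"]) auto
  qed
  define \<tau> where "\<tau> k = a + real k * ((b - a) / N)" for k :: nat
  have \<tau>: "\<tau> 0 = a" "\<tau> N = b" "\<And>k. \<tau> (Suc k) = \<tau> k + (b - a) / N"
    using N by (auto simp: \<tau>_def field_simps)
  have mesh: "0 \<le> (b - a) / N" "(b - a) / N < \<delta>"
    using N \<open>a \<le> b\<close> \<open>\<delta> > 0\<close> by (auto simp: field_simps)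
  have \<tau>_range: "a \<le> \<tau> k" "k \<le> N \<Longrightarrow> \<tau> k \<le> b" for k
  proof -
    show "a \<le> \<tau> k" using \<open>a \<le> b\<close> by (simp add: \<tau>_def)
    assume "k \<le> N"
    then have "real k * ((b - a) / N) \<le> real N * ((b - a) / N)"
      using mesh by (intro mult_right_mono) auto
    then show "\<tau> k \<le> b" using N by (simp add: \<tau>_def)
  qed
  define cl where "cl k x = max (\<tau> k) (min (\<tau> (Suc k)) x)" for k x
  have cl_mono: "cl k x \<le> cl k y" if "x \<le> y" for k x y
    using that by (auto simp: cl_def)
  have cl_range: "\<tau> k \<le> cl k x" "cl k x \<le> \<tau> (Suc k)" for k x
    using \<tau>(3)[of k] mesh by (auto simp: cl_def)
  \<comment> \<open>\<open>cl k\<close> projects onto the k-th grid piece. Pieces to the left of x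
    contribute their full increment and those to its right nothing, so the sum telescopes.\<close>
  have tele: "(\<Sum>k<n. g (cl k x) - g (\<tau> k)) = g (min x (\<tau> n)) - g a" if "a \<le> x" for n x
  proof (induction n)
    case 0
    then show ?case using that \<tau>(1) by (simp add: min_def)
  next
    case (Suc n)
    have "\<tau> n \<le> \<tau> (Suc n)" using \<tau>(3) mesh by simp
    then have "g (cl n x) - g (\<tau> n) = g (min x (\<tau> (Suc n))) - g (min x (\<tau> n))"
      by (cases "x \<le> \<tau> n") (auto simp: cl_def min_def max_def intro!: arg_cong[of _ _ g])
    then show ?case using Suc by simp
  qed
  have part: "(\<Sum>(s, K)\<in>p. \<bar>g (cl k (Sup K)) - g (cl k (Inf K))\<bar>) \<le> 1"
    if t: "t \<in> {a..b}" and p: "p tagged_division_of {a..t}" and k: "k < N" for t p k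
  proof -
    define c where "c = (\<lambda>(s::real, K). (cl k (Inf K), cl k (Sup K)))"
    define D where "D = c ` p"
    have fin: "finite p" using p by auto
    have sub: "{cl k (Inf K)<..<cl k (Sup K)} \<subseteq> {Inf K<..<Sup K}" for K
      by (auto simp: cl_def)
    have disj: "{fst (c x)<..<snd (c x)} \<inter> {fst (c y)<..<snd (c y)} = {}"
      if "x \<in> p" "y \<in> p" "x \<noteq> y" for x y
    proof -
      obtain s K s' K' where "x = (s, K)" "y = (s', K')" by fastforce
      have "{Inf K<..<Sup K} \<inter> {Inf K'<..<Sup K'} = {}"
        using that unfolding \<open>x = (s, K)\<close> \<open>y = (s', K')\<close>
        by (rule tagged_division_of_open_cells_disjoint[OF p])
      then have "{cl k (Inf K)<..<cl k (Sup K)} \<inter> {cl k (Inf K')<..<cl k (Sup K')} = {}"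
        using sub[of K] sub[of K'] by blast
      then show ?thesis by (simp only: c_def \<open>x = (s, K)\<close> \<open>y = (s', K')\<close> prod.case fst_conv snd_conv)
    qed
    have le: "fst (c x) \<le> snd (c x)" if "x \<in> p" for x
    proof -
      obtain s K where [simp]: "x = (s, K)" by fastforce
      show ?thesis
        using tagged_division_of_real_cell(3,4)[OF p, of s K] that by (auto simp: c_def intro!: cl_mono)
    qed
    have "(\<Sum>(u, v)\<in>D. dist (f u) (f v)) < 1"
    proof (rule \<delta>)
      show "finite D" using fin by (simp add: D_def)
      show "\<forall>(u, v)\<in>D. a \<le> u \<and> u \<le> v \<and> v \<le> b"
      proof -
        have "a \<le> fst (c x) \<and> fst (c x) \<le> snd (c x) \<and> snd (c x) \<le> b" if "x \<in> p" for x
          using le[OF that] order_trans[OF \<tau>_range(1) cl_range(1)] order_trans[OF cl_range(2) \<tau>_range(2)] k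
          by (auto simp: c_def split_def)
        then show ?thesis unfolding D_def split_def by blast
      qed
      show "pairwise (\<lambda>(u, v) (u', v'). disjnt {u<..<v} {u'<..<v'}) D"
      proof (rule pairwiseI)
        fix d d' assume "d \<in> D" "d' \<in> D" "d \<noteq> d'"
        then obtain x y where "x \<in> p" "y \<in> p" "d = c x" "d' = c y" "x \<noteq> y"
          unfolding D_def by blast
        then show "(case d of (u, v) \<Rightarrow> \<lambda>(u', v'). disjnt {u<..<v} {u'<..<v'}) d'"
          using disj[of x y] by (simp add: split_def disjnt_def)
      qed
      \<comment> \<open>\<open>c\<close> need not be injective, since cells outside the k-th piece
        collapse to its ends; passing to the image can only lower the total length.\<close>
      have "(\<Sum>(u, v)\<in>D. v - u) \<le> (\<Sum>x\<in>p. (case c x of (u, v) \<Rightarrow> v - u))"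
        unfolding D_def using le fin by (intro sum_image_le[unfolded comp_def]) (auto simp: split_def)
      also have "\<dots> = (\<Sum>(s, K)\<in>p. cl k (Sup K) - cl k (Inf K))"
        by (simp add: c_def split_def)
      also have "\<dots> = cl k t - cl k a"
        using t by (intro additive_tagged_division_1 p) auto
      also have "\<dots> \<le> (b - a) / N"
        using cl_range(2)[of k t] cl_range(1)[of k a] \<tau>(3)[of k] by linarith
      finally show "(\<Sum>(u, v)\<in>D. v - u) < \<delta>" using mesh by linarith
    qed
    also have "(\<Sum>(u, v)\<in>D. dist (f u) (f v)) = (\<Sum>x\<in>p. (case c x of (u, v) \<Rightarrow> dist (f u) (f v)))"
      unfolding D_def
    \<comment> \<open>Distinct cells have disjoint clipped interiors. If their clipped images
      coincide, the common image is a single point, and its term vanishes.\<close>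
    proof (subst sum.reindex_nontrivial[OF fin])
      fix x y assume xy: "x \<in> p" "y \<in> p" "x \<noteq> y" "c x = c y"
      then have "fst (c x) = snd (c x)"
        using disj[OF xy(1-3)] le[OF xy(1)] by (auto simp: order_le_less)
      then show "(case c x of (u, v) \<Rightarrow> dist (f u) (f v)) = 0"
        by (simp add: split_def)
    qed simp
    finally have "(\<Sum>(s, K)\<in>p. dist (f (cl k (Inf K))) (f (cl k (Sup K)))) < 1"
      by (simp add: c_def split_def)
    moreover have "(\<Sum>(s, K)\<in>p. \<bar>g (cl k (Sup K)) - g (cl k (Inf K))\<bar>) \<le>
        (\<Sum>(s, K)\<in>p. dist (f (cl k (Inf K))) (f (cl k (Sup K))))"
    proof (intro sum_mono, clarify)
      fix s K
      show "\<bar>g (cl k (Sup K)) - g (cl k (Inf K))\<bar> \<le> dist (f (cl k (Inf K))) (f (cl k (Sup K)))"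
        using fg[of "cl k (Sup K)" "cl k (Inf K)"] by (simp add: dist_commute)
    qed
    ultimately show ?thesis by linarith
  qed
  have "variation_bound g a t (real N)" if t: "t \<in> {a..b}" for t
    unfolding variation_bound_def
  proof (intro allI impI)
    fix p assume p: "p tagged_division_of {a..t}"
    have "(\<Sum>(s, K)\<in>p. \<bar>g (Sup K) - g (Inf K)\<bar>) \<le>
        (\<Sum>(s, K)\<in>p. \<Sum>k<N. \<bar>g (cl k (Sup K)) - g (cl k (Inf K))\<bar>)"
    proof (intro sum_mono, clarify)
      fix s K assume "(s, K) \<in> p"
      from tagged_division_of_real_cell[OF p this]
      have K: "a \<le> Inf K" "a \<le> Sup K" "Inf K \<le> b" "Sup K \<le> b" using t by auto
      have "g (Sup K) - g (Inf K) = (\<Sum>k<N. g (cl k (Sup K)) - g (\<tau> k)) - (\<Sum>k<N. g (cl k (Inf K)) - g (\<tau> k))"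
        unfolding tele[OF K(1)] tele[OF K(2)] using K \<tau>(2) by (simp add: min_def)
      also have "\<dots> = (\<Sum>k<N. g (cl k (Sup K)) - g (cl k (Inf K)))"
        by (simp add: sum_subtractf)
      finally show "\<bar>g (Sup K) - g (Inf K)\<bar> \<le> (\<Sum>k<N. \<bar>g (cl k (Sup K)) - g (cl k (Inf K))\<bar>)"
        by (simp add: sum_abs)
    qed
    also have "\<dots> = (\<Sum>k<N. \<Sum>(s, K)\<in>p. \<bar>g (cl k (Sup K)) - g (cl k (Inf K))\<bar>)"
      unfolding split_def by (rule sum.swap)
    also have "\<dots> \<le> (\<Sum>k<N. 1)"
      using part[OF t p] by (intro sum_mono) auto
    finally show "(\<Sum>(s, K)\<in>p. \<bar>g (Sup K) - g (Inf K)\<bar>) \<le> real N" by simp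
  qed
  then show thesis by (rule that)
qed

lemma abs_cont_on_continuous_on:
  assumes f: "abs_cont_on a b f"
  shows "continuous_on {a..b} f"
  unfolding continuous_on_iff
proof (intro ballI allI impI)
  fix x e :: real assume x: "x \<in> {a..b}" and "e > 0"
  then obtain \<delta> where "\<delta> > 0" and \<delta>: "\<And>D. finite D \<Longrightarrow> (\<forall>(u, v)\<in>D. a \<le> u \<and> u \<le> v \<and> v \<le> b) \<Longrightarrow>
      pairwise (\<lambda>(u, v) (u', v'). disjnt {u<..<v} {u'<..<v'}) D \<Longrightarrow> (\<Sum>(u, v)\<in>D. v - u) < \<delta> \<Longrightarrow>
      (\<Sum>(u, v)\<in>D. dist (f u) (f v)) < e"
    using f unfolding abs_cont_on_def by meson
  have "dist (f y) (f x) < e" if y: "y \<in> {a..b}" "dist y x < \<delta>" for y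
    using \<delta>[of "{(min x y, max x y)}"] x y
    by (cases "x \<le> y") (auto simp: dist_real_def dist_commute)
  with \<open>\<delta> > 0\<close> show "\<exists>d>0. \<forall>x'\<in>{a..b}. dist x' x < d \<longrightarrow> dist (f x') (f x) < e"
    by blast
qed

text \<open>Tag each cell at its left end for one integral and at its right end for the other: the
  two terms of a cell then add up to the increment of f g over it, and the sum telescopes.\<close>

lemma has_rs_integral_by_parts:
  assumes I: "has_rs_integral f g a b I" and J: "has_rs_integral g f a b J" and "a \<le> b"
  shows "I + J = f b * g b - f a * g a"
proof (rule ccontr)
  define T where "T = f b * g b - f a * g a"
  assume "I + J \<noteq> f b * g b - f a * g a"
  then have ne: "\<bar>T - (I + J)\<bar> > 0" by (simp add: T_def)
  define e where "e = \<bar>T - (I + J)\<bar> / 2"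
  have e: "e > 0" using ne by (simp add: e_def)
  obtain d1 where d1: "d1 > 0" "\<And>p. p tagged_division_of {a..b} \<Longrightarrow> (\<lambda>s. ball s d1) fine p \<Longrightarrow>
      \<bar>rs_sum f g p - I\<bar> < e"
    using I e unfolding has_rs_integral_def by meson
  obtain d2 where d2: "d2 > 0" "\<And>p. p tagged_division_of {a..b} \<Longrightarrow> (\<lambda>s. ball s d2) fine p \<Longrightarrow>
      \<bar>rs_sum g f p - J\<bar> < e"
    using J e unfolding has_rs_integral_def by meson
  \<comment> \<open>A d-fine cell has width below 2 d, so it stays in the ball of radius min d1 d2
    about either of its ends and may be retagged there.\<close>
  define d where "d = min d1 d2 / 2"
  have "d > 0" using d1 d2 by (simp add: d_def)
  obtain p where p: "p tagged_division_of {a..b}" "(\<lambda>s. ball s d) fine p"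
    using fine_division_exists_real[OF gauge_ball[OF \<open>d > 0\<close>]] by metis
  define D where "D = snd ` p"
  have D: "D division_of {a..b}"
    unfolding D_def by (rule division_of_tagged_division[OF p(1)])
  have cell: "K = {Inf K..Sup K}" "Inf K \<le> Sup K" "Sup K - Inf K < 2 * d" if K: "K \<in> D" for K
  proof -
    obtain s where sK: "(s, K) \<in> p" using K by (auto simp: D_def)
    note c = tagged_division_of_real_cell[OF p(1) sK]
    have "K \<subseteq> ball s d" using p(2) sK by (auto simp: fine_def)
    moreover have "Inf K \<in> K" "Sup K \<in> K"
      by (metis c(1,3,4) atLeastAtMost_iff order_refl order_trans)+
    ultimately have "dist s (Inf K) < d" "dist s (Sup K) < d" by auto
    with c show "K = {Inf K..Sup K}" "Inf K \<le> Sup K" "Sup K - Inf K < 2 * d"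
      by (auto simp: dist_real_def)
  qed
  have tag: "(\<lambda>K. (\<xi> K, K)) ` D tagged_division_of {a..b} \<and> (\<lambda>s. ball s (min d1 d2)) fine (\<lambda>K. (\<xi> K, K)) ` D"
    if \<xi>: "\<And>K. K \<in> D \<Longrightarrow> Inf K \<le> \<xi> K \<and> \<xi> K \<le> Sup K" for \<xi>
  proof
    show "(\<lambda>K. (\<xi> K, K)) ` D tagged_division_of {a..b}"
    proof (rule tagged_division_ofI)
      show "finite ((\<lambda>K. (\<xi> K, K)) ` D)" using D by auto
      show "x \<in> K" if "(x, K) \<in> (\<lambda>K. (\<xi> K, K)) ` D" for x K
        using that \<xi> cell(1) by (metis (no_types, lifting) Pair_inject atLeastAtMost_iff imageE)
      show "K \<subseteq> {a..b}" if "(x, K) \<in> (\<lambda>K. (\<xi> K, K)) ` D" for x K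
        using that division_ofD(2)[OF D] by auto
      show "\<exists>a b. K = cbox a b" if "(x, K) \<in> (\<lambda>K. (\<xi> K, K)) ` D" for x K
        using that division_ofD(4)[OF D] by auto
      show "interior K1 \<inter> interior K2 = {}" if "(x1, K1) \<in> (\<lambda>K. (\<xi> K, K)) ` D"
        "(x2, K2) \<in> (\<lambda>K. (\<xi> K, K)) ` D" "(x1, K1) \<noteq> (x2, K2)" for x1 K1 x2 K2
        using that by (intro division_ofD(5)[OF D]) auto
      show "\<Union> {K. \<exists>x. (x, K) \<in> (\<lambda>K. (\<xi> K, K)) ` D} = {a..b}"
      proof -
        have "{K. \<exists>x. (x, K) \<in> (\<lambda>K. (\<xi> K, K)) ` D} = D" by auto
        then show ?thesis using division_ofD(6)[OF D] by simp
      qed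
    qed
    show "(\<lambda>s. ball s (min d1 d2)) fine (\<lambda>K. (\<xi> K, K)) ` D"
    proof (rule fineI)
      fix x K assume "(x, K) \<in> (\<lambda>K. (\<xi> K, K)) ` D"
      then have K: "K \<in> D" "x = \<xi> K" by auto
      have "dist x y < min d1 d2" if "y \<in> K" for y
      proof -
        have "y \<in> {Inf K..Sup K}" using that cell(1)[OF K(1)] by simp
        then show ?thesis using \<xi>[OF K(1)] cell(3)[OF K(1)] K(2) by (auto simp: dist_real_def d_def)
      qed
      then show "K \<subseteq> ball x (min d1 d2)" by auto
    qed
  qed
  define pl where "pl = (\<lambda>K. (Inf K, K)) ` D"
  define pr where "pr = (\<lambda>K. (Sup K, K)) ` D"
  have pl: "pl tagged_division_of {a..b}" "(\<lambda>s. ball s (min d1 d2)) fine pl"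
    and pr: "pr tagged_division_of {a..b}" "(\<lambda>s. ball s (min d1 d2)) fine pr"
    unfolding pl_def pr_def using tag[of Inf] tag[of Sup] cell by auto
  have "(\<lambda>s. ball s d1) fine pl" "(\<lambda>s. ball s d2) fine pr"
    using pl(2) pr(2) by (fastforce simp: fine_def)+
  then have 1: "\<bar>rs_sum f g pl - I\<bar> < e" and 2: "\<bar>rs_sum g f pr - J\<bar> < e"
    using d1 d2 pl pr by auto
  have inj: "inj_on (\<lambda>K. (h K, K)) D" for h :: "real set \<Rightarrow> real" by (auto simp: inj_on_def)
  have "rs_sum f g pl + rs_sum g f pr = (\<Sum>K\<in>D. f (Inf K) * (g (Sup K) - g (Inf K))) +
      (\<Sum>K\<in>D. g (Sup K) * (f (Sup K) - f (Inf K)))"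
    unfolding pl_def pr_def by (simp add: sum.reindex[OF inj] comp_def)
  also have "\<dots> = (\<Sum>K\<in>D. f (Sup K) * g (Sup K) - f (Inf K) * g (Inf K))"
    by (simp add: sum.distrib[symmetric] algebra_simps)
  also have "\<dots> = (\<Sum>(s, K)\<in>pl. f (Sup K) * g (Sup K) - f (Inf K) * g (Inf K))"
    unfolding pl_def by (simp add: sum.reindex[OF inj] comp_def)
  also have "\<dots> = T"
    unfolding T_def by (rule additive_tagged_division_1[OF \<open>a \<le> b\<close> pl(1), of "\<lambda>x. f x * g x"])
  finally have "\<bar>T - (I + J)\<bar> < e + e"
    using 1 2 by linarith
  moreover have "e + e = \<bar>T - (I + J)\<bar>"
    unfolding e_def by (rule field_sum_of_halves)
  ultimately show False by linarith
qed

lemma has_rs_integral_shift: "has_rs_integral f (\<lambda>s. g s - c) a b I \<longleftrightarrow> has_rs_integral f g a b I"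
  by (simp add: has_rs_integral_def)

section \<open>Iterated integrals along absolutely continuous paths\<close>

lemma at_time_component_le_dist: "\<bar>at_time x u $ i - at_time x v $ i\<bar> \<le> dist (at_time x u) (at_time x v)"
  using component_le_norm_cart[of "at_time x u - at_time x v" i] by (simp add: dist_norm)

lemma ac_path_rs_integral:
  assumes "ac_path x" "continuous_on {0..1} f"
  obtains I where "continuous_on {0..1} I"
    "\<And>t. t \<in> {0..1} \<Longrightarrow> has_rs_integral f (\<lambda>s. at_time x s $ i) 0 t (I t)"
proof -
  obtain V where V: "\<And>t. t \<in> {0..1} \<Longrightarrow> variation_bound (\<lambda>s. at_time x s $ i) 0 t V"
    using abs_cont_on_variation_bound[OF assms(1) at_time_component_le_dist] zero_le_one by metis
  show thesis
    using has_rs_integral_continuous_BV[OF assms(2) _ V] that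
      continuous_on_component[OF abs_cont_on_continuous_on[OF assms(1)]] by metis
qed

text \<open>Continuity of one level makes the next integral exist and depend continuously on its
  upper limit, which is the induction. The second claim gives the \<open>THE\<close> in
  \<open>rs_integral\<close> its meaning.\<close>

lemma ac_path_iter_int:
  assumes x: "ac_path x"
  shows "continuous_on {0..1} (iter_int w x)"
    and "t \<in> {0..1} \<Longrightarrow> has_rs_integral (iter_int w x) (\<lambda>s. at_time x s $ i) 0 t (iter_int (i # w) x t)"
proof -
  have step: "continuous_on {0..1} (iter_int (i # w) x) \<and>
      (\<forall>t\<in>{0..1}. has_rs_integral (iter_int w x) (\<lambda>s. at_time x s $ i) 0 t (iter_int (i # w) x t))"
    if c: "continuous_on {0..1} (iter_int w x)" for i w
  proof -
    obtain I where I: "continuous_on {0..1} I"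
      "\<And>t. t \<in> {0..1} \<Longrightarrow> has_rs_integral (iter_int w x) (\<lambda>s. at_time x s $ i) 0 t (I t)"
      using ac_path_rs_integral[OF x c] by metis
    then have eq: "iter_int (i # w) x t = I t" if "t \<in> {0..1}" for t
      using rs_integral_eqI that by simp
    have "continuous_on {0..1} (iter_int (i # w) x)"
      using I(1) eq continuous_on_cong by metis
    then show ?thesis using I eq by auto
  qed
  show c: "continuous_on {0..1} (iter_int w x)"
  proof (induction w)
    case Nil
    then show ?case by simp
  qed (use step in blast)
  show "has_rs_integral (iter_int w x) (\<lambda>s. at_time x s $ i) 0 t (iter_int (i # w) x t)"
    if "t \<in> {0..1}" using step[OF c] that by blast
qed

lemma iter_int_single: "0 \<le> t \<Longrightarrow> iter_int [i] x t = at_time x t $ i - at_time x 0 $ i"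
proof -
  assume "0 \<le> t"
  moreover have "iter_int [] x = (\<lambda>_. 1)" by (rule ext) simp
  ultimately show ?thesis
    using rs_integral_eqI[OF has_rs_integral_const] by simp
qed

text \<open>The shuffle relation at level two, an instance of integration by parts. It expresses
  \<open>C_mat\<close> through products of increments and so is the source of its
  positivity.\<close>

lemma sig_two_symmetrized:
  assumes x: "ac_path x"
  shows "sig [i, j] x + sig [j, i] x =
    (at_time x 1 $ i - at_time x 0 $ i) * (at_time x 1 $ j - at_time x 0 $ j)"
proof -
  \<comment> \<open>Shifting by the starting value leaves the integrals unchanged and removes the
    boundary term at time 0.\<close>
  define f where "f k s = at_time x s $ k - at_time x 0 $ k" for k s
  have 1: "has_rs_integral (f i) (f j) 0 1 (iter_int [j, i] x 1)" for i j
  proof -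
    have "has_rs_integral (iter_int [i] x) (\<lambda>s. at_time x s $ j) 0 1 (iter_int [j, i] x 1)"
      by (rule ac_path_iter_int(2)[OF x]) simp
    then have "has_rs_integral (iter_int [i] x) (f j) 0 1 (iter_int [j, i] x 1)"
      unfolding f_def has_rs_integral_shift .
    then show ?thesis
      by (subst (asm) has_rs_integral_cong[where f' = "f i" and g' = "f j"])
        (auto simp: iter_int_single f_def simp del: iter_int.simps)
  qed
  have "iter_int [j, i] x 1 + iter_int [i, j] x 1 = f i 1 * f j 1 - f i 0 * f j 0"
    by (rule has_rs_integral_by_parts[OF 1 1]) simp
  then show ?thesis
    using x by (simp add: sig_def f_def del: iter_int.simps)
qed

section \<open>Multilinearity of the signature under matrices\<close>

lemma at_time_mat_path: "at_time (mat_path B x) s $ i = (\<Sum>k\<in>UNIV. B $ i $ k * at_time x s $ k)"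
  by (simp add: at_time_def matrix_vector_mult_def)

lemma ac_path_mat_path:
  assumes x: "ac_path x"
  shows "ac_path (mat_path B x)"
  unfolding abs_cont_on_def
proof (intro allI impI)
  fix e :: real assume e: "e > 0"
  \<comment> \<open>The added 1 makes the Lipschitz constant positive, so that e / L can be
    formed.\<close>
  define L where "L = onorm ((*v) B) + 1"
  have L: "L > 0" using onorm_pos_le[OF matrix_vector_mul_bounded_linear, of B] by (simp add: L_def)
  have lip: "dist (at_time (mat_path B x) u) (at_time (mat_path B x) v) \<le> L * dist (at_time x u) (at_time x v)" for u v
  proof -
    have "dist (at_time (mat_path B x) u) (at_time (mat_path B x) v) = norm (B *v (at_time x u - at_time x v))"
      by (simp add: at_time_def dist_norm matrix_vector_mult_diff_distrib)
    also have "\<dots> \<le> onorm ((*v) B) * norm (at_time x u - at_time x v)"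
      by (rule onorm[OF matrix_vector_mul_bounded_linear])
    also have "\<dots> \<le> L * norm (at_time x u - at_time x v)"
      by (intro mult_right_mono) (auto simp: L_def)
    finally show ?thesis by (simp add: dist_norm)
  qed
  obtain \<delta> where "\<delta> > 0" and \<delta>: "\<And>D. finite D \<and> (\<forall>(u, v)\<in>D. 0 \<le> u \<and> u \<le> v \<and> v \<le> 1)
      \<and> pairwise (\<lambda>(u, v) (u', v'). disjnt {u<..<v} {u'<..<v'}) D \<and> (\<Sum>(u, v)\<in>D. v - u) < \<delta> \<Longrightarrow>
      (\<Sum>(u, v)\<in>D. dist (at_time x u) (at_time x v)) < e / L"
    using x e L unfolding abs_cont_on_def by (metis (no_types, lifting) divide_pos_pos)
  have "(\<Sum>(u, v)\<in>D. dist (at_time (mat_path B x) u) (at_time (mat_path B x) v)) < e"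
    if D: "finite D \<and> (\<forall>(u, v)\<in>D. 0 \<le> u \<and> u \<le> v \<and> v \<le> 1)
      \<and> pairwise (\<lambda>(u, v) (u', v'). disjnt {u<..<v} {u'<..<v'}) D \<and> (\<Sum>(u, v)\<in>D. v - u) < \<delta>" for D
  proof -
    have "(\<Sum>(u, v)\<in>D. dist (at_time (mat_path B x) u) (at_time (mat_path B x) v)) \<le>
        (\<Sum>(u, v)\<in>D. L * dist (at_time x u) (at_time x v))"
      using lip by (intro sum_mono) auto
    also have "\<dots> = L * (\<Sum>(u, v)\<in>D. dist (at_time x u) (at_time x v))"
      by (simp add: sum_distrib_left split_def)
    also have "\<dots> < L * (e / L)"
      using \<delta>[OF D] L by (intro mult_strict_left_mono) auto
    finally show ?thesis using L by simp
  qed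
  with \<open>\<delta> > 0\<close> show "\<exists>\<delta>>0. \<forall>D. finite D \<and> (\<forall>(u, v)\<in>D. 0 \<le> u \<and> u \<le> v \<and> v \<le> 1)
      \<and> pairwise (\<lambda>(u, v) (u', v'). disjnt {u<..<v} {u'<..<v'}) D \<and> (\<Sum>(u, v)\<in>D. v - u) < \<delta> \<longrightarrow>
      (\<Sum>(u, v)\<in>D. dist (at_time (mat_path B x) u) (at_time (mat_path B x) v)) < e"
    by blast
qed

text \<open>Multilinearity, one letter at a time. The expansion of the shorter word is an abstract
  finite sum over E, so that the result, repackaged as such a sum, can be fed in again.\<close>

lemma iter_int_mat_path_Cons:
  assumes x: "ac_path x" and "finite E"
    and w: "\<And>t. t \<in> {0..1} \<Longrightarrow> iter_int w (mat_path B x) t = (\<Sum>e\<in>E. c e * iter_int (f e) x t)"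
    and t: "t \<in> {0..1}"
  shows "iter_int (i # w) (mat_path B x) t = (\<Sum>k\<in>UNIV. B $ i $ k * (\<Sum>e\<in>E. c e * iter_int (k # f e) x t))"
proof -
  have "has_rs_integral (\<lambda>s. \<Sum>e\<in>E. c e * iter_int (f e) x s) (\<lambda>s. \<Sum>k\<in>UNIV. B $ i $ k * at_time x s $ k) 0 t
      (\<Sum>k\<in>UNIV. B $ i $ k * (\<Sum>e\<in>E. c e * iter_int (k # f e) x t))"
    by (intro has_rs_integral_sum_right has_rs_integral_sum_left ac_path_iter_int(2) x t \<open>finite E\<close> finite)
  then have "has_rs_integral (iter_int w (mat_path B x)) (\<lambda>s. at_time (mat_path B x) s $ i) 0 t
      (\<Sum>k\<in>UNIV. B $ i $ k * (\<Sum>e\<in>E. c e * iter_int (k # f e) x t))"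
    by (rule has_rs_integral_cong[THEN iffD1, rotated -1]) (use t in \<open>auto simp: w at_time_mat_path\<close>)
  then show ?thesis by (simp add: rs_integral_eqI)
qed

lemma sig_two_mat_path:
  assumes x: "ac_path x"
  shows "sig [i, j] (mat_path B x) = (\<Sum>k\<in>UNIV. \<Sum>l\<in>UNIV. B $ i $ k * B $ j $ l * sig [k, l] x)"
proof -
  \<comment> \<open>The empty word, written as a sum over a one-point index set, starts the
    iteration.\<close>
  have 0: "iter_int [] (mat_path B x) t = (\<Sum>e\<in>{()}. 1 * iter_int [] x t)" for t by simp
  have 1: "iter_int [i] (mat_path B x) t = (\<Sum>k\<in>UNIV. B $ i $ k * iter_int [k] x t)" if "t \<in> {0..1}" for t
    using iter_int_mat_path_Cons[OF x _ 0 that, of i] by (simp del: iter_int.simps)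
  have "iter_int [j, i] (mat_path B x) 1 =
      (\<Sum>l\<in>UNIV. B $ j $ l * (\<Sum>k\<in>UNIV. B $ i $ k * iter_int [l, k] x 1))"
    by (rule iter_int_mat_path_Cons[OF x _ 1]) auto
  also have "\<dots> = (\<Sum>k\<in>UNIV. \<Sum>l\<in>UNIV. B $ i $ k * B $ j $ l * iter_int [l, k] x 1)"
    by (subst sum.swap) (simp add: sum_distrib_left ac_simps del: iter_int.simps)
  finally show ?thesis
    using x ac_path_mat_path[OF x] by (simp add: sig_def del: iter_int.simps)
qed

lemma sig_three_mat_path:
  assumes x: "ac_path x"
  shows "sig [i, j, \<nu>] (mat_path B x) =
    (\<Sum>k\<in>UNIV. \<Sum>l\<in>UNIV. \<Sum>m\<in>UNIV. B $ i $ k * B $ j $ l * B $ \<nu> $ m * sig [k, l, m] x)"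
proof -
  have 0: "iter_int [] (mat_path B x) t = (\<Sum>e\<in>{()}. 1 * iter_int [] x t)" for t by simp
  have 1: "iter_int [i] (mat_path B x) t = (\<Sum>k\<in>UNIV. B $ i $ k * iter_int [k] x t)" if "t \<in> {0..1}" for t
    using iter_int_mat_path_Cons[OF x _ 0 that, of i] by (simp del: iter_int.simps)
  \<comment> \<open>The double sum becomes a single sum over pairs, the form that the next
    application accepts.\<close>
  have 2: "iter_int [j, i] (mat_path B x) t =
      (\<Sum>(l, k)\<in>UNIV. (B $ j $ l * B $ i $ k) * iter_int ((\<lambda>(l, k). [l, k]) (l, k)) x t)" if "t \<in> {0..1}" for t
    using iter_int_mat_path_Cons[OF x _ 1 that, of j]
    by (simp add: sum_distrib_left sum.cartesian_product mult.assoc del: iter_int.simps)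
  have "iter_int [\<nu>, j, i] (mat_path B x) 1 = (\<Sum>m\<in>UNIV. B $ \<nu> $ m * (\<Sum>e\<in>UNIV.
      (\<lambda>(l, k). B $ j $ l * B $ i $ k) e * iter_int (m # (\<lambda>(l, k). [l, k]) e) x 1))"
    by (rule iter_int_mat_path_Cons[OF x]) (use 2 in \<open>auto simp: split_def simp del: iter_int.simps\<close>)
  also have "\<dots> = (\<Sum>m\<in>UNIV. \<Sum>l\<in>UNIV. \<Sum>k\<in>UNIV. B $ \<nu> $ m * (B $ j $ l * B $ i $ k * iter_int [m, l, k] x 1))"
    by (simp add: sum.cartesian_product sum_distrib_left split_def del: iter_int.simps)
  also have "\<dots> = (\<Sum>k\<in>UNIV. \<Sum>l\<in>UNIV. \<Sum>m\<in>UNIV. B $ \<nu> $ m * (B $ j $ l * B $ i $ k * iter_int [m, l, k] x 1))"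
    by (subst sum.swap, subst (2) sum.swap, subst sum.swap) (rule refl)
  finally show ?thesis
    using x ac_path_mat_path[OF x] by (simp add: sig_def ac_simps del: iter_int.simps)
qed

section \<open>Expected signatures under invertible linear maps and mixtures\<close>

lemma mat_path_compose: "mat_path A (mat_path B x) = mat_path (A ** B) x"
  by (rule bcontfun_eqI) (simp add: matrix_vector_mul_assoc)

lemma mat_path_mat_1 [simp]: "mat_path (mat 1) x = x"
  by (rule bcontfun_eqI) simp

lemma mat_path_borel_measurable [measurable]:
  "mat_path (B :: real ^ 'd ^ 'd) \<in> (borel :: 'd::finite path measure) \<rightarrow>\<^sub>M borel"
proof (rule borel_measurable_continuous_onI)
  define L where "L = onorm ((*v) B) + 1"
  have L: "L > 0" using onorm_pos_le[OF matrix_vector_mul_bounded_linear, of B] by (simp add: L_def)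
  have lip: "dist (mat_path B x) (mat_path B y) \<le> L * dist x y" for x y
  proof (rule dist_bound)
    fix t
    have "dist (apply_bcontfun (mat_path B x) t) (apply_bcontfun (mat_path B y) t) =
        norm (B *v (apply_bcontfun x t - apply_bcontfun y t))"
      by (simp add: dist_norm matrix_vector_mult_diff_distrib)
    also have "\<dots> \<le> onorm ((*v) B) * norm (apply_bcontfun x t - apply_bcontfun y t)"
      by (rule onorm[OF matrix_vector_mul_bounded_linear])
    also have "\<dots> \<le> L * norm (apply_bcontfun x t - apply_bcontfun y t)"
      by (intro mult_right_mono) (auto simp: L_def)
    also have "\<dots> \<le> L * dist x y"
      using dist_bounded[of x t y] L by (intro mult_left_mono) (auto simp: dist_norm)
    finally show "dist (apply_bcontfun (mat_path B x) t) (apply_bcontfun (mat_path B y) t) \<le> L * dist x y" .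
  qed
  show "continuous_on UNIV (mat_path B)"
    unfolding continuous_on_iff
  proof (intro ballI allI impI)
    fix x and e :: real assume "e > 0"
    have "dist (mat_path B y) (mat_path B x) < e" if "dist y x < e / L" for y
      using order_le_less_trans[OF lip[of y x], of e] that L by (simp add: field_simps)
    then show "\<exists>d>0. \<forall>y\<in>UNIV. dist y x < d \<longrightarrow> dist (mat_path B y) (mat_path B x) < e"
      using L \<open>e > 0\<close> by (intro exI[of _ "e / L"]) auto
  qed
qed

lemma mat_push_mat_push:
  assumes "sets \<mu> = sets borel"
  shows "mat_push A (mat_push B \<mu>) = mat_push (A ** B) \<mu>"
proof -
  have [measurable_cong]: "sets \<mu> = sets borel" by (rule assms)
  show ?thesis
    unfolding mat_push_def by (subst distr_distr) (auto simp: comp_def mat_path_compose)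
qed

lemma mat_push_mat_1: "sets \<mu> = sets borel \<Longrightarrow> mat_push (mat 1) \<mu> = \<mu>"
  unfolding mat_push_def using distr_id2[of borel \<mu>] by (simp add: id_def mat_path_mat_1[abs_def])

lemma matrix_inv_mult:
  assumes "invertible B"
  shows "B ** matrix_inv B = mat 1" "matrix_inv B ** B = mat 1"
  using someI_ex[OF assms[unfolded invertible_def]] unfolding matrix_inv_def by auto

lemma words23_cases:
  assumes "w \<in> words23"
  obtains i j where "w = [i, j]" | i j k where "w = [i, j, k]"
proof -
  have "length w = Suc (Suc 0) \<or> length w = Suc (Suc (Suc 0))"
    using assms by (auto simp: words23_def)
  then show thesis
    using that by (auto simp: length_Suc_conv)
qed

lemma words23_mem [simp]: "[i, j] \<in> words23" "[i, j, k] \<in> words23"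
  by (auto simp: words23_def)

text \<open>\<open>signal_laws_dot\<close> without the condition on the diagonal second-order
  coordinates. This class is stable under invertible matrices and under mixtures, whereas a
  push-forward may destroy the nonvanishing condition.\<close>

definition finite_signal_laws :: "'d::finite path measure set"
  where "finite_signal_laws = {\<mu> \<in> signal_laws. finite_coords \<mu>}"

text \<open>For the last claim: integrability includes measurability, which depends on the
  sigma-algebra only. A single law with finite coordinates thus makes \<open>sig w\<close> Borel
  measurable.\<close>

lemma finite_signal_lawsD:
  assumes "\<mu> \<in> finite_signal_laws"
  shows "sets \<mu> = sets borel" "prob_space \<mu>" "AE x in \<mu>. ac_path x"
    "w \<in> words23 \<Longrightarrow> integrable \<mu> (sig w)" "w \<in> words23 \<Longrightarrow> sig w \<in> borel_measurable borel"
proof -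
  show "sets \<mu> = sets borel" "prob_space \<mu>" "AE x in \<mu>. ac_path x"
    and i: "w \<in> words23 \<Longrightarrow> integrable \<mu> (sig w)"
    using assms by (auto simp: finite_signal_laws_def signal_laws_def finite_coords_def)
  then have s: "sets \<mu> = sets borel" by simp
  show "sig w \<in> borel_measurable borel" if "w \<in> words23"
    using borel_measurable_integrable[OF i[OF that]] unfolding measurable_cong_sets[OF s refl] .
qed

lemma signal_laws_dot_subset: "signal_laws_dot \<subseteq> finite_signal_laws"
  by (auto simp: finite_signal_laws_def signal_laws_dot_def)

text \<open>The exceptional paths are enclosed in a null set, which is pulled back along the inverse
  matrix to a Borel null set for the push-forward. In this way invertibility stands in for
  measurability of the set of absolutely continuous paths.\<close>

lemma AE_ac_path_mat_push:
  assumes \<mu>: "\<mu> \<in> finite_signal_laws" and B: "invertible B"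
  shows "AE y in mat_push B \<mu>. ac_path y"
proof -
  note s = finite_signal_lawsD(1)[OF \<mu>]
  have [measurable_cong]: "sets \<mu> = sets borel" by (rule s)
  have inv: "mat_path (matrix_inv B) (mat_path B x) = x" "mat_path B (mat_path (matrix_inv B) x) = x" for x
    using matrix_inv_mult[OF B] by (simp_all add: mat_path_compose)
  obtain N where N: "{x \<in> space \<mu>. \<not> ac_path x} \<subseteq> N" "emeasure \<mu> N = 0" "N \<in> sets \<mu>"
    by (rule AE_E[OF finite_signal_lawsD(3)[OF \<mu>]]) (rule that)
  define N' where "N' = mat_path (matrix_inv B) -` N"
  have N'_meas: "N' \<in> sets borel"
    unfolding N'_def using measurable_sets[OF mat_path_borel_measurable, of N] N(3) s by simp
  have "mat_path B -` N' = N"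
    by (auto simp: N'_def inv)
  then have "emeasure (mat_push B \<mu>) N' = 0"
    unfolding mat_push_def using N N'_meas by (subst emeasure_distr) (auto simp: sets_eq_imp_space_eq[OF s])
  moreover have "{y \<in> space (mat_push B \<mu>). \<not> ac_path y} \<subseteq> N'"
  proof
    fix y assume "y \<in> {y \<in> space (mat_push B \<mu>). \<not> ac_path y}"
    then have "\<not> ac_path (mat_path (matrix_inv B) y)"
      using ac_path_mat_path[of "mat_path (matrix_inv B) y" B] by (auto simp: inv)
    then show "y \<in> N'" using N(1) by (auto simp: N'_def sets_eq_imp_space_eq[OF s])
  qed
  ultimately show ?thesis
    by (intro AE_I[of _ _ N']) (auto simp: N'_meas mat_push_def)
qed

text \<open>The multilinear identities hold for almost every path, which determines the integral;
  \<open>has_bochner_integral\<close> delivers value and integrability at once.\<close>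

lemma integral_sig_mat_push:
  assumes \<mu>: "\<mu> \<in> finite_signal_laws"
  shows "has_bochner_integral (mat_push B \<mu>) (sig [i, j])
      (\<Sum>k\<in>UNIV. \<Sum>l\<in>UNIV. B $ i $ k * B $ j $ l * esig \<mu> [k, l])" (is ?A)
    and "has_bochner_integral (mat_push B \<mu>) (sig [i, j, \<nu>])
      (\<Sum>k\<in>UNIV. \<Sum>l\<in>UNIV. \<Sum>m\<in>UNIV. B $ i $ k * B $ j $ l * B $ \<nu> $ m * esig \<mu> [k, l, m])" (is ?B)
proof -
  have [measurable_cong]: "sets \<mu> = sets borel" by (rule finite_signal_lawsD(1)[OF \<mu>])
  note [measurable] = finite_signal_lawsD(5)[OF \<mu>]
  have int: "has_bochner_integral \<mu> (sig w) (esig \<mu> w)" if "w \<in> words23" for w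
    using finite_signal_lawsD(4)[OF \<mu> that] by (simp add: has_bochner_integral_iff esig_def)
  have "has_bochner_integral \<mu> (\<lambda>x. sig [i, j] (mat_path B x))
      (\<Sum>k\<in>UNIV. \<Sum>l\<in>UNIV. B $ i $ k * B $ j $ l * esig \<mu> [k, l])"
  proof (rule has_bochner_integralI_AE)
    show "has_bochner_integral \<mu> (\<lambda>x. \<Sum>k\<in>UNIV. \<Sum>l\<in>UNIV. B $ i $ k * B $ j $ l * sig [k, l] x)
      (\<Sum>k\<in>UNIV. \<Sum>l\<in>UNIV. B $ i $ k * B $ j $ l * esig \<mu> [k, l])"
      by (intro has_bochner_integral_sum has_bochner_integral_mult_right int) simp
    show "AE x in \<mu>. (\<Sum>k\<in>UNIV. \<Sum>l\<in>UNIV. B $ i $ k * B $ j $ l * sig [k, l] x) = sig [i, j] (mat_path B x)"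
      using finite_signal_lawsD(3)[OF \<mu>] by eventually_elim (simp add: sig_two_mat_path)
  qed measurable
  then show ?A
    unfolding mat_push_def by (subst has_bochner_integral_distr) auto
  have "has_bochner_integral \<mu> (\<lambda>x. sig [i, j, \<nu>] (mat_path B x))
      (\<Sum>k\<in>UNIV. \<Sum>l\<in>UNIV. \<Sum>m\<in>UNIV. B $ i $ k * B $ j $ l * B $ \<nu> $ m * esig \<mu> [k, l, m])"
  proof (rule has_bochner_integralI_AE)
    show "has_bochner_integral \<mu>
        (\<lambda>x. \<Sum>k\<in>UNIV. \<Sum>l\<in>UNIV. \<Sum>m\<in>UNIV. B $ i $ k * B $ j $ l * B $ \<nu> $ m * sig [k, l, m] x)
      (\<Sum>k\<in>UNIV. \<Sum>l\<in>UNIV. \<Sum>m\<in>UNIV. B $ i $ k * B $ j $ l * B $ \<nu> $ m * esig \<mu> [k, l, m])"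
      by (intro has_bochner_integral_sum has_bochner_integral_mult_right int) simp
    show "AE x in \<mu>. (\<Sum>k\<in>UNIV. \<Sum>l\<in>UNIV. \<Sum>m\<in>UNIV. B $ i $ k * B $ j $ l * B $ \<nu> $ m * sig [k, l, m] x)
        = sig [i, j, \<nu>] (mat_path B x)"
      using finite_signal_lawsD(3)[OF \<mu>] by eventually_elim (simp add: sig_three_mat_path)
  qed measurable
  then show ?B
    unfolding mat_push_def by (subst has_bochner_integral_distr) auto
qed

lemma esig_mat_push:
  assumes "\<mu> \<in> finite_signal_laws"
  shows "esig (mat_push B \<mu>) [i, j] = (\<Sum>k\<in>UNIV. \<Sum>l\<in>UNIV. B $ i $ k * B $ j $ l * esig \<mu> [k, l])"
    and "esig (mat_push B \<mu>) [i, j, \<nu>] =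
      (\<Sum>k\<in>UNIV. \<Sum>l\<in>UNIV. \<Sum>m\<in>UNIV. B $ i $ k * B $ j $ l * B $ \<nu> $ m * esig \<mu> [k, l, m])"
  using integral_sig_mat_push[OF assms] by (simp_all add: esig_def has_bochner_integral_iff)

lemma mat_push_finite_signal_laws:
  assumes \<mu>: "\<mu> \<in> finite_signal_laws" and B: "invertible B"
  shows "mat_push B \<mu> \<in> finite_signal_laws"
proof -
  have [measurable_cong]: "sets \<mu> = sets borel" by (rule finite_signal_lawsD(1)[OF \<mu>])
  have "integrable (mat_push B \<mu>) (sig w)" if "w \<in> words23" for w
    using that by (cases w rule: words23_cases) (use integral_sig_mat_push[OF \<mu>] in \<open>auto simp: has_bochner_integral_iff\<close>)
  moreover have "prob_space (mat_push B \<mu>)"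
    unfolding mat_push_def by (rule prob_space.prob_space_distr[OF finite_signal_lawsD(2)[OF \<mu>]]) measurable
  moreover have "sets (mat_push B \<mu>) = sets borel"
    by (simp add: mat_push_def)
  ultimately show ?thesis
    using AE_ac_path_mat_push[OF assms]
    by (auto simp: finite_signal_laws_def signal_laws_def finite_coords_def)
qed

section \<open>The covariance matrix: transformation and positivity\<close>

lemma congruence_component:
  fixes B X :: "real ^ 'n ^ 'n"
  shows "(B ** X ** transpose B) $ i $ j = (\<Sum>k\<in>UNIV. \<Sum>l\<in>UNIV. B $ i $ k * B $ j $ l * X $ k $ l)"
  by (subst sum.swap)
    (simp add: matrix_matrix_mult_def transpose_def sum_distrib_right sum_distrib_left ac_simps)

lemma C_mat_mat_push:
  assumes "\<mu> \<in> finite_signal_laws"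
  shows "C_mat (mat_push B \<mu>) = B ** C_mat \<mu> ** transpose B"
proof -
  have "esig (mat_push B \<mu>) [i, j] + esig (mat_push B \<mu>) [j, i] =
      (\<Sum>k\<in>UNIV. \<Sum>l\<in>UNIV. B $ i $ k * B $ j $ l * (esig \<mu> [k, l] + esig \<mu> [l, k]))" for i j
  proof -
    have "esig (mat_push B \<mu>) [j, i] = (\<Sum>k\<in>UNIV. \<Sum>l\<in>UNIV. B $ i $ k * B $ j $ l * esig \<mu> [l, k])"
      unfolding esig_mat_push[OF assms] by (subst sum.swap) (simp add: ac_simps)
    then show ?thesis
      by (simp add: esig_mat_push[OF assms] distrib_left sum.distrib)
  qed
  then show ?thesis
    by (simp add: vec_eq_iff congruence_component)
      (simp add: C_mat_def coord0_def transpose_def sum_divide_distrib)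
qed

lemma transpose_C_mat: "transpose (C_mat \<mu>) = C_mat \<mu>"
  by (simp add: C_mat_def vec_eq_iff transpose_def add.commute)

lemma C_mat_diag: "C_mat \<mu> $ i $ i = esig \<mu> [i, i]"
  by (simp add: C_mat_def coord0_def transpose_def)

text \<open>Because symmetrized second-order signatures are products of increments, the quadratic
  form is half the second moment of the increment of \<open>z \<bullet> x\<close> over
  [0, 1].\<close>

lemma C_mat_psd:
  assumes \<mu>: "\<mu> \<in> finite_signal_laws"
  shows "0 \<le> z \<bullet> (C_mat \<mu> *v z)"
proof -
  have int: "has_bochner_integral \<mu> (sig [i, j]) (esig \<mu> [i, j])" for i j
    using finite_signal_lawsD(4)[OF \<mu>] by (simp add: has_bochner_integral_iff esig_def)
  have "has_bochner_integral \<mu> (\<lambda>x. \<Sum>i\<in>UNIV. \<Sum>j\<in>UNIV. z $ i * z $ j / 2 * (sig [i, j] x + sig [j, i] x))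
     (\<Sum>i\<in>UNIV. \<Sum>j\<in>UNIV. z $ i * z $ j / 2 * (esig \<mu> [i, j] + esig \<mu> [j, i]))"
    by (intro has_bochner_integral_sum has_bochner_integral_mult_right has_bochner_integral_add int)
  then have "(\<Sum>i\<in>UNIV. \<Sum>j\<in>UNIV. z $ i * z $ j / 2 * (esig \<mu> [i, j] + esig \<mu> [j, i])) =
      (\<integral>x. (\<Sum>i\<in>UNIV. \<Sum>j\<in>UNIV. z $ i * z $ j / 2 * (sig [i, j] x + sig [j, i] x)) \<partial>\<mu>)"
    by (simp add: has_bochner_integral_iff)
  moreover have "0 \<le> \<dots>"
  proof (rule integral_nonneg_AE)
    show "AE x in \<mu>. 0 \<le> (\<Sum>i\<in>UNIV. \<Sum>j\<in>UNIV. z $ i * z $ j / 2 * (sig [i, j] x + sig [j, i] x))"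
      using finite_signal_lawsD(3)[OF \<mu>]
    proof eventually_elim
      case (elim x)
      define D where "D i = at_time x 1 $ i - at_time x 0 $ i" for i
      have "(\<Sum>i\<in>UNIV. \<Sum>j\<in>UNIV. z $ i * z $ j / 2 * (sig [i, j] x + sig [j, i] x)) =
         (\<Sum>i\<in>UNIV. \<Sum>j\<in>UNIV. (z $ i * D i) * (z $ j * D j)) / 2"
        by (simp add: sig_two_symmetrized[OF elim] D_def sum_divide_distrib ac_simps)
      also have "\<dots> = (\<Sum>i\<in>UNIV. z $ i * D i) * (\<Sum>i\<in>UNIV. z $ i * D i) / 2"
        by (simp add: sum_product)
      finally have "(\<Sum>i\<in>UNIV. \<Sum>j\<in>UNIV. z $ i * z $ j / 2 * (sig [i, j] x + sig [j, i] x)) =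
        (\<Sum>i\<in>UNIV. z $ i * D i) * (\<Sum>i\<in>UNIV. z $ i * D i) / 2" .
      moreover have "0 \<le> (\<Sum>i\<in>UNIV. z $ i * D i) * (\<Sum>i\<in>UNIV. z $ i * D i) / 2" by simp
      ultimately show ?case by linarith
    qed
  qed
  moreover have "z \<bullet> (C_mat \<mu> *v z) = (\<Sum>i\<in>UNIV. \<Sum>j\<in>UNIV. z $ i * z $ j / 2 * (esig \<mu> [i, j] + esig \<mu> [j, i]))"
    by (simp add: inner_vec_def matrix_vector_mult_def C_mat_def coord0_def transpose_def sum_distrib_left ac_simps)
  ultimately show ?thesis by simp
qed

lemma esig_diag_nonneg: "\<mu> \<in> finite_signal_laws \<Longrightarrow> 0 \<le> esig \<mu> [i, i]"
  using C_mat_psd[of \<mu> "axis i 1"] by (simp add: matrix_vector_mult_basis column_def C_mat_diag inner_axis')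

text \<open>The convex combination with weight s on the second law, the one taken when the coin
  shows success. As a bind it inherits its sigma-algebra and total mass from the Giry monad.\<close>

definition mixture :: "real \<Rightarrow> 'a measure \<Rightarrow> 'a measure \<Rightarrow> 'a measure"
  where "mixture s \<mu> \<nu> = measure_pmf (bernoulli_pmf s) \<bind> (\<lambda>b. if b then \<nu> else \<mu>)"

lemma mixture_props:
  assumes s: "0 \<le> s" "s \<le> 1" and "sets \<mu> = sets M" "sets \<nu> = sets M" "prob_space \<mu>" "prob_space \<nu>"
  shows "sets (mixture s \<mu> \<nu>) = sets M" "prob_space (mixture s \<mu> \<nu>)"
    and "f \<in> borel_measurable M \<Longrightarrow>
      (\<integral>\<^sup>+x. f x \<partial>mixture s \<mu> \<nu>) = ennreal (1 - s) * (\<integral>\<^sup>+x. f x \<partial>\<mu>) + ennreal s * (\<integral>\<^sup>+x. f x \<partial>\<nu>)"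
proof -
  have 1: "(\<lambda>b. if b then \<nu> else \<mu>) \<in> measure_pmf (bernoulli_pmf s) \<rightarrow>\<^sub>M prob_algebra M"
    using assms by (auto simp: measurable_def space_prob_algebra)
  have 0: "measure_pmf (bernoulli_pmf s) \<in> space (prob_algebra (measure_pmf (bernoulli_pmf s)))"
    by (simp add: space_prob_algebra measure_pmf.prob_space_axioms)
  show "sets (mixture s \<mu> \<nu>) = sets M" "prob_space (mixture s \<mu> \<nu>)"
    unfolding mixture_def using sets_bind'[OF 0 1] prob_space_bind'[OF 0 1] by auto
  show "(\<integral>\<^sup>+x. f x \<partial>mixture s \<mu> \<nu>) = ennreal (1 - s) * (\<integral>\<^sup>+x. f x \<partial>\<mu>) + ennreal s * (\<integral>\<^sup>+x. f x \<partial>\<nu>)"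
    if "f \<in> borel_measurable M"
    unfolding mixture_def using s
    by (subst nn_integral_bind[OF that measurable_prob_algebraD[OF 1]]) (simp add: ac_simps)
qed

lemma has_bochner_integral_mixture:
  fixes f :: "'a \<Rightarrow> real"
  assumes s: "0 \<le> s" "s \<le> 1" and "sets \<mu> = sets M" "sets \<nu> = sets M" "prob_space \<mu>" "prob_space \<nu>"
    and f: "integrable \<mu> f" "integrable \<nu> f"
  shows "has_bochner_integral (mixture s \<mu> \<nu>) f ((1 - s) * (\<integral>x. f x \<partial>\<mu>) + s * (\<integral>x. f x \<partial>\<nu>))"
proof -
  note m = mixture_props[OF assms(1-6)]
  have fM[measurable]: "f \<in> borel_measurable M"
    using borel_measurable_integrable[OF f(1)] measurable_cong_sets[OF assms(3) refl] by blast
  \<comment> \<open>\<open>ennreal\<close> truncates negative values at 0, so these are the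
    integrals of the positive and negative parts.\<close>
  obtain a b where a: "a \<ge> 0" "(\<integral>\<^sup>+x. f x \<partial>\<mu>) = ennreal a" and b: "b \<ge> 0" "(\<integral>\<^sup>+x. ennreal (- f x) \<partial>\<mu>) = ennreal b"
    and ab: "(\<integral>x. f x \<partial>\<mu>) = a - b"
    using integrableE[OF f(1)] by metis
  obtain c d where c: "c \<ge> 0" "(\<integral>\<^sup>+x. f x \<partial>\<nu>) = ennreal c" and d: "d \<ge> 0" "(\<integral>\<^sup>+x. ennreal (- f x) \<partial>\<nu>) = ennreal d"
    and cd: "(\<integral>x. f x \<partial>\<nu>) = c - d"
    using integrableE[OF f(2)] by metis
  have p: "(\<integral>\<^sup>+x. f x \<partial>mixture s \<mu> \<nu>) = ennreal ((1 - s) * a + s * c)"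
    using s a c by (subst m(3)) (auto simp: ennreal_mult ennreal_plus)
  have n: "(\<integral>\<^sup>+x. ennreal (- f x) \<partial>mixture s \<mu> \<nu>) = ennreal ((1 - s) * b + s * d)"
    using s b d by (subst m(3)) (auto simp: ennreal_mult ennreal_plus)
  have "f \<in> borel_measurable (mixture s \<mu> \<nu>)"
    using fM measurable_cong_sets[OF m(1) refl] by blast
  then have "integrable (mixture s \<mu> \<nu>) f"
    unfolding real_integrable_def p n by simp
  moreover from this have "(\<integral>x. f x \<partial>mixture s \<mu> \<nu>) = ((1 - s) * a + s * c) - ((1 - s) * b + s * d)"
  proof -
    have "0 \<le> (1 - s) * a + s * c" "0 \<le> (1 - s) * b + s * d"
      using s a(1) b(1) c(1) d(1) by simp_all
    with \<open>integrable (mixture s \<mu> \<nu>) f\<close> show ?thesis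
      by (simp only: real_lebesgue_integral_def p n enn2real_ennreal)
  qed
  ultimately show ?thesis
    by (simp add: has_bochner_integral_iff ab cd algebra_simps)
qed

lemma mixture_finite_signal_laws:
  assumes s: "0 \<le> s" "s \<le> 1" and \<mu>: "\<mu> \<in> finite_signal_laws" and \<nu>: "\<nu> \<in> finite_signal_laws"
  shows "mixture s \<mu> \<nu> \<in> finite_signal_laws"
    and "w \<in> words23 \<Longrightarrow> esig (mixture s \<mu> \<nu>) w = (1 - s) * esig \<mu> w + s * esig \<nu> w"
proof -
  note D = finite_signal_lawsD[OF \<mu>] finite_signal_lawsD[OF \<nu>]
  note m = mixture_props[OF s D(1) D(6) D(2) D(7)]
  have b: "has_bochner_integral (mixture s \<mu> \<nu>) (sig w) ((1 - s) * esig \<mu> w + s * esig \<nu> w)"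
    if "w \<in> words23" for w
    unfolding esig_def using that
    by (intro has_bochner_integral_mixture[OF s D(1) D(6) D(2) D(7)] D)
  then show "w \<in> words23 \<Longrightarrow> esig (mixture s \<mu> \<nu>) w = (1 - s) * esig \<mu> w + s * esig \<nu> w"
    by (simp add: has_bochner_integral_iff esig_def)
  obtain N1 where N1: "{x \<in> space \<mu>. \<not> ac_path x} \<subseteq> N1" "emeasure \<mu> N1 = 0" "N1 \<in> sets \<mu>"
    by (rule AE_E[OF D(3)]) (rule that)
  obtain N2 where N2: "{x \<in> space \<nu>. \<not> ac_path x} \<subseteq> N2" "emeasure \<nu> N2 = 0" "N2 \<in> sets \<nu>"
    by (rule AE_E[OF D(8)]) (rule that)
  \<comment> \<open>Every exceptional path lies in both sets, and the intersection, unlike the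
    union, is null under both laws.\<close>
  have N: "N1 \<inter> N2 \<in> sets borel" using N1 N2 D(1,6) by auto
  have "emeasure (mixture s \<mu> \<nu>) (N1 \<inter> N2) = ennreal (1 - s) * emeasure \<mu> (N1 \<inter> N2) + ennreal s * emeasure \<nu> (N1 \<inter> N2)"
    using m(3)[of "indicator (N1 \<inter> N2)"] N D(1,6) m(1) by (simp add: nn_integral_indicator)
  moreover have "emeasure \<mu> (N1 \<inter> N2) = 0"
    using N1 N D(1) by (metis Int_lower1 emeasure_mono le_zero_eq)
  moreover have "emeasure \<nu> (N1 \<inter> N2) = 0"
    using N2 N D(6) by (metis Int_lower2 emeasure_mono le_zero_eq)
  ultimately have "emeasure (mixture s \<mu> \<nu>) (N1 \<inter> N2) = 0" by simp
  moreover have "{x \<in> space (mixture s \<mu> \<nu>). \<not> ac_path x} \<subseteq> N1 \<inter> N2"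
    using N1(1) N2(1) sets_eq_imp_space_eq[OF D(1)] sets_eq_imp_space_eq[OF D(6)] by auto
  ultimately have "AE x in mixture s \<mu> \<nu>. ac_path x"
    using N m(1) by (intro AE_I[of _ _ "N1 \<inter> N2"]) auto
  then show "mixture s \<mu> \<nu> \<in> finite_signal_laws"
    using m b by (auto simp: finite_signal_laws_def signal_laws_def finite_coords_def has_bochner_integral_iff)
qed

section \<open>Square roots of positive definite matrices\<close>

lemma linear_coefficient_eq_0:
  fixes b c :: real
  assumes "\<And>t. 0 \<le> 2 * t * b + t\<^sup>2 * c"
  shows "b = 0"
proof (rule ccontr)
  assume "b \<noteq> 0"
  \<comment> \<open>The witness t = - b / k turns the expression into (b / k)^2 (c - 2 k), which is
    negative because k is positive and exceeds c.\<close>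
  define k where "k = \<bar>c\<bar> + 1"
  have k: "k > 0" "c < k" by (auto simp: k_def)
  have "2 * (- b / k) * b + (- b / k)\<^sup>2 * c = (b\<^sup>2 / k\<^sup>2) * (c - 2 * k)"
    using k by (simp add: power2_eq_square field_simps)
  also have "\<dots> < 0"
    using k \<open>b \<noteq> 0\<close> by (intro mult_pos_neg divide_pos_pos) auto
  finally show False
    using assms[of "- b / k"] by simp
qed

text \<open>Along u + t T u the form is nonnegative and vanishes at t = 0, so its linear coefficient
  2 |T u|^2 must be 0. An invariant subspace W is allowed for the sake of the eigenvector argument;
  covariance matrices use the whole space.\<close>

lemma psd_null_vector:
  fixes T :: "'a::real_inner \<Rightarrow> 'a"
  assumes "linear T" and sym: "\<And>x y. x \<bullet> T y = T x \<bullet> y" and "subspace W" "T ` W \<subseteq> W"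
    and psd: "\<And>x. x \<in> W \<Longrightarrow> 0 \<le> x \<bullet> T x" and u: "u \<in> W" "u \<bullet> T u = 0"
  shows "T u = 0"
proof -
  have Tu: "T u \<in> W" using assms by auto
  have "0 \<le> 2 * t * (T u \<bullet> T u) + t\<^sup>2 * (T u \<bullet> T (T u))" for t
  proof -
    have "u + t *\<^sub>R T u \<in> W"
      using u Tu \<open>subspace W\<close> by (intro subspace_add subspace_scale)
    then have "0 \<le> (u + t *\<^sub>R T u) \<bullet> T (u + t *\<^sub>R T u)" by (rule psd)
    also have "\<dots> = 2 * t * (T u \<bullet> T u) + t\<^sup>2 * (T u \<bullet> T (T u))"
      using u(2) sym[of u "T u"]
      by (simp add: linear_add[OF \<open>linear T\<close>] linear_scale[OF \<open>linear T\<close>] inner_left_distrib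
          inner_right_distrib power2_eq_square algebra_simps)
    finally show ?thesis .
  qed
  then have "T u \<bullet> T u = 0" by (rule linear_coefficient_eq_0)
  then show ?thesis by simp
qed

text \<open>u maximizes the Rayleigh quotient on the unit sphere of W. With l the maximum, l I - T
  is positive semidefinite on W and its form vanishes at u, so it annihilates u.\<close>

lemma self_adjoint_eigenvector:
  fixes T :: "'a::euclidean_space \<Rightarrow> 'a"
  assumes T: "linear T" and sym: "\<And>x y. x \<bullet> T y = T x \<bullet> y" and W: "subspace W" "T ` W \<subseteq> W"
    and x: "x \<in> W" "x \<noteq> 0"
  obtains u l where "u \<in> W" "norm u = 1" "T u = l *\<^sub>R u"
proof -
  define S where "S = W \<inter> sphere 0 1"
  have "compact S"
    unfolding S_def using W(1) by (intro closed_Int_compact closed_subspace compact_sphere)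
  moreover have "x /\<^sub>R norm x \<in> S"
    unfolding S_def using x W(1) by (auto intro: subspace_scale)
  then have "S \<noteq> {}" by auto
  moreover have "continuous_on S (\<lambda>x. x \<bullet> T x)"
    using T by (intro continuous_intros linear_continuous_on linear_conv_bounded_linear[THEN iffD1])
  ultimately obtain u where u: "u \<in> S" and max: "\<And>y. y \<in> S \<Longrightarrow> y \<bullet> T y \<le> u \<bullet> T u"
    using continuous_attains_sup by metis
  define l where "l = u \<bullet> T u"
  have uW: "u \<in> W" "norm u = 1" using u by (auto simp: S_def)
  define G where "G y = l *\<^sub>R y - T y" for y
  have "G u = 0"
  proof (rule psd_null_vector[of G W])
    show "linear G"
      unfolding G_def by (intro linear_compose_sub T linear_compose_scale_right linear_id[unfolded id_def])
    show "y \<bullet> G z = G y \<bullet> z" for y z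
      by (simp add: G_def inner_diff_left inner_diff_right sym)
    show "G ` W \<subseteq> W"
      using W by (auto simp: G_def intro!: subspace_diff subspace_scale)
    show "0 \<le> y \<bullet> G y" if "y \<in> W" for y
    proof (cases "y = 0")
      case False
      have "y /\<^sub>R norm y \<in> S" unfolding S_def using that False W(1) by (auto intro: subspace_scale)
      from max[OF this] have "(y \<bullet> T y) / (norm y)\<^sup>2 \<le> l"
        by (simp add: linear_scale[OF T] l_def power2_eq_square field_simps)
      then have "y \<bullet> T y \<le> l * (norm y)\<^sup>2"
        using False by (simp add: field_simps)
      then show ?thesis by (simp add: G_def inner_diff_right power2_norm_eq_inner)
    qed simp
    show "u \<bullet> G u = 0"
      using uW by (simp add: G_def inner_diff_right l_def power2_norm_eq_inner[symmetric])
  qed (use uW W in auto)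
  then show thesis
    using that[OF uW, of l] by (simp add: G_def)
qed

text \<open>An orthonormal set of eigenvectors of maximal cardinality must span: otherwise its
  orthogonal complement is a nonzero invariant subspace and contains a further eigenvector.\<close>

lemma self_adjoint_eigenbasis:
  fixes T :: "'a::euclidean_space \<Rightarrow> 'a"
  assumes T: "linear T" and sym: "\<And>x y. x \<bullet> T y = T x \<bullet> y"
  obtains B l where "finite B" "pairwise orthogonal B" "\<And>b. b \<in> B \<Longrightarrow> norm b = 1"
    "span B = UNIV" "\<And>b. b \<in> B \<Longrightarrow> T b = l b *\<^sub>R b"
proof -
  define Q where "Q B \<longleftrightarrow> pairwise orthogonal B \<and> (\<forall>b\<in>B. norm b = 1 \<and> (\<exists>l. T b = l *\<^sub>R b))" for B
  have ind: "independent B" if "Q B" for B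
    using that unfolding Q_def by (intro pairwise_orthogonal_independent) auto
  have "\<forall>B. Q B \<longrightarrow> card B \<le> DIM('a)"
    using ind independent_bound by blast
  moreover have "Q {}" by (simp add: Q_def)
  ultimately have "\<exists>B. Q B \<and> (\<forall>B'. Q B' \<longrightarrow> card B' \<le> card B)"
    by (intro ex_has_greatest_nat[of Q "{}" card "Suc DIM('a)"]) (auto simp: less_Suc_eq_le)
  then obtain B where B: "Q B" "\<And>B'. Q B' \<Longrightarrow> card B' \<le> card B"
    by blast
  have fin: "finite B" using ind[OF B(1)] independent_bound by blast
  have "span B = UNIV"
  proof (rule ccontr)
    assume "span B \<noteq> UNIV"
    then have "dim B < DIM('a)"
      using dim_eq_full[of B] dim_subset_UNIV[of B] by linarith
    then obtain x where x: "x \<noteq> 0" "\<And>y. y \<in> span B \<Longrightarrow> orthogonal x y"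
      using orthogonal_to_subspace_exists by blast
    define W where "W = {x. \<forall>b\<in>B. b \<bullet> x = 0}"
    have "subspace W"
      by (auto simp: subspace_def W_def inner_right_distrib)
    moreover have "T ` W \<subseteq> W"
      using B(1) by (auto simp: W_def Q_def sym)
    moreover have "x \<in> W"
      using x(2) by (auto simp: W_def orthogonal_def inner_commute span_base)
    ultimately obtain u l where u: "u \<in> W" "norm u = 1" "T u = l *\<^sub>R u"
      using self_adjoint_eigenvector[OF T sym] x(1) by metis
    have "u \<notin> B" using u by (auto simp: W_def)
    have "Q (insert u B)"
      using B(1) u by (auto simp: Q_def pairwise_insert orthogonal_def W_def inner_commute)
    from B(2)[OF this] \<open>u \<notin> B\<close> fin show False by simp
  qed
  moreover obtain l where "\<And>b. b \<in> B \<Longrightarrow> T b = l b *\<^sub>R b"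
    using B(1) unfolding Q_def by metis
  ultimately show thesis
    using that[of B l] fin B(1) by (auto simp: Q_def)
qed

section \<open>Existence and uniqueness of the positive definite root\<close>

lemma transpose_eq_iff_inner:
  fixes R :: "real ^ 'n ^ 'n"
  shows "transpose R = R \<longleftrightarrow> (\<forall>x y. x \<bullet> (R *v y) = (R *v x) \<bullet> y)"
proof
  show "\<forall>x y. x \<bullet> (R *v y) = (R *v x) \<bullet> y" if "transpose R = R"
    using that dot_lmul_matrix[of _ R] transpose_matrix_vector[of R] by metis
next
  assume *: "\<forall>x y. x \<bullet> (R *v y) = (R *v x) \<bullet> y"
  have "R $ i $ j = R $ j $ i" for i j
    using *[rule_format, of "axis i 1" "axis j 1"]
    by (simp add: matrix_vector_mult_basis column_def inner_axis inner_axis')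
  then show "transpose R = R"
    by (simp add: vec_eq_iff transpose_def)
qed

lemma pos_def_matD:
  assumes "pos_def_mat R"
  shows "x \<bullet> (R *v y) = (R *v x) \<bullet> y" "x \<noteq> 0 \<Longrightarrow> 0 < x \<bullet> (R *v x)" "transpose R = R"
  using assms transpose_eq_iff_inner by (auto simp: pos_def_mat_def)

lemma pos_def_mat_invertible:
  assumes "pos_def_mat R"
  shows "invertible R"
  using pos_def_matD(2)[OF assms] unfolding invertible_left_inverse matrix_left_invertible_ker
  by (metis inner_zero_right less_irrefl)

lemma pos_def_sqrt_exists:
  assumes P: "pos_def_mat P"
  shows "\<exists>R. pos_def_mat R \<and> R ** R = P"
proof -
  obtain B l where B: "finite B" "pairwise orthogonal B" "\<And>b. b \<in> B \<Longrightarrow> norm b = 1"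
    "span B = UNIV" and ev: "\<And>b. b \<in> B \<Longrightarrow> P *v b = l b *\<^sub>R b"
    using self_adjoint_eigenbasis[OF matrix_vector_mul_linear[of P] pos_def_matD(1)[OF P]] by metis
  have pos: "l b > 0" if "b \<in> B" for b
  proof -
    have "b \<noteq> 0" using B(3)[OF that] by auto
    then show ?thesis
      using pos_def_matD(2)[OF P, of b] ev[OF that] B(3)[OF that] by (simp add: power2_norm_eq_inner[symmetric])
  qed
  have expand: "(\<Sum>b\<in>B. (x \<bullet> b) *\<^sub>R b) = x" for x
    using orthonormal_basis_expand[OF B(2,3) _ B(1)] B(4) by simp
  \<comment> \<open>The operator with the same eigenbasis as P and with eigenvalues
    \<open>sqrt (l b)\<close>.\<close>
  define r where "r x = (\<Sum>b\<in>B. (sqrt (l b) * (x \<bullet> b)) *\<^sub>R b)" for x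
  have "linear r"
    unfolding r_def by (intro linear_compose_sum ballI linearI)
      (simp_all add: inner_left_distrib algebra_simps)
  define R where "R = matrix r"
  have R: "R *v x = r x" for x
    unfolding R_def using matrix_works[of r] \<open>linear r\<close> by (simp add: linear_matrix_vector_mul_eq)
  have rb: "r b = sqrt (l b) *\<^sub>R b" if "b \<in> B" for b
  proof -
    have "b \<bullet> b' = (if b' = b then 1 else 0)" if "b' \<in> B" for b'
      using B(2,3) \<open>b \<in> B\<close> that by (auto simp: pairwise_def orthogonal_def norm_eq_1)
    then have "r b = (\<Sum>b'\<in>B. if b' = b then sqrt (l b) *\<^sub>R b else 0)"
      unfolding r_def by (intro sum.cong) auto
    then show ?thesis using that B(1) by simp
  qed
  have "R ** R = P"
  proof -
    have "(R ** R) *v b = P *v b" if "b \<in> B" for b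
      using that pos[OF that] by (simp add: matrix_vector_mul_assoc[symmetric] R rb ev linear_scale[OF \<open>linear r\<close>])
    then have "(R ** R) *v x = P *v x" for x
      using linear_eq_on_span[OF matrix_vector_mul_linear matrix_vector_mul_linear, of B "R ** R" P] B(4) by auto
    then show ?thesis by (simp add: matrix_eq)
  qed
  moreover have "x \<bullet> (R *v y) = (\<Sum>b\<in>B. sqrt (l b) * ((x \<bullet> b) * (y \<bullet> b)))" for x y
    by (simp add: R r_def inner_sum_right ac_simps)
  then have sym: "x \<bullet> (R *v y) = (R *v x) \<bullet> y" and quad: "x \<bullet> (R *v x) = (\<Sum>b\<in>B. sqrt (l b) * (x \<bullet> b)\<^sup>2)" for x y
    by (simp_all add: inner_commute[of "R *v x" y] power2_eq_square ac_simps)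
  have "0 < x \<bullet> (R *v x)" if "x \<noteq> 0" for x
  proof -
    obtain b where "b \<in> B" "x \<bullet> b \<noteq> 0"
      using expand[of x] \<open>x \<noteq> 0\<close> by (metis (no_types, lifting) scale_zero_left sum.neutral)
    then show ?thesis
      unfolding quad using pos B(1) by (intro sum_pos2[of _ b]) (auto simp: less_imp_le)
  qed
  with sym have "pos_def_mat R"
    by (auto simp: pos_def_mat_def transpose_eq_iff_inner)
  ultimately show ?thesis by blast
qed

text \<open>If \<open>R\<^sup>2 = R'\<^sup>2\<close>, then \<open>D = R - R'\<close> anticommutes with \<open>R + R'\<close>, which forces every
  eigenvalue of \<open>D\<close> to vanish.\<close>

lemma pos_def_sqrt_unique:
  assumes R: "pos_def_mat R" and R': "pos_def_mat R'" and eq: "R ** R = R' ** R'"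
  shows "R = R'"
proof -
  define D where "D x = R *v x - R' *v x" for x
  have "linear D"
    unfolding D_def by (intro linear_compose_sub matrix_vector_mul_linear)
  have sym: "x \<bullet> D y = D x \<bullet> y" for x y
    by (simp add: D_def inner_diff_left inner_diff_right pos_def_matD(1)[OF R] pos_def_matD(1)[OF R'])
  obtain B l where B: "\<And>b. b \<in> B \<Longrightarrow> norm b = 1" "span B = UNIV" "\<And>b. b \<in> B \<Longrightarrow> D b = l b *\<^sub>R b"
    using self_adjoint_eigenbasis[OF \<open>linear D\<close> sym] by metis
  have "D b = 0" if b: "b \<in> B" for b
  proof -
    have "b \<noteq> 0" using B(1)[OF b] by auto
    define w where "w = R *v b + R' *v b"
    have "R *v (R *v b) = R' *v (R' *v b)"
      using eq by (simp add: matrix_vector_mul_assoc)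
    then have "D w + (R *v D b + R' *v D b) = 0"
      by (simp add: D_def w_def matrix_vector_right_distrib matrix_vector_mult_diff_distrib algebra_simps)
    \<comment> \<open>Self-adjointness turns each of the two summands D w and R D b + R' D b into l
      b (b \<bullet> w), and b \<bullet> w is positive.\<close>
    then have "0 = b \<bullet> (D w + (R *v D b + R' *v D b))" by simp
    also have "\<dots> = 2 * l b * (b \<bullet> w)"
      by (simp only: inner_right_distrib sym[of b w] B(3)[OF b])
        (simp add: w_def inner_right_distrib algebra_simps matrix_vector_mult_scaleR)
    finally have "l b * (b \<bullet> w) = 0" by simp
    moreover have "b \<bullet> w > 0"
      using pos_def_matD(2)[OF R \<open>b \<noteq> 0\<close>] pos_def_matD(2)[OF R' \<open>b \<noteq> 0\<close>] by (simp add: w_def inner_right_distrib)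
    ultimately show ?thesis using B(3)[OF b] by simp
  qed
  then have "D x = 0" for x
    using linear_eq_0_on_span[OF \<open>linear D\<close>, of B x] B(2) by auto
  then show ?thesis by (simp add: D_def matrix_eq)
qed

lemma pos_def_mat_matrix_inv:
  assumes P: "pos_def_mat P"
  shows "pos_def_mat (matrix_inv P)"
proof -
  note inv = matrix_inv_mult[OF pos_def_mat_invertible[OF P]]
  have PQ: "P *v (matrix_inv P *v x) = x" for x
    using inv by (simp add: matrix_vector_mul_assoc)
  have "x \<bullet> (matrix_inv P *v y) = (matrix_inv P *v x) \<bullet> y" for x y
    using pos_def_matD(1)[OF P, of "matrix_inv P *v x" "matrix_inv P *v y"] by (simp add: PQ)
  moreover have "0 < x \<bullet> (matrix_inv P *v x)" if "x \<noteq> 0" for x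
  proof -
    have "matrix_inv P *v x \<noteq> 0" using that PQ[of x] by auto
    from pos_def_matD(2)[OF P this] show ?thesis by (simp add: PQ inner_commute)
  qed
  ultimately show ?thesis by (auto simp: pos_def_mat_def transpose_eq_iff_inner)
qed

lemma inv_sqrt_mat:
  assumes C: "pos_def_mat C"
  shows "pos_def_mat (inv_sqrt_mat C)" "inv_sqrt_mat C ** inv_sqrt_mat C = matrix_inv C"
    and "inv_sqrt_mat C ** C ** inv_sqrt_mat C = mat 1"
proof -
  have "\<exists>!R. pos_def_mat R \<and> R ** R = matrix_inv C"
    using pos_def_sqrt_exists[OF pos_def_mat_matrix_inv[OF C]] pos_def_sqrt_unique by metis
  from theI'[OF this] show R: "pos_def_mat (inv_sqrt_mat C)" "inv_sqrt_mat C ** inv_sqrt_mat C = matrix_inv C"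
    unfolding inv_sqrt_mat_def by blast+
  have "inv_sqrt_mat C ** (inv_sqrt_mat C ** C) = mat 1"
    using R(2) matrix_inv_mult[OF pos_def_mat_invertible[OF C]] by (simp add: matrix_mul_assoc)
  then show "inv_sqrt_mat C ** C ** inv_sqrt_mat C = mat 1"
    \<comment> \<open>For square matrices a right inverse is also a left inverse, so R (R C) = I may
      be read as (R C) R = I.\<close>
    by (subst (asm) matrix_left_right_inverse)
qed

section \<open>The constraint set of the contrast\<close>

lemma norm_mult_le_spectral_norm: "norm (B *v x) \<le> spectral_norm B * norm x"
  unfolding spectral_norm_def by (rule onorm[OF matrix_vector_mul_bounded_linear])

lemma spectral_norm_nonneg: "0 \<le> spectral_norm B"
  unfolding spectral_norm_def by (rule onorm_pos_le[OF matrix_vector_mul_bounded_linear])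

lemma norm_mult_le_norm:
  fixes B :: "real ^ 'n ^ 'm"
  shows "norm (B *v x) \<le> norm B * norm x"
proof -
  have "norm (B *v x) = L2_set (\<lambda>i. \<bar>B $ i \<bullet> x\<bar>) UNIV"
    by (simp add: norm_vec_def matrix_vector_mult_def inner_vec_def)
  also have "\<dots> \<le> L2_set (\<lambda>i. norm (B $ i) * norm x) UNIV"
    by (intro L2_set_mono Cauchy_Schwarz_ineq2) auto
  also have "\<dots> = norm B * norm x"
    by (simp add: L2_set_left_distrib norm_vec_def)
  finally show ?thesis .
qed

lemma row_eq_component: "row i \<theta> = \<theta> $ i"
  by (simp add: row_def vec_eq_iff)

lemma mult_component_inner: "(\<theta> *v x) $ i = row i \<theta> \<bullet> x" for \<theta> :: "real ^ 'n ^ 'm"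
  by (simp add: matrix_vector_mult_def inner_vec_def row_def)

lemma Xi1_alt_def:
  "Xi1 \<kappa> = {\<theta> :: real ^ 'd ^ 'd::finite. (\<forall>i. norm (row i \<theta>) = 1) \<and>
    (\<forall>x y. norm (\<theta> *v x) * norm y \<le> \<kappa> * (norm x * norm (\<theta> *v y)))}" (is "_ = ?R")
proof (intro equalityI subsetI)
  fix \<theta> :: "real ^ 'd ^ 'd" assume "\<theta> \<in> Xi1 \<kappa>"
  then have \<theta>: "invertible \<theta>" "\<And>i. norm (row i \<theta>) = 1" "cond2 \<theta> \<le> \<kappa>" by (auto simp: Xi1_def)
  have "norm (\<theta> *v x) * norm y \<le> \<kappa> * (norm x * norm (\<theta> *v y))" for x y
  proof -
    have y: "y = matrix_inv \<theta> *v (\<theta> *v y)"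
      using matrix_inv_mult[OF \<theta>(1)] by (simp add: matrix_vector_mul_assoc)
    have "norm (\<theta> *v x) * norm y \<le> (spectral_norm \<theta> * norm x) * (spectral_norm (matrix_inv \<theta>) * norm (\<theta> *v y))"
      using norm_mult_le_spectral_norm[of "matrix_inv \<theta>" "\<theta> *v y"] y
      by (intro mult_mono norm_mult_le_spectral_norm mult_nonneg_nonneg spectral_norm_nonneg) auto
    also have "\<dots> = cond2 \<theta> * (norm x * norm (\<theta> *v y))" by (simp add: cond2_def)
    also have "\<dots> \<le> \<kappa> * (norm x * norm (\<theta> *v y))"
      by (intro mult_right_mono \<theta>(3)) auto
    finally show ?thesis .
  qed
  with \<theta> show "\<theta> \<in> ?R" by auto
next
  fix \<theta> :: "real ^ 'd ^ 'd" assume "\<theta> \<in> ?R"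
  then have \<theta>: "\<And>i. norm (row i \<theta>) = 1"
    and le: "\<And>x y. norm (\<theta> *v x) * norm y \<le> \<kappa> * (norm x * norm (\<theta> *v y))" by auto
  \<comment> \<open>The image of a unit row has entry 1 at the index of that row and is thus
    nonzero. With this row as x, \<open>le\<close> shows that \<theta> is injective.\<close>
  have "\<theta> *v row i \<theta> \<noteq> 0" for i
  proof -
    have "(\<theta> *v row i \<theta>) $ i = 1"
      unfolding mult_component_inner using \<theta>[of i] by (simp add: norm_eq_1)
    then show ?thesis by auto
  qed
  then have "x = 0" if "\<theta> *v x = 0" for x
    using le[of "row undefined \<theta>" x] that \<theta>[of undefined] by (auto simp: mult_le_0_iff)
  then have inv: "invertible \<theta>"
    unfolding invertible_left_inverse matrix_left_invertible_ker by blast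
  \<comment> \<open>For fixed z the inequality in x bounds \<open>spectral_norm \<theta>\<close>;
    varying z afterwards recovers the product in \<open>cond2\<close>.\<close>
  have inner: "norm (matrix_inv \<theta> *v z) * spectral_norm \<theta> \<le> \<kappa> * norm z" for z
  proof (cases "matrix_inv \<theta> *v z = 0")
    case True
    then have "z = 0"
      using matrix_inv_mult[OF inv] by (metis matrix_vector_mul_assoc matrix_vector_mul_lid matrix_vector_mult_0_right)
    then show ?thesis by simp
  next
    case False
    then have n: "norm (matrix_inv \<theta> *v z) > 0" by simp
    have "spectral_norm \<theta> \<le> \<kappa> * norm z / norm (matrix_inv \<theta> *v z)"
      unfolding spectral_norm_def
    proof (rule onorm_le)
      fix x
      have "\<theta> *v (matrix_inv \<theta> *v z) = z"
        using matrix_inv_mult[OF inv] by (simp add: matrix_vector_mul_assoc)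
      then show "norm (\<theta> *v x) \<le> \<kappa> * norm z / norm (matrix_inv \<theta> *v z) * norm x"
        using le[of x "matrix_inv \<theta> *v z"] n by (simp add: field_simps)
    qed
    then show ?thesis using n by (simp add: field_simps)
  qed
  have s: "spectral_norm \<theta> > 0"
  proof -
    have "norm (\<theta> *v row undefined \<theta>) > 0" using \<open>\<And>i. \<theta> *v row i \<theta> \<noteq> 0\<close> by simp
    then show ?thesis
      using norm_mult_le_spectral_norm[of \<theta> "row undefined \<theta>"] \<theta>[of undefined]
      by (simp del: zero_less_norm_iff)
  qed
  have "spectral_norm (matrix_inv \<theta>) \<le> \<kappa> / spectral_norm \<theta>"
    unfolding spectral_norm_def[of "matrix_inv \<theta>"]
    using inner s by (intro onorm_le) (simp add: field_simps)
  then have "cond2 \<theta> \<le> \<kappa>"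
    using s by (simp add: cond2_def field_simps)
  with \<theta> inv show "\<theta> \<in> Xi1 \<kappa>" by (simp add: Xi1_def)
qed

lemma compact_Xi1: "compact (Xi1 \<kappa> :: (real ^ 'd ^ 'd::finite) set)"
proof -
  have c: "continuous_on UNIV (\<lambda>\<theta> :: real ^ 'd ^ 'd. \<theta> *v x)" for x
    unfolding matrix_vector_mult_def by (intro continuous_intros)
  have "closed (Xi1 \<kappa> :: (real ^ 'd ^ 'd) set)"
    unfolding Xi1_alt_def row_eq_component
    by (intro closed_Collect_conj closed_Collect_all closed_Collect_eq closed_Collect_le continuous_intros c)
  moreover have "bounded (Xi1 \<kappa> :: (real ^ 'd ^ 'd) set)"
  proof (rule boundedI)
    fix \<theta> :: "real ^ 'd ^ 'd" assume "\<theta> \<in> Xi1 \<kappa>"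
    then have "norm (\<theta> $ i) = 1" for i by (simp add: Xi1_def row_eq_component)
    moreover have "norm \<theta> \<le> (\<Sum>i\<in>UNIV. norm (\<theta> $ i))"
      unfolding norm_vec_def by (rule L2_set_le_sum) simp
    ultimately show "norm \<theta> \<le> real CARD('d)" by simp
  qed
  ultimately show ?thesis by (simp add: compact_eq_bounded_closed)
qed

text \<open>A unit row r satisfies \<open>norm (\<theta> *v r) \<ge> 1\<close>, so x = r in the
  condition-number inequality turns \<kappa> into a lower bound for \<theta>. This later strips
  \<theta> from products \<theta> R.\<close>

lemma Xi1_lower_bound:
  fixes \<theta> :: "real ^ 'd ^ 'd::finite"
  assumes "\<theta> \<in> Xi1 \<kappa>"
  shows "norm z \<le> \<kappa> * norm (\<theta> *v z)"
proof -
  define r where "r = row undefined \<theta>"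
  have r: "norm r = 1" using assms by (simp add: r_def Xi1_def)
  have "(\<theta> *v r) $ undefined = 1"
    unfolding mult_component_inner using r by (simp add: r_def[symmetric] norm_eq_1)
  then have "1 \<le> norm (\<theta> *v r)"
    using component_le_norm_cart[of "\<theta> *v r" undefined] by simp
  then have "norm z \<le> norm (\<theta> *v r) * norm z"
    using mult_right_mono[of 1 "norm (\<theta> *v r)" "norm z"] by simp
  also have "\<dots> \<le> \<kappa> * (norm r * norm (\<theta> *v z))"
    using assms unfolding Xi1_alt_def by blast
  finally show ?thesis using r by simp
qed

lemma normalize_rows_in_Xi1:
  assumes "invertible B" "cond2 (normalize_rows B) \<le> \<kappa>"
  shows "normalize_rows B \<in> Xi1 \<kappa>"
proof -
  have ker: "x = 0" if "B *v x = 0" for x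
    using assms(1) that unfolding invertible_left_inverse matrix_left_invertible_ker by blast
  have row: "row i B \<noteq> 0" for i
  proof
    assume "row i B = 0"
    then have "\<forall>x. (B *v x) $ i = 0" by (simp add: mult_component_inner)
    moreover have "B *v (matrix_inv B *v axis i 1) = axis i 1"
      using matrix_inv_mult[OF assms(1)] by (simp add: matrix_vector_mul_assoc)
    ultimately show False by (metis axis_nth zero_neq_one)
  qed
  have comp: "(normalize_rows B *v x) $ i = (B *v x) $ i / norm (row i B)" for x i
    unfolding mult_component_inner by (simp add: normalize_rows_def row_eq_component divide_inverse_commute)
  then have "B *v x = 0" if "normalize_rows B *v x = 0" for x
  proof -
    have "(B *v x) $ i / norm (row i B) = 0" for i
      using comp[of x i] that by simp
    then show ?thesis using row by (simp add: vec_eq_iff[of "B *v x"])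
  qed
  then have "invertible (normalize_rows B)"
    unfolding invertible_left_inverse matrix_left_invertible_ker using ker by blast
  moreover have "norm (row i (normalize_rows B)) = 1" for i
    using row[of i] by (simp add: normalize_rows_def row_eq_component)
  ultimately show ?thesis using assms(2) by (simp add: Xi1_def)
qed

section \<open>Existence of minimizers of the contrast\<close>

text \<open>A semidefinite form vanishes only on the kernel of its matrix, so invertibility upgrades
  it to a definite one.\<close>

lemma pos_def_C_mat:
  assumes \<mu>: "\<mu> \<in> finite_signal_laws" and inv: "invertible (C_mat \<mu>)"
  shows "pos_def_mat (C_mat \<mu>)"
proof -
  have sym: "x \<bullet> (C_mat \<mu> *v y) = (C_mat \<mu> *v x) \<bullet> y" for x y
    using transpose_C_mat transpose_eq_iff_inner by blast
  have "0 < x \<bullet> (C_mat \<mu> *v x)" if "x \<noteq> 0" for x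
  proof -
    have "C_mat \<mu> *v x \<noteq> 0"
      using inv that unfolding invertible_left_inverse matrix_left_invertible_ker by blast
    then have "x \<bullet> (C_mat \<mu> *v x) \<noteq> 0"
      using psd_null_vector[OF matrix_vector_mul_linear sym subspace_UNIV _ C_mat_psd[OF \<mu>], of x] by auto
    then show ?thesis using C_mat_psd[OF \<mu>, of x] by linarith
  qed
  then show ?thesis by (simp add: pos_def_mat_def transpose_C_mat)
qed

lemma R_mat:
  assumes "\<mu> \<in> finite_signal_laws" "invertible (C_mat \<mu>)"
  shows "pos_def_mat (R_mat \<mu>)" "R_mat \<mu> ** R_mat \<mu> = matrix_inv (C_mat \<mu>)"
    "R_mat \<mu> ** C_mat \<mu> ** R_mat \<mu> = mat 1" "invertible (R_mat \<mu>)"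
  unfolding R_mat_def using inv_sqrt_mat[OF pos_def_C_mat[OF assms]]
  by (auto intro: pos_def_mat_invertible)

lemma matrix_inv_unique:
  assumes "A ** B = mat 1" "B ** A = mat 1"
  shows "matrix_inv A = B"
proof -
  have "invertible A" using assms by (auto simp: invertible_def)
  note inv = matrix_inv_mult[OF this]
  have "matrix_inv A = matrix_inv A ** (A ** B)" by (simp add: assms)
  also have "\<dots> = B" by (simp add: matrix_mul_assoc inv)
  finally show ?thesis .
qed

lemma matrix_inv_mat_1: "matrix_inv (mat 1 :: real ^ 'n ^ 'n) = mat 1"
  by (rule matrix_inv_unique) auto

text \<open>Since \<open>R C R = I\<close>, the push-forward under \<open>\<theta> R\<close> has diagonal \<open>\<theta> \<theta>\<^sup>T\<close>.\<close>

lemma N_mat_whitened: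
  assumes \<mu>: "\<mu> \<in> finite_signal_laws" "invertible (C_mat \<mu>)" and \<theta>: "\<theta> \<in> Xi1 \<kappa>"
  shows "N_mat (mat_push (\<theta> ** R_mat \<mu>) \<mu>) = mat 1"
    and "esig (mat_push (\<theta> ** R_mat \<mu>) \<mu>) [i, i] = 1"
proof -
  note R = R_mat[OF \<mu>]
  have 1: "esig (mat_push (\<theta> ** R_mat \<mu>) \<mu>) [i, i] = 1" for i
  proof -
    have "C_mat (mat_push (\<theta> ** R_mat \<mu>) \<mu>) = \<theta> ** (R_mat \<mu> ** C_mat \<mu> ** R_mat \<mu>) ** transpose \<theta>"
      unfolding C_mat_mat_push[OF \<mu>(1)] matrix_transpose_mul pos_def_matD(3)[OF R(1)]
      by (simp add: matrix_mul_assoc)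
    also have "\<dots> = \<theta> ** transpose \<theta>" by (simp add: R)
    finally have "esig (mat_push (\<theta> ** R_mat \<mu>) \<mu>) [i, i] = (\<theta> ** transpose \<theta>) $ i $ i"
      by (simp add: C_mat_diag[symmetric])
    also have "\<dots> = row i \<theta> \<bullet> row i \<theta>"
      by (simp add: matrix_matrix_mult_def transpose_def inner_vec_def row_def)
    also have "\<dots> = 1" using \<theta> by (simp add: Xi1_def norm_eq_1)
    finally show ?thesis .
  qed
  then show "esig (mat_push (\<theta> ** R_mat \<mu>) \<mu>) [i, i] = 1" .
  show "N_mat (mat_push (\<theta> ** R_mat \<mu>) \<mu>) = mat 1"
    by (simp add: N_mat_def diag_mat_def 1 mat_def)
qed

text \<open>On the constraint set all normalizing factors are 1, so roots and inverses disappear and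
  the contrast is a polynomial in the entries of \<theta>.\<close>

lemma continuous_on_contrast:
  assumes \<mu>: "\<mu> \<in> finite_signal_laws" "invertible (C_mat \<mu>)"
  shows "continuous_on (Xi1 \<kappa>) (contrast \<mu>)"
proof -
  define R where "R = R_mat \<mu>"
  define f where "f \<theta> = (norm (offdiag (coord0 (mat_push (\<theta> ** R) \<mu>))))\<^sup>2
    + (\<Sum>\<nu>\<in>UNIV. (norm (offdiag (coord (mat_push (\<theta> ** R) \<mu>) \<nu>)))\<^sup>2)" for \<theta>
  have "contrast \<mu> \<theta> = f \<theta>" if "\<theta> \<in> Xi1 \<kappa>" for \<theta>
    by (simp add: contrast_def f_def x0_mat_def x_mat_def Let_def R_def N_mat_whitened[OF \<mu> that] matrix_inv_mat_1)
  moreover have comp: "continuous_on (Xi1 \<kappa>) (\<lambda>\<theta>. (\<theta> ** R) $ i $ k)" for i k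
    unfolding matrix_matrix_mult_def by (simp, intro continuous_intros)
  have off: "continuous_on (Xi1 \<kappa>) (\<lambda>\<theta>. offdiag (g \<theta>))"
    if "\<And>i j. continuous_on (Xi1 \<kappa>) (\<lambda>\<theta>. g \<theta> $ i $ j)" for g :: "real ^ 'b ^ 'b \<Rightarrow> real ^ 'b ^ 'b"
  proof -
    have "continuous_on (Xi1 \<kappa>) (\<lambda>\<theta>. if i = j then 0 else g \<theta> $ i $ j)" for i j
      using that by (cases "i = j") auto
    then show ?thesis
      unfolding offdiag_def by (intro continuous_intros)
  qed
  have "continuous_on (Xi1 \<kappa>) f"
    unfolding f_def
    by (intro continuous_intros off; simp add: coord0_def coord_def esig_mat_push[OF \<mu>(1)])
      (intro continuous_intros comp)+
  ultimately show ?thesis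
    using continuous_on_cong by metis
qed

lemma inversion_map_nonempty:
  fixes \<mu> :: "'d::finite path measure"
  assumes \<Phi>: "inversion_map \<kappa> \<Phi>" and ne: "(Xi1 \<kappa> :: (real ^ 'd ^ 'd) set) \<noteq> {}"
    and \<mu>: "\<mu> \<in> finite_signal_laws" "invertible (C_mat \<mu>)"
  obtains \<theta> where "\<theta> \<in> Xi1 \<kappa>" "\<theta> ** R_mat \<mu> \<in> \<Phi> \<mu>"
proof -
  obtain \<theta> where \<theta>: "\<theta> \<in> Xi1 \<kappa>" "\<And>\<theta>'. \<theta>' \<in> Xi1 \<kappa> \<Longrightarrow> contrast \<mu> \<theta> \<le> contrast \<mu> \<theta>'"
    using continuous_attains_inf[OF compact_Xi1 ne continuous_on_contrast[OF \<mu>]] by metis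
  then have "is_arg_min (contrast \<mu>) (\<lambda>\<theta>. \<theta> \<in> Xi1 \<kappa>) \<theta>"
    by (auto simp: is_arg_min_linorder)
  moreover have "\<Phi> \<mu> = {\<theta> ** R_mat \<mu> |\<theta>. is_arg_min (contrast \<mu>) (\<lambda>\<theta>. \<theta> \<in> Xi1 \<kappa>) \<theta>}"
    using \<Phi> \<mu> by (auto simp: inversion_map_def finite_signal_laws_def)
  ultimately show thesis using that \<theta>(1) by blast
qed

text \<open>The row-normalized inverse whose condition number enters \<open>kappa_bound\<close> is
  itself admissible, as \<Delta> is positive.\<close>

lemma Xi1_kappa_bound_nonempty:
  fixes A :: "real ^ 'd ^ 'd::finite"
  assumes \<S>: "\<S> \<in> finite_signal_laws" "invertible (C_mat \<S>)" and A: "invertible A" and "\<Delta> > 0"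
  shows "(Xi1 (kappa_bound A \<S> \<Delta>) :: (real ^ 'd ^ 'd) set) \<noteq> {}"
proof -
  have "C_mat (mat_push A \<S>) = A ** C_mat \<S> ** transpose A"
    by (rule C_mat_mat_push[OF \<S>(1)])
  then have "invertible (C_mat (mat_push A \<S>))"
    using A \<S>(2) by (simp add: invertible_mult transpose_invertible)
  then have "invertible (R_mat (mat_push A \<S>) ** A)"
    using R_mat(4)[OF mat_push_finite_signal_laws[OF \<S>(1) A]] A by (simp add: invertible_mult)
  then have "invertible (matrix_inv (R_mat (mat_push A \<S>) ** A))"
    using matrix_inv_mult unfolding invertible_def by blast
  then show ?thesis
    using normalize_rows_in_Xi1[of _ "kappa_bound A \<S> \<Delta>"] \<open>\<Delta> > 0\<close> by (force simp: kappa_bound_def)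
qed

section \<open>The modulus of the dissimilarity\<close>

lemma source_lawsD:
  assumes "\<S> \<in> source_laws"
  shows "\<S> \<in> finite_signal_laws" "invertible (C_mat \<S>)" "0 < esig \<S> [i, i]"
    "i \<noteq> j \<Longrightarrow> esig \<S> [i, j] = 0"
proof -
  have *: "\<S> \<in> signal_laws_dot"
    using assms by (simp add: source_laws_def)
  show "invertible (C_mat \<S>)"
    using assms by (simp add: source_laws_def)
  from * show f: "\<S> \<in> finite_signal_laws" using signal_laws_dot_subset by blast
  have "esig \<S> [i, i] \<noteq> 0" using * by (simp add: signal_laws_dot_def)
  then show "0 < esig \<S> [i, i]" using esig_diag_nonneg[OF f, of i] by linarith
  have "esig \<S> [i, j] = of_bool (i = j) * esig \<S> [i, j]"
    using assms unfolding source_laws_def by blast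
  then show "i \<noteq> j \<Longrightarrow> esig \<S> [i, j] = 0" by simp
qed

lemma diag_mat_mult: "diag_mat c ** diag_mat c' = diag_mat (\<lambda>i. c i * c' i)"
proof -
  have "(\<Sum>k\<in>UNIV. (if i = k then c i else 0) * (if k = j then c' k else 0)) =
      (\<Sum>k\<in>UNIV. if k = i then (if i = j then c i * c' i else 0) else 0)" for i j
    by (intro sum.cong) auto
  then show ?thesis
    by (simp add: diag_mat_def matrix_matrix_mult_def vec_eq_iff)
qed

lemma diag_mat_inverse:
  assumes "\<And>i. c i \<noteq> 0"
  shows "diag_mat c ** diag_mat (\<lambda>i. inverse (c i)) = mat 1" "diag_mat (\<lambda>i. inverse (c i)) ** diag_mat c = mat 1"
  unfolding diag_mat_mult using assms by (simp_all add: diag_mat_def mat_def)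

lemma sandwich_component:
  fixes D X :: "real ^ 'n ^ 'n"
  shows "(D ** X ** D) $ i $ j = (\<Sum>l\<in>UNIV. (\<Sum>k\<in>UNIV. D $ i $ k * X $ k $ l) * D $ l $ j)"
  by (simp add: matrix_matrix_mult_def)

lemma phi_S_nonneg: "\<S> \<in> finite_signal_laws \<Longrightarrow> 0 \<le> phi_S \<S> v"
  unfolding phi_S_def using esig_diag_nonneg[of \<S>] by (auto intro!: add_nonneg_nonneg sum_nonneg)

text \<open>For a source law, \<open>phi_S\<close> is a weighted Euclidean norm of the deviation
  from \<open>coords \<S>\<close>. Its homogeneity gives both the linearity of
  \<open>omega_phi\<close> and the effect of mixing with \<S>.\<close>

lemma phi_S_scale:
  "phi_S \<S> (coords \<S> + t *\<^sub>R w) = \<bar>t\<bar> * phi_S \<S> (coords \<S> + w)"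
proof -
  define D where "D = matrix_inv (N_mat \<S>)"
  have "D ** (t *\<^sub>R X) ** D = t *\<^sub>R (D ** X ** D)" for X
    by (simp add: vec_eq_iff sandwich_component sum_distrib_left sum_distrib_right ac_simps)
  then have n: "(norm (D ** (t *\<^sub>R X) ** D))\<^sup>2 = t\<^sup>2 * (norm (D ** X ** D))\<^sup>2" for X
    by (simp add: power_mult_distrib)
  have "fst (coords \<S> + t *\<^sub>R w) - coord0 \<S> = t *\<^sub>R (fst (coords \<S> + w) - coord0 \<S>)"
    "snd (coords \<S> + t *\<^sub>R w) $ \<nu> - coord \<S> \<nu> = t *\<^sub>R (snd (coords \<S> + w) $ \<nu> - coord \<S> \<nu>)" for \<nu>
    by (simp_all add: coords_def)
  then have "(norm (D ** (fst (coords \<S> + t *\<^sub>R w) - coord0 \<S>) ** D))\<^sup>2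
      + (\<Sum>\<nu>\<in>UNIV. inverse (esig \<S> [\<nu>, \<nu>]) * (norm (D ** (snd (coords \<S> + t *\<^sub>R w) $ \<nu> - coord \<S> \<nu>) ** D))\<^sup>2)
    = t\<^sup>2 * ((norm (D ** (fst (coords \<S> + w) - coord0 \<S>) ** D))\<^sup>2
      + (\<Sum>\<nu>\<in>UNIV. inverse (esig \<S> [\<nu>, \<nu>]) * (norm (D ** (snd (coords \<S> + w) $ \<nu> - coord \<S> \<nu>) ** D))\<^sup>2))"
    by (simp only: n) (simp add: sum_distrib_left distrib_left ac_simps)
  then show ?thesis
    unfolding phi_S_def D_def[symmetric] by (simp add: real_sqrt_mult)
qed

lemma continuous_on_phi_S:
  fixes \<S> :: "'d::finite path measure"
  shows "continuous_on UNIV (phi_S \<S>)"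
proof -
  define D where "D = matrix_inv (N_mat \<S>)"
  have D: "continuous_on UNIV (\<lambda>v. D ** g v ** D)" if "continuous_on UNIV g" for g :: "'d coords \<Rightarrow> real ^ 'd ^ 'd"
    unfolding matrix_matrix_mult_def by (simp, intro continuous_intros that)
  then show ?thesis
    unfolding phi_S_def[abs_def] D_def[symmetric] by (intro continuous_intros D)
qed

text \<open>The diagonal normalizer is invertible, so the first term of \<open>phi_S\<close> cannot
  vanish. One such direction makes the slope of \<open>omega_phi\<close> positive.\<close>

lemma phi_S_pos:
  assumes \<S>: "\<S> \<in> source_laws" and "w \<noteq> 0"
  shows "0 < phi_S \<S> (coords \<S> + (w, 0))"
proof -
  define c where "c = (\<lambda>i. sqrt (esig \<S> [i, i]))"
  have c: "c i \<noteq> 0" for i using source_lawsD(3)[OF \<S>, of i] by (simp add: c_def)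
  define D where "D = matrix_inv (N_mat \<S>)"
  have N: "N_mat \<S> = diag_mat c" by (simp add: N_mat_def c_def)
  have D: "D ** diag_mat c = mat 1" "diag_mat c ** D = mat 1"
    unfolding D_def N using matrix_inv_mult diag_mat_inverse[of c] c unfolding invertible_def by blast+
  have "diag_mat c ** (D ** w ** D) ** diag_mat c = (diag_mat c ** D) ** w ** (D ** diag_mat c)"
    by (simp add: matrix_mul_assoc)
  also have "\<dots> = w" by (simp add: D)
  finally have w: "diag_mat c ** (D ** w ** D) ** diag_mat c = w" .
  have "D ** w ** D \<noteq> 0"
  proof
    assume "D ** w ** D = 0"
    then have "diag_mat c ** 0 ** diag_mat c = w" using w by simp
    moreover have "diag_mat c ** 0 ** diag_mat c = 0" by (simp add: matrix_matrix_mult_def vec_eq_iff)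
    ultimately show False using \<open>w \<noteq> 0\<close> by simp
  qed
  then have "0 < (norm (D ** w ** D))\<^sup>2" by simp
  moreover have "0 \<le> (\<Sum>\<nu>\<in>UNIV. inverse (esig \<S> [\<nu>, \<nu>]) * (norm (D ** (snd (coords \<S> + (w, 0)) $ \<nu> - coord \<S> \<nu>) ** D))\<^sup>2)"
    using source_lawsD(3)[OF \<S>] by (intro sum_nonneg) (simp add: less_imp_le)
  ultimately show ?thesis
    unfolding phi_S_def D_def[symmetric] by (simp add: coords_def)
qed

text \<open>By homogeneity the supremum over the ball of radius r is r times the maximum c over the
  unit ball, which compactness provides. So \<open>eta_phi\<close> is division by c on the
  nonnegative reals.\<close>

lemma omega_phi_linear:
  assumes \<S>: "\<S> \<in> source_laws"
  obtains c where "c > 0" "\<And>r. 0 \<le> r \<Longrightarrow> omega_phi \<S> r = c * r"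
    "\<And>v r. infnorm (v - coords \<S>) \<le> r \<Longrightarrow> phi_S \<S> v \<le> c * r"
proof -
  note nn = phi_S_nonneg[OF source_lawsD(1)[OF \<S>]]
  define f where "f w = phi_S \<S> (coords \<S> + w)" for w
  define K where "K = {w :: 'a coords. infnorm w \<le> 1}"
  have "closed K"
    unfolding K_def by (intro closed_Collect_le continuous_intros continuous_on_infnorm)
  moreover have "bounded K"
  proof (rule boundedI)
    fix w :: "'a coords" assume "w \<in> K"
    then have "sqrt DIM('a coords) * infnorm w \<le> sqrt DIM('a coords) * 1"
      unfolding K_def by (intro mult_left_mono) auto
    then show "norm w \<le> sqrt DIM('a coords)" using norm_le_infnorm[of w] by linarith
  qed
  ultimately have "compact K" by (simp add: compact_eq_bounded_closed)
  moreover have "0 \<in> K" by (simp add: K_def infnorm_0)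
  moreover have "continuous_on K f"
    unfolding f_def by (intro continuous_on_compose2[OF continuous_on_phi_S] continuous_intros) auto
  ultimately obtain w where w: "w \<in> K" "\<And>y. y \<in> K \<Longrightarrow> f y \<le> f w"
    using continuous_attains_sup[of K f] by blast
  have scale: "f (t *\<^sub>R y) = \<bar>t\<bar> * f y" for t y
    by (simp add: f_def phi_S_scale)
  have "f w > 0"
  proof -
    \<comment> \<open>A test direction, the identity in the first component, for showing that the
      maximum is positive.\<close>
    define e where "e = (mat 1 :: real ^ 'a ^ 'a, 0 :: (real ^ 'a ^ 'a) ^ 'a)"
    have "(mat 1 :: real ^ 'a ^ 'a) $ i $ i \<noteq> 0" for i by (simp add: mat_def)
    then have ne: "(mat 1 :: real ^ 'a ^ 'a) \<noteq> 0" by (metis zero_index)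
    then have "f e > 0" unfolding f_def e_def by (rule phi_S_pos[OF \<S>])
    moreover have n: "infnorm e > 0" using ne by (simp add: infnorm_pos_lt e_def zero_prod_def)
    ultimately have "0 < f (inverse (infnorm e) *\<^sub>R e)" by (simp add: scale)
    also have "\<dots> \<le> f w"
      using n by (intro w(2)) (simp add: K_def infnorm_mul)
    finally show ?thesis .
  qed
  moreover have le: "phi_S \<S> v \<le> f w * r" if "infnorm (v - coords \<S>) \<le> r" for v r
  proof (cases "r = 0")
    case True
    then have "v = coords \<S>" using that infnorm_pos_le[of "v - coords \<S>"] infnorm_eq_0[of "v - coords \<S>"] by simp
    then show ?thesis using phi_S_scale[of \<S> 0 0] True by simp
  next
    case False
    then have r: "r > 0" using that infnorm_pos_le[of "v - coords \<S>"] by linarith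
    define y where "y = inverse r *\<^sub>R (v - coords \<S>)"
    have "y \<in> K"
      unfolding y_def K_def mem_Collect_eq infnorm_mul using that r by (simp add: field_simps)
    have "phi_S \<S> v = f (r *\<^sub>R y)" using r by (simp add: f_def y_def)
    also have "\<dots> \<le> r * f w" using r w(2)[OF \<open>y \<in> K\<close>] by (simp add: scale)
    finally show ?thesis by (simp add: mult.commute)
  qed
  moreover have "omega_phi \<S> r = f w * r" if "0 \<le> r" for r
    unfolding omega_phi_def
  proof (rule cSup_eq_maximum)
    have "infnorm (r *\<^sub>R w) \<le> r"
      using w(1) that by (simp add: K_def infnorm_mul mult_left_le)
    moreover have "f w * r = phi_S \<S> (coords \<S> + r *\<^sub>R w)"
      using that by (simp add: phi_S_scale f_def)
    ultimately show "f w * r \<in> {phi_S \<S> v |v. infnorm (v - coords \<S>) \<le> r}"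
      by (intro CollectI exI[of _ "coords \<S> + r *\<^sub>R w"]) simp
  qed (use le in auto)
  ultimately show thesis using that[of "f w"] by blast
qed

lemma bij_betw_omega_phi:
  assumes "\<S> \<in> source_laws"
  shows "bij_betw (omega_phi \<S>) {0..} {0..}"
proof -
  obtain c where c: "c > 0" "\<And>r. 0 \<le> r \<Longrightarrow> omega_phi \<S> r = c * r"
    using omega_phi_linear[OF assms] by metis
  have "bij_betw (\<lambda>r. c * r) {0..} {0..}"
    using c(1) by (intro bij_betw_byWitness[of _ "\<lambda>r. r / c"]) auto
  then show ?thesis using c(2) bij_betw_cong[of "{0..}" "omega_phi \<S>" "\<lambda>r. c * r"] by simp
qed

lemma eta_phi_threshold:
  assumes \<S>: "\<S> \<in> source_laws" and "0 < d"
  shows "0 < eta_phi \<S> d"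
    and "infnorm (v - coords \<S>) < eta_phi \<S> d \<Longrightarrow> phi_S \<S> v < d"
proof -
  obtain c where c: "c > 0" "\<And>r. 0 \<le> r \<Longrightarrow> omega_phi \<S> r = c * r"
    "\<And>v r. infnorm (v - coords \<S>) \<le> r \<Longrightarrow> phi_S \<S> v \<le> c * r"
    using omega_phi_linear[OF \<S>] by metis
  have mem: "eta_phi \<S> d \<in> {0..}" and "omega_phi \<S> (eta_phi \<S> d) = d"
    using bij_betw_omega_phi[OF \<S>] \<open>0 < d\<close> inv_into_into[of d "omega_phi \<S>" "{0..}"]
      f_inv_into_f[of d "omega_phi \<S>" "{0..}"]
    unfolding eta_phi_def bij_betw_def by auto
  then have d: "c * eta_phi \<S> d = d" using c(2) by simp
  then show "0 < eta_phi \<S> d" using c(1) \<open>0 < d\<close> by (metis zero_less_mult_pos)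
  assume "infnorm (v - coords \<S>) < eta_phi \<S> d"
  then have "c * infnorm (v - coords \<S>) < d" using c(1) d by (metis mult_strict_left_mono)
  then show "phi_S \<S> v < d" using c(3)[OF order_refl, of v] by linarith
qed

section \<open>Perturbation of the coordinates under a matrix, in the maximum norm\<close>

lemma infnorm_mult_le_linf_opnorm:
  fixes B :: "real ^ 'n ^ 'n::finite"
  shows "infnorm (B *v x) \<le> linf_opnorm B * infnorm x"
proof (cases "x = 0")
  case False
  then have n: "infnorm x > 0" by (simp add: infnorm_pos_lt)
  have "bdd_above ((\<lambda>x. infnorm (B *v x)) ` {x. infnorm x \<le> 1})"
  proof (rule bdd_aboveI2)
    fix x :: "real ^ 'n" assume x: "x \<in> {x. infnorm x \<le> 1}"
    have "infnorm (B *v x) \<le> norm B * norm x"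
      using infnorm_le_norm norm_mult_le_norm order_trans by blast
    also have "\<dots> \<le> norm B * (sqrt DIM(real ^ 'n) * 1)"
      using x norm_le_infnorm[of x]
      by (intro mult_left_mono order_trans[OF norm_le_infnorm]) auto
    finally show "infnorm (B *v x) \<le> norm B * (sqrt DIM(real ^ 'n) * 1)" .
  qed
  then have "infnorm (B *v (inverse (infnorm x) *\<^sub>R x)) \<le> linf_opnorm B"
    unfolding linf_opnorm_def using n by (intro cSUP_upper) (auto simp: infnorm_mul)
  then show ?thesis
    using n by (simp add: matrix_vector_mult_scaleR infnorm_mul field_simps)
qed (simp add: infnorm_0)

lemma linf_opnorm_nonneg: "0 \<le> linf_opnorm (B :: real ^ 'n ^ 'n::finite)"
proof -
  have "(axis undefined 1 :: real ^ 'n) \<noteq> 0" by (simp add: axis_eq_0_iff)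
  then have "0 < infnorm (axis undefined 1 :: real ^ 'n)" by (simp add: infnorm_pos_lt)
  moreover have "0 \<le> linf_opnorm B * infnorm (axis undefined 1 :: real ^ 'n)"
    using infnorm_mult_le_linf_opnorm[of B "axis undefined 1"] infnorm_pos_le order_trans by blast
  ultimately show ?thesis by (simp add: zero_le_mult_iff)
qed

text \<open>Contracts one index with a row of B. Applied once per letter it yields powers of the
  operator norm, without factors that depend on the dimension.\<close>

lemma sum_row_le_linf_opnorm:
  fixes B :: "real ^ 'n ^ 'n::finite"
  assumes "\<And>k. \<bar>f k\<bar> \<le> c"
  shows "\<bar>\<Sum>k\<in>UNIV. B $ i $ k * f k\<bar> \<le> linf_opnorm B * c"
proof -
  have "infnorm (\<chi> k. f k) \<le> c"
    unfolding infnorm_cart using assms by (intro cSup_least) auto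
  have "\<bar>\<Sum>k\<in>UNIV. B $ i $ k * f k\<bar> = \<bar>(B *v (\<chi> k. f k)) $ i\<bar>"
    by (simp add: matrix_vector_mult_def)
  also have "\<dots> \<le> infnorm (B *v (\<chi> k. f k))" by (rule component_le_infnorm_cart)
  also have "\<dots> \<le> linf_opnorm B * infnorm (\<chi> k. f k)" by (rule infnorm_mult_le_linf_opnorm)
  also have "\<dots> \<le> linf_opnorm B * c"
    by (intro mult_left_mono linf_opnorm_nonneg) fact
  finally show ?thesis .
qed

lemma infnorm_coords_le:
  fixes v :: "'d::finite coords"
  assumes "\<And>i j. \<bar>fst v $ i $ j\<bar> \<le> c" "\<And>\<nu> i j. \<bar>snd v $ \<nu> $ i $ j\<bar> \<le> c"
  shows "infnorm v \<le> c"
  unfolding infnorm_Max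
proof (rule Max.boundedI)
  fix y assume "y \<in> (\<lambda>b. \<bar>v \<bullet> b\<bar>) ` Basis"
  then show "y \<le> c"
    using assms by (auto simp: Basis_prod_def Basis_vec_def inner_axis inner_prod_def)
qed auto

text \<open>With L = \<open>linf_opnorm B\<close>, words of length two and three cost L^2 and L^3.
  As L may be below 1, the common bound is (1 + L)^3; this is the origin of the cube in the
  threshold.\<close>

lemma infnorm_coords_mat_push_diff_le:
  assumes \<mu>: "\<mu> \<in> finite_signal_laws" and \<nu>: "\<nu> \<in> finite_signal_laws"
    and le: "\<And>w. w \<in> words23 \<Longrightarrow> \<bar>esig \<mu> w - esig \<nu> w\<bar> \<le> c"
  shows "infnorm (coords (mat_push B \<mu>) - coords (mat_push B \<nu>)) \<le> (1 + linf_opnorm B) ^ 3 * c"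
proof -
  define L where "L = linf_opnorm B"
  have L: "L \<ge> 0" by (simp add: L_def linf_opnorm_nonneg)
  have c: "c \<ge> 0" using le[of "[undefined, undefined]"] by (simp add: order_trans[OF abs_ge_zero])
  note row = sum_row_le_linf_opnorm[of _ _ B, folded L_def]
  have 2: "\<bar>esig (mat_push B \<mu>) [i, j] - esig (mat_push B \<nu>) [i, j]\<bar> \<le> (1 + L) ^ 3 * c" for i j
  proof -
    have "esig (mat_push B \<mu>) [i, j] - esig (mat_push B \<nu>) [i, j] =
        (\<Sum>k\<in>UNIV. B $ i $ k * (\<Sum>l\<in>UNIV. B $ j $ l * (esig \<mu> [k, l] - esig \<nu> [k, l])))"
      by (simp add: esig_mat_push[OF \<mu>] esig_mat_push[OF \<nu>] sum_distrib_left right_diff_distrib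
          sum_subtractf mult.assoc)
    also have "\<bar>\<dots>\<bar> \<le> L * (L * c)"
      by (intro row le) simp
    also have "\<dots> = L ^ 2 * c" by (simp add: power2_eq_square)
    also have "\<dots> \<le> (1 + L) ^ 2 * c"
      using L c by (intro mult_right_mono power_mono) auto
    also have "\<dots> \<le> (1 + L) ^ 3 * c"
      using L c by (intro mult_right_mono power_increasing) auto
    finally show ?thesis .
  qed
  have 3: "\<bar>esig (mat_push B \<mu>) [i, j, k] - esig (mat_push B \<nu>) [i, j, k]\<bar> \<le> (1 + L) ^ 3 * c" for i j k
  proof -
    have "esig (mat_push B \<mu>) [i, j, k] - esig (mat_push B \<nu>) [i, j, k] =
        (\<Sum>k'\<in>UNIV. B $ i $ k' * (\<Sum>l\<in>UNIV. B $ j $ l *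
          (\<Sum>m\<in>UNIV. B $ k $ m * (esig \<mu> [k', l, m] - esig \<nu> [k', l, m]))))"
      by (simp add: esig_mat_push[OF \<mu>] esig_mat_push[OF \<nu>] sum_distrib_left right_diff_distrib
          sum_subtractf mult.assoc)
    also have "\<bar>\<dots>\<bar> \<le> L * (L * (L * c))"
      by (intro row le) simp
    also have "\<dots> = L ^ 3 * c" by (simp add: power3_eq_cube)
    also have "\<dots> \<le> (1 + L) ^ 3 * c"
      using L c by (intro mult_right_mono power_mono) auto
    finally show ?thesis .
  qed
  show ?thesis
    unfolding L_def[symmetric] using 2 3
    by (intro infnorm_coords_le) (simp_all add: coords_def coord0_def coord_def)
qed

section \<open>Recovery of the source\<close>

lemma monomial_mats_invertible:
  assumes "M \<in> monomial_mats"
  shows "invertible M"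
proof -
  obtain c \<pi> where M: "M = diag_mat c ** (\<chi> i j. of_bool (j = \<pi> i))" and c: "\<And>i. c i \<noteq> 0"
    and \<pi>: "\<pi> permutes UNIV"
    using assms unfolding monomial_mats_def by blast
  have "invertible (diag_mat c)"
    using diag_mat_inverse[of c] c unfolding invertible_def by blast
  moreover have "invertible (\<chi> i j. of_bool (j = \<pi> i) :: real ^ 'a ^ 'a)"
    unfolding invertible_left_inverse matrix_left_invertible_ker
  proof (intro allI impI)
    fix x :: "real ^ 'a" assume *: "(\<chi> i j. of_bool (j = \<pi> i)) *v x = 0"
    have "x $ \<pi> i = 0" for i
    proof -
      have "((\<chi> i j. of_bool (j = \<pi> i)) *v x) $ i = (\<Sum>j\<in>UNIV. if j = \<pi> i then x $ j else 0)"
        by (simp add: matrix_vector_mult_def of_bool_def if_distrib[of "\<lambda>c. c * _"] cong: if_cong)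
      then show ?thesis using * by simp
    qed
    then show "x = 0"
      using permutes_surj[OF \<pi>] by (metis surjD vec_eq_iff zero_index)
  qed
  ultimately show ?thesis unfolding M by (rule invertible_mult)
qed

lemma conjugate_norm_le:
  assumes "invertible M"
  shows "norm (M *v (E *v x)) \<le> cond2 M * norm E * norm (M *v x)"
proof -
  have x: "x = matrix_inv M *v (M *v x)"
    using matrix_inv_mult[OF assms] by (simp add: matrix_vector_mul_assoc)
  have "norm (M *v (E *v x)) \<le> spectral_norm M * norm (E *v x)"
    by (rule norm_mult_le_spectral_norm)
  also have "\<dots> \<le> spectral_norm M * (norm E * norm x)"
    by (intro mult_left_mono norm_mult_le_norm spectral_norm_nonneg)
  also have "\<dots> \<le> spectral_norm M * (norm E * (spectral_norm (matrix_inv M) * norm (M *v x)))"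
    using norm_mult_le_spectral_norm[of "matrix_inv M" "M *v x"] x
    by (intro mult_left_mono spectral_norm_nonneg) auto
  finally show ?thesis by (simp add: cond2_def ac_simps)
qed

lemma recovers_within_mat_path:
  assumes A: "invertible A" and "0 < c4"
    and \<Theta>: "\<And>\<theta>. \<theta> \<in> \<Theta> \<Longrightarrow> \<exists>M\<in>monomial_mats. \<exists>E.
      cond2 M \<le> c4 \<and> norm E \<le> \<epsilon> / c4 \<and> \<theta> = M ** (mat 1 + E) ** matrix_inv A"
  shows "recovers_within \<epsilon> \<Theta> (mat_path A s) s"
  unfolding recovers_within_def
proof
  fix \<theta> assume "\<theta> \<in> \<Theta>"
  then obtain M E where M: "M \<in> monomial_mats" "cond2 M \<le> c4" and E: "norm E \<le> \<epsilon> / c4"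
    and \<theta>: "\<theta> = M ** (mat 1 + E) ** matrix_inv A"
    using \<Theta> by blast
  show "\<exists>M\<in>monomial_mats. (SUP t. ennreal (norm (\<theta> *v apply_bcontfun (mat_path A s) t - M *v apply_bcontfun s t)
        / norm (M *v apply_bcontfun s t) * of_bool (apply_bcontfun s t \<noteq> 0))) \<le> ennreal \<epsilon>"
  proof (intro bexI[OF _ M(1)] SUP_least ennreal_leI)
    fix t
    define x where "x = apply_bcontfun s t"
    have "0 \<le> \<epsilon> / c4" using E norm_ge_zero order_trans by blast
    then have eps: "0 \<le> \<epsilon>" using \<open>0 < c4\<close> by (simp add: zero_le_divide_iff)
    have "matrix_inv A *v (A *v x) = x"
      using matrix_inv_mult[OF A] by (simp add: matrix_vector_mul_assoc)
    then have "\<theta> *v (A *v x) = M *v ((mat 1 + E) *v x)"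
      by (simp add: \<theta> matrix_vector_mul_assoc[symmetric])
    then have "\<theta> *v (A *v x) - M *v x = M *v (E *v x)"
      by (simp add: matrix_vector_mult_add_rdistrib matrix_vector_right_distrib)
    then have "norm (\<theta> *v (A *v x) - M *v x) \<le> cond2 M * norm E * norm (M *v x)"
      using conjugate_norm_le[OF monomial_mats_invertible[OF M(1)]] by simp
    \<comment> \<open>The perturbation has size \<epsilon> / c4 precisely so that multiplying by the
      bound c4 on \<open>cond2 M\<close> gives \<epsilon>.\<close>
    also have "\<dots> \<le> c4 * (\<epsilon> / c4) * norm (M *v x)"
      using M(2) E \<open>0 < c4\<close> by (intro mult_right_mono mult_mono) auto
    finally have "norm (\<theta> *v (A *v x) - M *v x) \<le> \<epsilon> * norm (M *v x)" using \<open>0 < c4\<close> by simp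
    \<comment> \<open>For M x = 0 the quotient has the value 0, which lies below \<epsilon> as
      \<epsilon> is nonnegative.\<close>
    then have "norm (\<theta> *v (A *v x) - M *v x) / norm (M *v x) \<le> \<epsilon>"
      using eps by (cases "norm (M *v x) = 0") (simp_all add: field_simps)
    then show "norm (\<theta> *v apply_bcontfun (mat_path A s) t - M *v apply_bcontfun s t)
        / norm (M *v apply_bcontfun s t) * of_bool (apply_bcontfun s t \<noteq> 0) \<le> \<epsilon>"
      using eps by (simp add: x_def)
  qed
qed

lemma robustness_constants_perturbation:
  assumes "robustness_constants \<S> A \<Phi> c0 c1 c2 c3 c4" "\<epsilon> > 0" "\<mu> \<in> signal_laws_dot"
    "dissim \<S> \<mu> < delta_tilde c0 c1 c2 \<epsilon>" "\<theta> \<in> \<Phi> (mat_push A \<mu>)"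
  shows "\<exists>M\<in>monomial_mats. \<exists>E. norm M \<le> c3 \<and> cond2 M \<le> c4 \<and> norm E \<le> \<epsilon> \<and>
    \<theta> = M ** (mat 1 + E) ** matrix_inv A"
  using assms unfolding robustness_constants_def by blast

text \<open>Degenerate laws near \<open>\<S>\<close> are excluded by the robustness property itself: if
  \<open>esig \<mu> [i, i] = 0\<close>, then the mixtures \<open>(1 - s) \<mu> + s \<S>\<close> are at least as close to \<open>\<S>\<close>, but their
  covariances degenerate as \<open>s \<rightarrow> 0\<close>, so that the whitening matrices \<open>R\<close> blow up, contradicting
  the uniform bound on \<open>M (I + E) A\<^sup>-\<^sup>1\<close>.\<close>

lemma nondegenerate_near_source:
  fixes \<S> \<mu> :: "'d::finite path measure"
  assumes \<S>: "\<S> \<in> source_laws" and A: "invertible A" and "\<Delta> > 0"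
    and \<Phi>: "inversion_map (kappa_bound A \<S> \<Delta>) \<Phi>"
    and robust: "robustness_constants \<S> A \<Phi> c0 c1 c2 c3 c4" and "\<epsilon> > 0"
    and \<mu>: "\<mu> \<in> finite_signal_laws" and near: "dissim \<S> \<mu> < delta_tilde c0 c1 c2 \<epsilon>"
  shows "\<mu> \<in> signal_laws_dot"
proof (rule ccontr)
  assume "\<mu> \<notin> signal_laws_dot"
  then obtain i where i: "esig \<mu> [i, i] = 0"
    using \<mu> by (auto simp: signal_laws_dot_def finite_signal_laws_def)
  note S = source_lawsD[OF \<S>]
  define \<kappa> where "\<kappa> = kappa_bound A \<S> \<Delta>"
  have ne: "(Xi1 \<kappa> :: (real ^ 'd ^ 'd) set) \<noteq> {}"
    unfolding \<kappa>_def by (rule Xi1_kappa_bound_nonempty[OF S(1,2) A \<open>\<Delta> > 0\<close>])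
  have \<kappa>: "\<kappa> \<ge> 0"
  proof -
    obtain \<theta> :: "real ^ 'd ^ 'd" where \<theta>: "\<theta> \<in> Xi1 \<kappa>" using ne by blast
    have "0 < norm (axis undefined 1 :: real ^ 'd)" by simp
    also have "\<dots> \<le> \<kappa> * norm (\<theta> *v axis undefined 1)" by (rule Xi1_lower_bound[OF \<theta>])
    finally show ?thesis by (metis norm_ge_zero zero_less_mult_iff not_less order_less_imp_le)
  qed
  have c3: "c3 > 0" using robust by (simp add: robustness_constants_def)
  \<comment> \<open>A bound for all whitening matrices R that occur: \<kappa> strips \<theta> from
    \<theta> R, and the other factors bound M (I + E) A^{-1}.\<close>
  define K where "K = \<kappa> * (c3 * ((1 + \<epsilon>) * norm (matrix_inv A)))"
  define e where "e = (axis i 1 :: real ^ 'd)"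
  define a where "a = esig \<S> [i, i]"
  define n where "n = norm (A *v e)"
  have a: "a > 0" using S(3) by (simp add: a_def)
  \<comment> \<open>In a semidefinite matrix a zero on the diagonal kills the whole column.\<close>
  have C\<mu>: "C_mat \<mu> *v e = 0"
  proof (rule psd_null_vector[OF matrix_vector_mul_linear _ subspace_UNIV _ C_mat_psd[OF \<mu>]])
    show "x \<bullet> (C_mat \<mu> *v y) = (C_mat \<mu> *v x) \<bullet> y" for x y
      using transpose_C_mat transpose_eq_iff_inner by blast
    show "e \<bullet> (C_mat \<mu> *v e) = 0"
      using i by (simp add: e_def matrix_vector_mult_basis column_def C_mat_diag inner_axis')
  qed auto
  \<comment> \<open>The second-order coordinates of a source are diagonal, so e is an
    eigenvector.\<close>
  have C\<S>: "C_mat \<S> *v e = a *\<^sub>R e"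
  proof -
    have "C_mat \<S> $ k $ i = a * (if k = i then 1 else 0)" for k
      using S(4)[of k i] S(4)[of i k] by (cases "k = i") (simp_all add: C_mat_def coord0_def transpose_def a_def)
    then show ?thesis
      unfolding e_def matrix_vector_mult_basis by (simp add: column_def vec_eq_iff axis_def)
  qed
  \<comment> \<open>A positive weight s makes the diagonal of the mixture positive and its
    covariance invertible, so that both robustness and the existence of minimizers apply to
    it.\<close>
  have key: "1 \<le> K\<^sup>2 * s * a * n\<^sup>2" if s: "0 < s" "s < 1" for s
  proof -
    define m where "m = mixture s \<mu> \<S>"
    have m: "m \<in> finite_signal_laws" "\<And>w. w \<in> words23 \<Longrightarrow> esig m w = (1 - s) * esig \<mu> w + s * esig \<S> w"
      unfolding m_def using mixture_finite_signal_laws[OF _ _ \<mu> S(1), of s] s by auto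
    have pos: "esig m [j, j] > 0" for j
      using m(2)[of "[j, j]"] s esig_diag_nonneg[OF \<mu>, of j] S(3)[of j] by (simp add: add_nonneg_pos)
    then have mdot: "m \<in> signal_laws_dot"
      using m(1) by (auto simp: signal_laws_dot_def finite_signal_laws_def less_le)
    have C: "C_mat m = (1 - s) *\<^sub>R C_mat \<mu> + s *\<^sub>R C_mat \<S>"
      by (simp add: vec_eq_iff C_mat_def coord0_def transpose_def m(2) field_simps)
    have Cv: "C_mat m *v x = (1 - s) *\<^sub>R (C_mat \<mu> *v x) + s *\<^sub>R (C_mat \<S> *v x)" for x
      unfolding C by (simp add: matrix_vector_mult_add_rdistrib scaleR_matrix_vector_assoc)
    have "C_mat m *v x \<noteq> 0" if "x \<noteq> 0" for x
    proof -
      have "0 < (1 - s) * (x \<bullet> (C_mat \<mu> *v x)) + s * (x \<bullet> (C_mat \<S> *v x))"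
        using s C_mat_psd[OF \<mu>, of x] pos_def_matD(2)[OF pos_def_C_mat[OF S(1,2)] that]
        by (intro add_nonneg_pos mult_nonneg_nonneg mult_pos_pos) auto
      also have "\<dots> = x \<bullet> (C_mat m *v x)"
        unfolding Cv by (simp add: inner_right_distrib)
      finally show ?thesis by auto
    qed
    then have Cinv: "invertible (C_mat m)"
      unfolding invertible_left_inverse matrix_left_invertible_ker by blast
    define \<nu> where "\<nu> = mat_push A m"
    have \<nu>: "\<nu> \<in> finite_signal_laws" unfolding \<nu>_def by (rule mat_push_finite_signal_laws[OF m(1) A])
    have C\<nu>: "C_mat \<nu> = A ** C_mat m ** transpose A" unfolding \<nu>_def by (rule C_mat_mat_push[OF m(1)])
    then have \<nu>inv: "invertible (C_mat \<nu>)"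
      using A Cinv by (simp add: invertible_mult transpose_invertible)
    note R = R_mat[OF \<nu> \<nu>inv]
    \<comment> \<open>The mixture lies on the segment from \<open>coords \<mu>\<close> to
      \<open>coords \<S>\<close>, so homogeneity multiplies the dissimilarity by 1 - s.\<close>
    have "coords m = coords \<S> + (1 - s) *\<^sub>R (coords \<mu> - coords \<S>)"
      by (simp add: coords_def coord0_def coord_def vec_eq_iff m(2) algebra_simps)
    then have "dissim \<S> m = (1 - s) * dissim \<S> \<mu>"
      using s by (simp add: dissim_def phi_S_scale)
    also have "\<dots> \<le> dissim \<S> \<mu>"
      using s phi_S_nonneg[OF S(1)] by (intro mult_left_le_one_le) (auto simp: dissim_def)
    finally have mnear: "dissim \<S> m < delta_tilde c0 c1 c2 \<epsilon>" using near by linarith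
    obtain \<theta> where \<theta>: "\<theta> \<in> Xi1 \<kappa>" "\<theta> ** R_mat \<nu> \<in> \<Phi> \<nu>"
      using inversion_map_nonempty[OF \<Phi>[folded \<kappa>_def] ne \<nu> \<nu>inv] .
    obtain M E where M: "norm M \<le> c3" and E: "norm E \<le> \<epsilon>"
      and eq: "\<theta> ** R_mat \<nu> = M ** (mat 1 + E) ** matrix_inv A"
      using robustness_constants_perturbation[OF robust \<open>\<epsilon> > 0\<close> mdot mnear \<theta>(2)[unfolded \<nu>_def]]
      unfolding \<nu>_def by blast
    have bound: "norm (R_mat \<nu> *v z) \<le> K * norm z" for z
    proof -
      define y where "y = matrix_inv A *v z"
      have "\<theta> *v (R_mat \<nu> *v z) = M *v (y + E *v y)"
      proof -
        have "\<theta> *v (R_mat \<nu> *v z) = M *v ((mat 1 + E) *v y)"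
          by (simp only: y_def matrix_vector_mul_assoc matrix_mul_assoc eq)
        then show ?thesis by (simp only: matrix_vector_mult_add_rdistrib matrix_vector_mul_lid)
      qed
      then have "norm (\<theta> *v (R_mat \<nu> *v z)) \<le> norm M * norm (y + E *v y)"
        by (simp add: norm_mult_le_norm)
      also have "\<dots> \<le> c3 * (norm y + norm E * norm y)"
        using M c3 norm_mult_le_norm[of E y] by (intro mult_mono order_trans[OF norm_triangle_ineq]) auto
      also have "\<dots> \<le> c3 * (norm y + \<epsilon> * norm y)"
        using E c3 by (intro mult_left_mono add_left_mono mult_right_mono) auto
      also have "\<dots> = c3 * ((1 + \<epsilon>) * norm y)" by (simp add: algebra_simps)
      also have "\<dots> \<le> c3 * ((1 + \<epsilon>) * (norm (matrix_inv A) * norm z))"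
        using c3 \<open>\<epsilon> > 0\<close> unfolding y_def by (intro mult_left_mono norm_mult_le_norm) auto
      finally have "\<kappa> * norm (\<theta> *v (R_mat \<nu> *v z)) \<le> \<kappa> * (c3 * ((1 + \<epsilon>) * (norm (matrix_inv A) * norm z)))"
        using \<kappa> by (intro mult_left_mono) auto
      then show ?thesis
        using Xi1_lower_bound[OF \<theta>(1), of "R_mat \<nu> *v z"] by (simp add: K_def mult.assoc)
    qed
    \<comment> \<open>The test vector z = C y is chosen so that R^2 z = y. Then |R z|^2 = z
      \<bullet> y = s a is linear in s, whereas |z|^2 = (s a n)^2 is quadratic.\<close>
    define y where "y = transpose (matrix_inv A) *v e"
    define z where "z = C_mat \<nu> *v y"
    have "transpose A ** transpose (matrix_inv A) = mat 1"
      using matrix_inv_mult(2)[OF A] by (metis matrix_transpose_mul transpose_mat)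
    then have Ay: "transpose A *v y = e" by (simp only: y_def matrix_vector_mul_assoc matrix_vector_mul_lid)
    have "z = A *v (C_mat m *v (transpose A *v y))"
      by (simp only: z_def C\<nu> matrix_vector_mul_assoc matrix_mul_assoc)
    then have z: "z = (s * a) *\<^sub>R (A *v e)"
      by (simp only: Ay Cv C\<mu> C\<S>) (simp add: matrix_vector_mult_scaleR)
    have "(norm (R_mat \<nu> *v z))\<^sup>2 = (R_mat \<nu> *v z) \<bullet> (R_mat \<nu> *v z)"
      by (rule power2_norm_eq_inner)
    also have "\<dots> = z \<bullet> ((R_mat \<nu> ** R_mat \<nu>) *v z)"
      by (simp add: pos_def_matD(1)[OF R(1)] matrix_vector_mul_assoc[symmetric])
    also have "\<dots> = z \<bullet> y"
      using matrix_inv_mult(2)[OF \<nu>inv] by (simp add: R(2) z_def matrix_vector_mul_assoc)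
    also have "\<dots> = (s * a) * (e \<bullet> (transpose A *v y))"
      using dot_lmul_matrix[of y A e] by (simp add: z inner_commute)
    also have "\<dots> = s * a" unfolding Ay by (simp add: e_def)
    finally have "s * a = (norm (R_mat \<nu> *v z))\<^sup>2" by simp
    also have "\<dots> \<le> (K * norm z)\<^sup>2"
      using bound by (intro power_mono) auto
    also have "\<dots> = (s * a) * (K\<^sup>2 * s * a * n\<^sup>2)"
      using s a by (simp add: z n_def power2_eq_square ac_simps)
    finally show ?thesis using s a by simp
  qed
  \<comment> \<open>Small enough to bring K^2 a n^2 s below 1; the 2 keeps s itself below 1 even if
    K^2 a n^2 is 0.\<close>
  define s where "s = 1 / (2 + K\<^sup>2 * a * n\<^sup>2)"
  have d: "K\<^sup>2 * a * n\<^sup>2 \<ge> 0" using a by simp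
  then have "0 < s" "s < 1" by (auto simp: s_def field_simps)
  from key[OF this] have "1 \<le> (K\<^sup>2 * a * n\<^sup>2) * s" by (simp add: ac_simps)
  moreover have "(K\<^sup>2 * a * n\<^sup>2) * s < 1" using d by (simp add: s_def divide_less_eq)
  ultimately show False by simp
qed

lemma delta_tilde_pos:
  assumes "0 < c0" "0 < c1" "0 < c2" "0 < \<epsilon>"
  shows "0 < delta_tilde c0 c1 c2 \<epsilon>"
proof -
  have "0 < \<epsilon> / (c2 + \<epsilon>)" using assms by simp
  then have "0 < c1\<^sup>2 * (\<epsilon> / (c2 + \<epsilon>))\<^sup>2"
    using assms(2) by (intro mult_pos_pos zero_less_power)
  then show ?thesis using assms(1) by (simp add: delta_tilde_def)
qed

lemma recovers_within_close_law:
  fixes \<S> \<mu> :: "'d::finite path measure"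
  assumes \<S>: "\<S> \<in> source_laws" and A: "invertible A" and "\<Delta> > 0"
    and \<Phi>: "inversion_map (kappa_bound A \<S> \<Delta>) \<Phi>"
    and robust: "robustness_constants \<S> A \<Phi> c0 c1 c2 c3 c4" and "\<epsilon> > 0"
    and \<mu>: "\<mu> \<in> finite_signal_laws"
    and close: "\<And>w. w \<in> words23 \<Longrightarrow> \<bar>esig \<mu> w - esig (mat_push A \<S>) w\<bar> \<le> \<gamma>"
    and \<gamma>: "(1 + linf_opnorm (matrix_inv A)) ^ 3 * \<gamma> < eta_phi \<S> (delta_tilde c0 c1 c2 (\<epsilon> / c4))"
  shows "recovers_within \<epsilon> (\<Phi> \<mu>) (mat_path A s) s"
proof -
  have c: "c0 > 0" "c1 > 0" "c2 > 0" "c4 > 0" using robust by (auto simp: robustness_constants_def)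
  note S = source_lawsD[OF \<S>]
  define B where "B = matrix_inv A"
  have B: "invertible B" "A ** B = mat 1" "B ** A = mat 1"
    using matrix_inv_mult[OF A] unfolding B_def invertible_def by blast+
  have \<epsilon>': "\<epsilon> / c4 > 0" using \<open>\<epsilon> > 0\<close> c by simp
  have d: "delta_tilde c0 c1 c2 (\<epsilon> / c4) > 0"
    by (rule delta_tilde_pos[OF c(1-3) \<epsilon>'])
  \<comment> \<open>The law that produces \<mu> when mixed by A, hence the one to which robustness
    has to be applied.\<close>
  define \<nu> where "\<nu> = mat_push B \<mu>"
  have \<nu>: "\<nu> \<in> finite_signal_laws" unfolding \<nu>_def by (rule mat_push_finite_signal_laws[OF \<mu> B(1)])
  have A\<nu>: "mat_push A \<nu> = \<mu>"
    unfolding \<nu>_def using finite_signal_lawsD(1)[OF \<mu>] by (simp add: mat_push_mat_push B mat_push_mat_1)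
  have BX: "mat_push B (mat_push A \<S>) = \<S>"
    using finite_signal_lawsD(1)[OF S(1)] by (simp add: mat_push_mat_push B mat_push_mat_1)
  have "infnorm (coords \<nu> - coords \<S>) \<le> (1 + linf_opnorm B) ^ 3 * \<gamma>"
    using infnorm_coords_mat_push_diff_le[OF \<mu> mat_push_finite_signal_laws[OF S(1) A] close, of B]
    unfolding BX \<nu>_def .
  then have near: "dissim \<S> \<nu> < delta_tilde c0 c1 c2 (\<epsilon> / c4)"
    unfolding dissim_def using \<gamma> by (intro eta_phi_threshold(2)[OF \<S> d]) (simp add: B_def)
  have dot: "\<nu> \<in> signal_laws_dot"
    by (rule nondegenerate_near_source[OF \<S> A \<open>\<Delta> > 0\<close> \<Phi> robust \<epsilon>' \<nu> near])
  show ?thesis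
  proof (rule recovers_within_mat_path[OF A c(4)])
    fix \<theta> assume "\<theta> \<in> \<Phi> \<mu>"
    then show "\<exists>M\<in>monomial_mats. \<exists>E. cond2 M \<le> c4 \<and> norm E \<le> \<epsilon> / c4 \<and> \<theta> = M ** (mat 1 + E) ** matrix_inv A"
      using robustness_constants_perturbation[OF robust \<epsilon>' dot near, of \<theta>] unfolding A\<nu> by blast
  qed
qed

section \<open>Estimators\<close>

lemma finite_words23: "finite (words23 :: 'd::finite list set)"
  by (rule finite_subset[OF _ finite_lists_length_le[of UNIV 3]]) (auto simp: words23_def)

lemma words23_nonempty: "words23 \<noteq> {}"
  using words23_mem(1) by blast

lemma dot_estimator_mem:
  assumes "dot_estimator P \<mu>hat" "\<omega> \<in> space P"
  shows "\<mu>hat n \<omega> \<in> finite_signal_laws"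
proof -
  have "\<mu>hat n \<in> P \<rightarrow>\<^sub>M restrict_space (prob_algebra borel) signal_laws_dot"
    using assms(1) by (simp add: dot_estimator_def)
  then have "\<mu>hat n \<omega> \<in> space (restrict_space (prob_algebra borel) signal_laws_dot)"
    using assms(2) by (rule measurable_space)
  then show ?thesis
    using signal_laws_dot_subset by (auto simp: space_restrict_space)
qed

lemma esig_estimator_measurable:
  fixes \<mu>hat :: "nat \<Rightarrow> 'w \<Rightarrow> 'd::finite path measure"
  assumes est: "dot_estimator P \<mu>hat" and w: "sig w \<in> borel_measurable (borel :: 'd path measure)"
  shows "(\<lambda>\<omega>. esig (\<mu>hat n \<omega>) w) \<in> borel_measurable P"
proof -
  have "\<mu>hat n \<in> P \<rightarrow>\<^sub>M prob_algebra borel"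
    using est by (auto simp: dot_estimator_def measurable_restrict_space2_iff)
  then show ?thesis
    unfolding esig_def
    by (rule measurable_compose[OF measurable_prob_algebraD integral_measurable_subprob_algebra[OF w]])
qed

text \<open>The error is a maximum over finitely many words. Measurability matters because
  \<open>with_prob_at_least\<close> asks for a measurable event.\<close>

lemma est_error_event_measurable:
  fixes \<mu>hat :: "nat \<Rightarrow> 'w \<Rightarrow> 'd::finite path measure"
  assumes est: "dot_estimator P \<mu>hat"
    and sig: "\<And>w. w \<in> words23 \<Longrightarrow> sig w \<in> borel_measurable (borel :: 'd path measure)"
  shows "{\<omega> \<in> space P. est_error \<mu>hat \<X> n \<omega> < c} \<in> sets P"
proof -
  have "{\<omega> \<in> space P. est_error \<mu>hat \<X> n \<omega> < c} =
      {\<omega> \<in> space P. \<forall>w\<in>words23. \<bar>esig (\<mu>hat n \<omega>) w - esig \<X> w\<bar> < c}"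
    unfolding est_error_def using finite_words23 words23_nonempty by (subst Max_less_iff) auto
  also have "\<dots> \<in> sets P"
  proof (rule sets.sets_Collect_finite_All'[OF _ finite_words23 words23_nonempty])
    fix w :: "'d list" assume "w \<in> words23"
    then have [measurable]: "(\<lambda>\<omega>. esig (\<mu>hat n \<omega>) w) \<in> borel_measurable P"
      by (intro esig_estimator_measurable[OF est] sig)
    show "{\<omega> \<in> space P. \<bar>esig (\<mu>hat n \<omega>) w - esig \<X> w\<bar> < c} \<in> sets P" by measurable
  qed
  finally show ?thesis .
qed

lemma le_est_error: "w \<in> words23 \<Longrightarrow> \<bar>esig (\<mu>hat n \<omega>) w - esig \<X> w\<bar> \<le> est_error \<mu>hat \<X> n \<omega>"
  unfolding est_error_def using finite_words23 by (intro Max_ge) auto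

lemma OP_witness_prob:
  assumes "prob_space P" "OP_witness P \<gamma> \<alpha> (1 - q) m M" "m \<le> real n"
    and meas: "{\<omega> \<in> space P. \<gamma> n \<omega> < M * \<alpha> n} \<in> sets P"
  shows "q \<le> measure P {\<omega> \<in> space P. \<gamma> n \<omega> < M * \<alpha> n}"
proof -
  interpret prob_space P by fact
  have "measure P {\<omega> \<in> space P. \<gamma> n \<omega> \<ge> M * \<alpha> n} \<le>
      (SUP n\<in>{n. m \<le> real n}. measure P {\<omega> \<in> space P. \<gamma> n \<omega> \<ge> M * \<alpha> n})"
    \<comment> \<open>A supremum of reals dominates its members only for bounded families; here
      probabilities are bounded by 1.\<close>
    using assms(3) by (intro cSUP_upper bdd_aboveI2[of _ _ 1]) auto
  also have "\<dots> \<le> 1 - q" using assms(2) by (simp add: OP_witness_def)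
  finally have "measure P {\<omega> \<in> space P. \<gamma> n \<omega> \<ge> M * \<alpha> n} \<le> 1 - q" .
  moreover have "measure P {\<omega> \<in> space P. \<gamma> n \<omega> \<ge> M * \<alpha> n} = 1 - measure P {\<omega> \<in> space P. \<gamma> n \<omega> < M * \<alpha> n}"
    using prob_compl[OF meas] by (simp add: set_diff_eq not_less conj_commute cong: conj_cong)
  ultimately show ?thesis by linarith
qed

theorem proposition6p4:
  fixes P :: "'w measure"
    and S X :: "'w \<Rightarrow> 'd::finite path"
    and A :: "real ^ 'd ^ 'd"
    and \<S> \<X> :: "'d path measure"
    and \<Phi> :: "'d path measure \<Rightarrow> (real ^ 'd ^ 'd) set"
    and \<mu>hat :: "nat \<Rightarrow> 'w \<Rightarrow> 'd path measure"
    and \<alpha> :: "nat \<Rightarrow> real"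
    and \<Delta>\<kappa> c0 c1 c2 c3 c4 :: real
  assumes dim: "CARD('d) \<ge> 2"
    and P: "prob_space P"
    and S: "S \<in> P \<rightarrow>\<^sub>M borel" "\<S> = distr P borel S"
    and X: "\<And>\<omega>. \<omega> \<in> space P \<Longrightarrow> X \<omega> = mat_path A (S \<omega>)" "\<X> = mat_push A \<S>"
    and cause: "(\<S>, A) \<in> causes"
    and \<Delta>\<kappa>: "\<Delta>\<kappa> > 0"
    and \<Phi>: "inversion_map (kappa_bound A \<S> \<Delta>\<kappa>) \<Phi>"
    and robust: "robustness_constants \<S> A \<Phi> c0 c1 c2 c3 c4"
    and est: "dot_estimator P \<mu>hat" "consistent_estimator P \<mu>hat \<X>"
    and rate: "convergence_rate \<alpha>" "is_OP P (est_error \<mu>hat \<X>) \<alpha>"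
  shows "bij_betw (omega_phi \<S>) {0..} {0..} \<and>
    (\<forall>\<epsilon> q. 0 < \<epsilon> \<and> 0 \<le> q \<and> q < 1 \<longrightarrow>
      (\<exists>n0. \<forall>n\<ge>n0.
        with_prob_at_least P q (\<lambda>\<omega>. recovers_within \<epsilon> (\<Phi> (\<mu>hat n \<omega>)) (X \<omega>) (S \<omega>))) \<and>
      (\<forall>m M. OP_witness P (est_error \<mu>hat \<X>) \<alpha> (1 - q) m M \<longrightarrow>
        sample_thresholds A \<S> c0 c1 c2 c4 \<alpha> m M \<epsilon> \<noteq> {} \<and>
        (\<forall>n \<ge> (LEAST k. k \<in> sample_thresholds A \<S> c0 c1 c2 c4 \<alpha> m M \<epsilon>).
          with_prob_at_least P q (\<lambda>\<omega>. recovers_within \<epsilon> (\<Phi> (\<mu>hat n \<omega>)) (X \<omega>) (S \<omega>)))))"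
proof (intro conjI allI impI)
  have \<S>: "\<S> \<in> source_laws" and A: "invertible A"
    using cause by (auto simp: causes_def)
  note SD = source_lawsD[OF \<S>]
  show "bij_betw (omega_phi \<S>) {0..} {0..}"
    by (rule bij_betw_omega_phi[OF \<S>])
  fix \<epsilon> q :: real assume "0 < \<epsilon> \<and> 0 \<le> q \<and> q < 1"
  then have \<epsilon>: "0 < \<epsilon>" and q: "0 \<le> q" "q < 1" by auto
  define good where "good n \<longleftrightarrow>
    with_prob_at_least P q (\<lambda>\<omega>. recovers_within \<epsilon> (\<Phi> (\<mu>hat n \<omega>)) (X \<omega>) (S \<omega>))" for n
  define L where "L = (1 + linf_opnorm (matrix_inv A)) ^ 3"
  define \<eta> where "\<eta> = eta_phi \<S> (delta_tilde c0 c1 c2 (\<epsilon> / c4))"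
  have c: "c0 > 0" "c1 > 0" "c2 > 0" "c4 > 0"
    using robust by (auto simp: robustness_constants_def)
  have L: "L > 0"
    unfolding L_def using linf_opnorm_nonneg[of "matrix_inv A"] by (intro zero_less_power) linarith
  have "\<epsilon> / c4 > 0" using \<epsilon> c by simp
  then have "delta_tilde c0 c1 c2 (\<epsilon> / c4) > 0"
    by (rule delta_tilde_pos[OF c(1-3)])
  then have \<eta>: "\<eta> > 0"
    unfolding \<eta>_def by (rule eta_phi_threshold(1)[OF \<S>])
  \<comment> \<open>Monotonicity carries the threshold inequality from its first index to all later
    ones, and the limit 0 makes the set of thresholds nonempty.\<close>
  have dec: "decseq \<alpha>" and null: "\<alpha> \<longlonglongrightarrow> 0"
    using rate(1) by (auto simp: convergence_rate_def decseq_Suc_iff less_imp_le)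
  have thresholds: "sample_thresholds A \<S> c0 c1 c2 c4 \<alpha> m M \<epsilon> = {n. m \<le> real n \<and> \<alpha> n < \<eta> / (L * M)}" for m M
    by (simp add: sample_thresholds_def L_def \<eta>_def)
  have nonempty: "sample_thresholds A \<S> c0 c1 c2 c4 \<alpha> m M \<epsilon> \<noteq> {}"
    if "OP_witness P (est_error \<mu>hat \<X>) \<alpha> (1 - q) m M" for m M
  proof -
    have "\<eta> / (L * M) > 0" using that \<eta> L by (simp add: OP_witness_def)
    then have "\<forall>\<^sub>F n in sequentially. \<alpha> n < \<eta> / (L * M)"
      by (rule order_tendstoD(2)[OF null])
    moreover have "\<forall>\<^sub>F n in sequentially. m \<le> real n"
      using filterlim_real_sequentially by (simp add: filterlim_at_top)
    ultimately have "\<forall>\<^sub>F n in sequentially. m \<le> real n \<and> \<alpha> n < \<eta> / (L * M)"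
      by eventually_elim auto
    then show ?thesis
      unfolding thresholds by (auto simp: eventually_sequentially)
  qed
  have good: "good n" if W: "OP_witness P (est_error \<mu>hat \<X>) \<alpha> (1 - q) m M"
    and n: "n \<ge> (LEAST k. k \<in> sample_thresholds A \<S> c0 c1 c2 c4 \<alpha> m M \<epsilon>)" for m M n
  proof -
    define k where "k = (LEAST k. k \<in> sample_thresholds A \<S> c0 c1 c2 c4 \<alpha> m M \<epsilon>)"
    have "k \<in> sample_thresholds A \<S> c0 c1 c2 c4 \<alpha> m M \<epsilon>"
      unfolding k_def using nonempty[OF W]
      by (intro LeastI_ex[of "\<lambda>k. k \<in> sample_thresholds A \<S> c0 c1 c2 c4 \<alpha> m M \<epsilon>"]) blast
    then have k: "m \<le> real k" "\<alpha> k < \<eta> / (L * M)" by (auto simp: thresholds)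
    have kn: "k \<le> n" using n by (simp add: k_def)
    have M: "M > 0" using W by (simp add: OP_witness_def)
    have "\<alpha> n < \<eta> / (L * M)" using decseqD[OF dec kn] k(2) by linarith
    then have small: "L * (M * \<alpha> n) < \<eta>"
      using L M by (simp add: field_simps)
    \<comment> \<open>The strict inequality makes F the exact complement of the event in
      \<open>OP_witness\<close>.\<close>
    define F where "F = {\<omega> \<in> space P. est_error \<mu>hat \<X> n \<omega> < M * \<alpha> n}"
    \<comment> \<open>\<open>sig w\<close> is Borel measurable because \<S> has finite
      coordinates.\<close>
    have F: "F \<in> sets P"
      unfolding F_def by (rule est_error_event_measurable[OF est(1) finite_signal_lawsD(5)[OF SD(1)]])
    have "q \<le> measure P F"
      unfolding F_def
      by (rule OP_witness_prob[OF P W]) (use k(1) kn F in \<open>auto simp: F_def\<close>)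
    moreover have "recovers_within \<epsilon> (\<Phi> (\<mu>hat n \<omega>)) (X \<omega>) (S \<omega>)" if "\<omega> \<in> F" for \<omega>
    proof -
      have \<omega>: "\<omega> \<in> space P" "est_error \<mu>hat \<X> n \<omega> < M * \<alpha> n" using that by (auto simp: F_def)
      have "\<bar>esig (\<mu>hat n \<omega>) w - esig (mat_push A \<S>) w\<bar> \<le> M * \<alpha> n" if "w \<in> words23" for w
        using le_est_error[OF that, of \<mu>hat n \<omega> \<X>] \<omega>(2) X(2) by simp
      then show ?thesis
        unfolding X(1)[OF \<omega>(1)] using small unfolding L_def \<eta>_def
        by (intro recovers_within_close_law[OF \<S> A \<Delta>\<kappa> \<Phi> robust \<epsilon> dot_estimator_mem[OF est(1) \<omega>(1)]])
    qed
    ultimately show ?thesis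
      unfolding good_def with_prob_at_least_def using F by blast
  qed
  have "1 - q > 0" using q by simp
  then obtain m M where "OP_witness P (est_error \<mu>hat \<X>) \<alpha> (1 - q) m M"
    using rate(2) unfolding is_OP_def by blast
  then show "\<exists>n0. \<forall>n\<ge>n0. with_prob_at_least P q (\<lambda>\<omega>. recovers_within \<epsilon> (\<Phi> (\<mu>hat n \<omega>)) (X \<omega>) (S \<omega>))"
    by (intro exI allI impI) (rule good[unfolded good_def])
  show "sample_thresholds A \<S> c0 c1 c2 c4 \<alpha> m M \<epsilon> \<noteq> {}"
    if "OP_witness P (est_error \<mu>hat \<X>) \<alpha> (1 - q) m M" for m M
    by (rule nonempty[OF that])
  show "with_prob_at_least P q (\<lambda>\<omega>. recovers_within \<epsilon> (\<Phi> (\<mu>hat n \<omega>)) (X \<omega>) (S \<omega>))"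
    if "OP_witness P (est_error \<mu>hat \<X>) \<alpha> (1 - q) m M"
      "n \<ge> (LEAST k. k \<in> sample_thresholds A \<S> c0 c1 c2 c4 \<alpha> m M \<epsilon>)" for m M n
    using good[OF that] unfolding good_def .
qed

end
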